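(* Let $\mathcal{C}$ be a pivotal fusion category and let $\mathcal{M},\mathcal{N}$ be $\mathcal{C}$-module categories equipped with $\mathcal{C}$-module traces $\Theta^{\mathcal{M}},\Theta^{\mathcal{N}}$. For every module functor $F:\mathcal{M}\to\mathcal{N}$, the canonical transformation $a_F:F\to F^{ll}$ (defined in the context) to the double left adjoint module functor of $F$ is a module natural isomorphism, and: (i) The isomorphisms $a_F$ are natural with respect to module natural transformations: for every module functor $G:\mathcal{M}\to\mathcal{N}$ and every module natural transformation $\rho:F\to G$, one has $\rho^{ll}\circ a_F=a_G\circ\rho$. (ii) For all module functors $F:\mathcal{M}\to\mathcal{N}$ and $K:\mathcal{N}\to\mathcal{E}$ between $\mathcal{C}$-module categories with $\mathcal{C}$-module traces, $a_{KF}=a_K\circ a_F:K\circ F\to(K\circ F)^{ll}=K^{ll}\circ F^{ll}$, where the right-hand side denotes the horizontal composite of $a_K$ and $a_F$. In particular, these isomorphisms equip the dual category $\mathrm{Fun}_{\mathcal{C}}(\mathcal{M},\mathcal{M})$ with a pivotal structure that is invariant under rescaling of the module trace of $\mathcal{M}$ by a nonzero complex number.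
   Context: All categories are abelian and locally finite over $\mathbb{C}$; functors are additive. A fusion category is a semisimple rigid monoidal $\mathbb{C}$-linear category with tensor product bilinear on morphisms, simple unit $1$ and finitely many isomorphism classes of simple objects (treated as strict). The right dual of $c$ is $c^{*}$ with $\mathrm{ev}_c:c^{*}\otimes c\to1$, $\mathrm{coev}_c:1\to c\otimes c^{*}$; the left dual is ${}^{*}c$ with $\mathrm{ev}'_c:c\otimes{}^{*}c\to1$, $\mathrm{coev}'_c:1\to{}^{*}c\otimes c$; $({}^{*}c)^{*}\cong c\cong{}^{*}(c^{*})$ canonically, treated as identities. A pivotal structure is a monoidal natural isomorphism $a:\mathrm{id}\to(-)^{**}$. A (left) $\mathcal{C}$-module category is a semisimple $\mathbb{C}$-linear abelian category $\mathcal{M}$ with finitely many isomorphism classes of simple objects, a bifunctor $\triangleright:\mathcal{C}\times\mathcal{M}\to\mathcal{M}$ and natural isomorphisms $(c\otimes d)\triangleright m\cong c\triangleright(d\triangleright m)$, $1\triangleright m\cong m$ satisfying the usual pentagon and triangle axioms (suppressed below). A module functor is a functor $F$ with natural isomorphisms $F(c\triangleright m)\cong c\triangleright F(m)$ satisfying the usual pentagon and triangle axioms; module natural transformations are natural transformations compatible with these. The left adjoint $F^{l}$ of a module functor $F$ is a module functor whose constraint is the unique one for which unit and counit of the adjunction are module natural transformations; $F^{ll}=(F^{l})^{l}$. For $\rho:F\to G$, $\rho^{l}:G^{l}\to F^{l}$ is the induced transformation of left adjoints and $\rho^{ll}=(\rho^{l})^{l}:F^{ll}\to G^{ll}$. $\mathrm{Fun}_{\mathcal{C}}(\mathcal{M},\mathcal{M})$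 is the category of module endofunctors and module natural transformations, monoidal under composition, rigid via adjoints, with right dual of $F$ equal to $F^{l}$. For $f\in\mathrm{End}_{\mathcal{M}}(c\triangleright m)$ put $\mathrm{tr}^{\mathcal{C}}(f)=(\mathrm{ev}_c\triangleright\mathrm{id}_m)\circ(a_{{}^{*}c}\triangleright f)\circ(\mathrm{coev}'_c\triangleright\mathrm{id}_m)$. A $\mathcal{C}$-module trace on $\mathcal{M}$ is a family of linear maps $\Theta_m:\mathrm{End}_{\mathcal{M}}(m)\to\mathbb{C}$ that is symmetric ($\Theta_m(g\circ f)=\Theta_n(f\circ g)$ for $f:m\to n$, $g:n\to m$), non-degenerate (the pairing $(f,g)\mapsto\Theta_m(g\circ f)$ on $\mathrm{Hom}(m,n)\times\mathrm{Hom}(n,m)$ is non-degenerate) and $\mathcal{C}$-compatible ($\Theta_{c\triangleright m}=\Theta_m\circ\mathrm{tr}^{\mathcal{C}}$). It determines natural isomorphisms $\eta^{\mathcal{M}}:\mathrm{Hom}_{\mathcal{M}}(m,\tilde m)\to\mathrm{Hom}_{\mathcal{M}}(\tilde m,m)^{*}$, $\eta^{\mathcal{M}}(f)(g)=\Theta^{\mathcal{M}}_m(g\circ f)$. Definition of $a_F$: it is the natural transformation corresponding by the Yoneda lemma (i.e. by post-composition with $a_F(m):F(m)\to F^{ll}(m)$) to the composite of natural isomorphisms, for $n\in\mathcal{N}$, $m\in\mathcal{M}$, $$\mathrm{Hom}_{\mathcal{N}}(n,F(m))\cong\mathrm{Hom}_{\mathcal{M}}(F^{l}(n),m)\xrightarrow{\eta^{\mathcal{M}}}\mathrm{Hom}_{\mathcal{M}}(m,F^{l}(n))^{*}\cong\mathrm{Hom}_{\mathcal{N}}(F^{ll}(m),n)^{*}\xrightarrow{(\eta^{\mathcal{N}})^{-1}}\mathrm{Hom}_{\mathcal{N}}(n,F^{ll}(m)),$$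 where the unlabelled isomorphisms are given by the adjunctions. *)

theory Defs
  imports Complex_Main "HOL-Library.FuncSet"
begin

section \<open>Linear abelian categories\<close>

record ('o, 'a) cat =
  Obj :: "'o set"
  Arr :: "'a set"
  Dom :: "'a \<Rightarrow> 'o"
  Cod :: "'a \<Rightarrow> 'o"
  Id :: "'o \<Rightarrow> 'a"
  Comp :: "'a \<Rightarrow> 'a \<Rightarrow> 'a"  (infixr "\<cdot>\<index>" 55)

definition hom :: "('o, 'a, 'z) cat_scheme \<Rightarrow> 'o \<Rightarrow> 'o \<Rightarrow> 'a set" where
  "hom C x y = {f \<in> Arr C. Dom C f = x \<and> Cod C f = y}"

locale category =
  fixes C :: "('o, 'a, 'z) cat_scheme" (structure)
  assumes Dom_Obj: "f \<in> Arr C \<Longrightarrow> Dom C f \<in> Obj C"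
    and Cod_Obj: "f \<in> Arr C \<Longrightarrow> Cod C f \<in> Obj C"
    and Id_hom: "x \<in> Obj C \<Longrightarrow> Id C x \<in> hom C x x"
    and Comp_hom: "\<lbrakk>f \<in> hom C x y; g \<in> hom C y z\<rbrakk> \<Longrightarrow> g \<cdot> f \<in> hom C x z"
    and Comp_Id_left: "f \<in> hom C x y \<Longrightarrow> Id C y \<cdot> f = f"
    and Comp_Id_right: "f \<in> hom C x y \<Longrightarrow> f \<cdot> Id C x = f"
    and Comp_assoc: "\<lbrakk>f \<in> hom C w x; g \<in> hom C x y; h \<in> hom C y z\<rbrakk>
      \<Longrightarrow> (h \<cdot> g) \<cdot> f = h \<cdot> (g \<cdot> f)"

definition inverse_arrows :: "('o, 'a, 'z) cat_scheme \<Rightarrow> 'a \<Rightarrow> 'a \<Rightarrow> bool" where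
  "inverse_arrows C f g \<longleftrightarrow> f \<in> Arr C \<and> g \<in> hom C (Cod C f) (Dom C f) \<and>
     g \<cdot>\<^bsub>C\<^esub> f = Id C (Dom C f) \<and> f \<cdot>\<^bsub>C\<^esub> g = Id C (Cod C f)"

definition iso :: "('o, 'a, 'z) cat_scheme \<Rightarrow> 'a \<Rightarrow> bool" where
  "iso C f \<longleftrightarrow> (\<exists>g. inverse_arrows C f g)"

definition Inv :: "('o, 'a, 'z) cat_scheme \<Rightarrow> 'a \<Rightarrow> 'a" where
  "Inv C f = (THE g. inverse_arrows C f g)"

definition isomorphic :: "('o, 'a, 'z) cat_scheme \<Rightarrow> 'o \<Rightarrow> 'o \<Rightarrow> bool" where
  "isomorphic C x y \<longleftrightarrow> (\<exists>f \<in> hom C x y. iso C f)"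

definition mono_arrow :: "('o, 'a, 'z) cat_scheme \<Rightarrow> 'a \<Rightarrow> bool" where
  "mono_arrow C f \<longleftrightarrow> f \<in> Arr C \<and>
     (\<forall>w \<in> Obj C. \<forall>g \<in> hom C w (Dom C f). \<forall>h \<in> hom C w (Dom C f).
        f \<cdot>\<^bsub>C\<^esub> g = f \<cdot>\<^bsub>C\<^esub> h \<longrightarrow> g = h)"

definition epi_arrow :: "('o, 'a, 'z) cat_scheme \<Rightarrow> 'a \<Rightarrow> bool" where
  "epi_arrow C f \<longleftrightarrow> f \<in> Arr C \<and>
     (\<forall>w \<in> Obj C. \<forall>g \<in> hom C (Cod C f) w. \<forall>h \<in> hom C (Cod C f) w.
        g \<cdot>\<^bsub>C\<^esub> f = h \<cdot>\<^bsub>C\<^esub> f \<longrightarrow> g = h)"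

definition zero_object :: "('o, 'a, 'z) cat_scheme \<Rightarrow> 'o \<Rightarrow> bool" where
  "zero_object C z \<longleftrightarrow> z \<in> Obj C \<and>
     (\<forall>x \<in> Obj C. (\<exists>!f. f \<in> hom C z x) \<and> (\<exists>!f. f \<in> hom C x z))"

text \<open>A simple object is a nonzero object without proper nonzero subobjects.\<close>

definition simple_object :: "('o, 'a, 'z) cat_scheme \<Rightarrow> 'o \<Rightarrow> bool" where
  "simple_object C x \<longleftrightarrow> x \<in> Obj C \<and> \<not> zero_object C x \<and>
     (\<forall>f. mono_arrow C f \<and> Cod C f = x \<longrightarrow> zero_object C (Dom C f) \<or> iso C f)"

record ('o, 'a) lin_cat = "('o, 'a) cat" +
  Zero :: "'o \<Rightarrow> 'o \<Rightarrow> 'a"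
  Add :: "'a \<Rightarrow> 'a \<Rightarrow> 'a"  (infixl "\<oplus>\<index>" 52)
  Scale :: "complex \<Rightarrow> 'a \<Rightarrow> 'a"

locale linear_category = category C
  for C :: "('o, 'a, 'z) lin_cat_scheme" (structure) +
  assumes Zero_hom: "\<lbrakk>x \<in> Obj C; y \<in> Obj C\<rbrakk> \<Longrightarrow> Zero C x y \<in> hom C x y"
    and Add_hom: "\<lbrakk>f \<in> hom C x y; g \<in> hom C x y\<rbrakk> \<Longrightarrow> f \<oplus> g \<in> hom C x y"
    and Scale_hom: "f \<in> hom C x y \<Longrightarrow> Scale C r f \<in> hom C x y"
    and Add_assoc: "\<lbrakk>f \<in> hom C x y; g \<in> hom C x y; h \<in> hom C x y\<rbrakk>
      \<Longrightarrow> (f \<oplus> g) \<oplus> h = f \<oplus> (g \<oplus> h)"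
    and Add_commute: "\<lbrakk>f \<in> hom C x y; g \<in> hom C x y\<rbrakk> \<Longrightarrow> f \<oplus> g = g \<oplus> f"
    and Add_Zero: "f \<in> hom C x y \<Longrightarrow> f \<oplus> Zero C x y = f"
    and Add_minus: "f \<in> hom C x y \<Longrightarrow> f \<oplus> Scale C (- 1) f = Zero C x y"
    and Scale_Add: "\<lbrakk>f \<in> hom C x y; g \<in> hom C x y\<rbrakk>
      \<Longrightarrow> Scale C r (f \<oplus> g) = Scale C r f \<oplus> Scale C r g"
    and Scale_plus: "f \<in> hom C x y \<Longrightarrow> Scale C (r + s) f = Scale C r f \<oplus> Scale C s f"
    and Scale_Scale: "f \<in> hom C x y \<Longrightarrow> Scale C r (Scale C s f) = Scale C (r * s) f"
    and Scale_one: "f \<in> hom C x y \<Longrightarrow> Scale C 1 f = f"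
    and Comp_Add_right: "\<lbrakk>f \<in> hom C x y; g \<in> hom C x y; h \<in> hom C y z\<rbrakk>
      \<Longrightarrow> h \<cdot> (f \<oplus> g) = (h \<cdot> f) \<oplus> (h \<cdot> g)"
    and Comp_Add_left: "\<lbrakk>f \<in> hom C x y; g \<in> hom C y z; h \<in> hom C y z\<rbrakk>
      \<Longrightarrow> (g \<oplus> h) \<cdot> f = (g \<cdot> f) \<oplus> (h \<cdot> f)"
    and Comp_Scale_right: "\<lbrakk>f \<in> hom C x y; h \<in> hom C y z\<rbrakk>
      \<Longrightarrow> h \<cdot> Scale C r f = Scale C r (h \<cdot> f)"
    and Comp_Scale_left: "\<lbrakk>f \<in> hom C x y; h \<in> hom C y z\<rbrakk>
      \<Longrightarrow> Scale C r h \<cdot> f = Scale C r (h \<cdot> f)"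

definition arrow_sum :: "('o, 'a, 'z) lin_cat_scheme \<Rightarrow> 'o \<Rightarrow> 'o \<Rightarrow> 'a list \<Rightarrow> 'a" where
  "arrow_sum C x y fs = foldr (Add C) fs (Zero C x y)"

definition direct_sum ::
  "('o, 'a, 'z) lin_cat_scheme \<Rightarrow> 'o list \<Rightarrow> 'o \<Rightarrow> (nat \<Rightarrow> 'a) \<Rightarrow> (nat \<Rightarrow> 'a) \<Rightarrow> bool" where
  "direct_sum C xs s i p \<longleftrightarrow> s \<in> Obj C \<and>
     (\<forall>k < length xs. i k \<in> hom C (xs ! k) s \<and> p k \<in> hom C s (xs ! k)) \<and>
     (\<forall>j < length xs. \<forall>k < length xs.
        p j \<cdot>\<^bsub>C\<^esub> i k = (if j = k then Id C (xs ! k) else Zero C (xs ! k) (xs ! j))) \<and>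
     arrow_sum C s s (map (\<lambda>k. i k \<cdot>\<^bsub>C\<^esub> p k) [0..<length xs]) = Id C s"

definition kernel :: "('o, 'a, 'z) lin_cat_scheme \<Rightarrow> 'a \<Rightarrow> 'a \<Rightarrow> bool" where
  "kernel C f k \<longleftrightarrow> f \<in> Arr C \<and> k \<in> Arr C \<and> Cod C k = Dom C f \<and>
     f \<cdot>\<^bsub>C\<^esub> k = Zero C (Dom C k) (Cod C f) \<and>
     (\<forall>w \<in> Obj C. \<forall>h \<in> hom C w (Dom C f). f \<cdot>\<^bsub>C\<^esub> h = Zero C w (Cod C f) \<longrightarrow>
        (\<exists>!u. u \<in> hom C w (Dom C k) \<and> k \<cdot>\<^bsub>C\<^esub> u = h))"

definition cokernel :: "('o, 'a, 'z) lin_cat_scheme \<Rightarrow> 'a \<Rightarrow> 'a \<Rightarrow> bool" where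
  "cokernel C f q \<longleftrightarrow> f \<in> Arr C \<and> q \<in> Arr C \<and> Dom C q = Cod C f \<and>
     q \<cdot>\<^bsub>C\<^esub> f = Zero C (Dom C f) (Cod C q) \<and>
     (\<forall>w \<in> Obj C. \<forall>h \<in> hom C (Cod C f) w. h \<cdot>\<^bsub>C\<^esub> f = Zero C (Dom C f) w \<longrightarrow>
        (\<exists>!u. u \<in> hom C (Cod C q) w \<and> u \<cdot>\<^bsub>C\<^esub> q = h))"

locale abelian_category = linear_category +
  assumes direct_sums: "set xs \<subseteq> Obj C \<Longrightarrow> \<exists>s i p. direct_sum C xs s i p"
    and kernels: "f \<in> Arr C \<Longrightarrow> \<exists>k. kernel C f k"
    and cokernels: "f \<in> Arr C \<Longrightarrow> \<exists>q. cokernel C f q"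
    and mono_normal: "mono_arrow C k \<Longrightarrow> \<exists>f. kernel C f k"
    and epi_normal: "epi_arrow C q \<Longrightarrow> \<exists>f. cokernel C f q"

text \<open>
  Every object is a finite direct sum of simple objects, hence has finite length; together with
  the finite-dimensional morphism spaces this is local finiteness.
\<close>

locale finite_semisimple_category = abelian_category +
  assumes finite_dimensional: "\<lbrakk>x \<in> Obj C; y \<in> Obj C\<rbrakk> \<Longrightarrow>
      \<exists>bs. set bs \<subseteq> hom C x y \<and> (\<forall>f \<in> hom C x y. \<exists>rs. length rs = length bs \<and>
        f = arrow_sum C x y (map2 (Scale C) rs bs))"
    and semisimple: "x \<in> Obj C \<Longrightarrow>
      \<exists>xs i p. (\<forall>y \<in> set xs. simple_object C y) \<and> direct_sum C xs x i p"
    and finitely_many_simples: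
      "\<exists>S. finite S \<and> (\<forall>x. simple_object C x \<longrightarrow> (\<exists>y \<in> S. simple_object C y \<and> isomorphic C x y))"


section \<open>Rigid monoidal, pivotal and fusion categories\<close>

text \<open>\<open>Assoc C x y z\<close> goes from \<open>(x \<otimes> y) \<otimes> z\<close> to \<open>x \<otimes> (y \<otimes> z)\<close>.\<close>

record ('o, 'a) mon_cat = "('o, 'a) lin_cat" +
  TensO :: "'o \<Rightarrow> 'o \<Rightarrow> 'o"  (infixr "\<otimes>\<index>" 70)
  TensA :: "'a \<Rightarrow> 'a \<Rightarrow> 'a"  (infixr "\<boxtimes>\<index>" 70)
  Unit :: "'o"
  Assoc :: "'o \<Rightarrow> 'o \<Rightarrow> 'o \<Rightarrow> 'a"
  Lunit :: "'o \<Rightarrow> 'a"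
  Runit :: "'o \<Rightarrow> 'a"

locale monoidal_category = category C
  for C :: "('o, 'a, 'z) mon_cat_scheme" (structure) +
  assumes Unit_Obj: "Unit C \<in> Obj C"
    and TensO_Obj: "\<lbrakk>x \<in> Obj C; y \<in> Obj C\<rbrakk> \<Longrightarrow> x \<otimes> y \<in> Obj C"
    and TensA_hom: "\<lbrakk>f \<in> hom C x x'; g \<in> hom C y y'\<rbrakk> \<Longrightarrow> f \<boxtimes> g \<in> hom C (x \<otimes> y) (x' \<otimes> y')"
    and TensA_Id: "\<lbrakk>x \<in> Obj C; y \<in> Obj C\<rbrakk> \<Longrightarrow> Id C x \<boxtimes> Id C y = Id C (x \<otimes> y)"
    and TensA_Comp: "\<lbrakk>f \<in> hom C x x'; f' \<in> hom C x' x''; g \<in> hom C y y'; g' \<in> hom C y' y''\<rbrakk>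
      \<Longrightarrow> (f' \<cdot> f) \<boxtimes> (g' \<cdot> g) = (f' \<boxtimes> g') \<cdot> (f \<boxtimes> g)"
    and Assoc_hom: "\<lbrakk>x \<in> Obj C; y \<in> Obj C; z \<in> Obj C\<rbrakk>
      \<Longrightarrow> Assoc C x y z \<in> hom C ((x \<otimes> y) \<otimes> z) (x \<otimes> (y \<otimes> z))"
    and Assoc_iso: "\<lbrakk>x \<in> Obj C; y \<in> Obj C; z \<in> Obj C\<rbrakk> \<Longrightarrow> iso C (Assoc C x y z)"
    and Assoc_natural: "\<lbrakk>f \<in> hom C x x'; g \<in> hom C y y'; h \<in> hom C z z'\<rbrakk>
      \<Longrightarrow> Assoc C x' y' z' \<cdot> ((f \<boxtimes> g) \<boxtimes> h) = (f \<boxtimes> (g \<boxtimes> h)) \<cdot> Assoc C x y z"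
    and Lunit_hom: "x \<in> Obj C \<Longrightarrow> Lunit C x \<in> hom C (Unit C \<otimes> x) x"
    and Lunit_iso: "x \<in> Obj C \<Longrightarrow> iso C (Lunit C x)"
    and Lunit_natural: "f \<in> hom C x y \<Longrightarrow> Lunit C y \<cdot> (Id C (Unit C) \<boxtimes> f) = f \<cdot> Lunit C x"
    and Runit_hom: "x \<in> Obj C \<Longrightarrow> Runit C x \<in> hom C (x \<otimes> Unit C) x"
    and Runit_iso: "x \<in> Obj C \<Longrightarrow> iso C (Runit C x)"
    and Runit_natural: "f \<in> hom C x y \<Longrightarrow> Runit C y \<cdot> (f \<boxtimes> Id C (Unit C)) = f \<cdot> Runit C x"
    and pentagon: "\<lbrakk>w \<in> Obj C; x \<in> Obj C; y \<in> Obj C; z \<in> Obj C\<rbrakk> \<Longrightarrow>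
      (Id C w \<boxtimes> Assoc C x y z) \<cdot> Assoc C w (x \<otimes> y) z \<cdot> (Assoc C w x y \<boxtimes> Id C z)
        = Assoc C w x (y \<otimes> z) \<cdot> Assoc C (w \<otimes> x) y z"
    and triangle: "\<lbrakk>x \<in> Obj C; y \<in> Obj C\<rbrakk> \<Longrightarrow>
      (Id C x \<boxtimes> Lunit C y) \<cdot> Assoc C x (Unit C) y = Runit C x \<boxtimes> Id C y"

text \<open>
  \<open>dual_pair C x y e n\<close>: the object \<open>y\<close> is a right dual of \<open>x\<close> (and \<open>x\<close> a left dual of \<open>y\<close>) with
  evaluation \<open>e : y \<otimes> x \<rightarrow> 1\<close> and coevaluation \<open>n : 1 \<rightarrow> x \<otimes> y\<close>.
\<close>

definition dual_pair :: "('o, 'a, 'z) mon_cat_scheme \<Rightarrow> 'o \<Rightarrow> 'o \<Rightarrow> 'a \<Rightarrow> 'a \<Rightarrow> bool" where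
  "dual_pair C x y e n \<longleftrightarrow> x \<in> Obj C \<and> y \<in> Obj C \<and>
     e \<in> hom C (y \<otimes>\<^bsub>C\<^esub> x) (Unit C) \<and> n \<in> hom C (Unit C) (x \<otimes>\<^bsub>C\<^esub> y) \<and>
     Runit C x \<cdot>\<^bsub>C\<^esub> (Id C x \<boxtimes>\<^bsub>C\<^esub> e) \<cdot>\<^bsub>C\<^esub> Assoc C x y x \<cdot>\<^bsub>C\<^esub> (n \<boxtimes>\<^bsub>C\<^esub> Id C x) = Lunit C x \<and>
     Lunit C y \<cdot>\<^bsub>C\<^esub> (e \<boxtimes>\<^bsub>C\<^esub> Id C y) \<cdot>\<^bsub>C\<^esub> Inv C (Assoc C y x y) \<cdot>\<^bsub>C\<^esub> (Id C y \<boxtimes>\<^bsub>C\<^esub> n) = Runit C y"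

text \<open>Right duals are chosen, left duals are only required to exist.\<close>

record ('o, 'a) rigid_cat = "('o, 'a) mon_cat" +
  Rdual :: "'o \<Rightarrow> 'o"
  Ev :: "'o \<Rightarrow> 'a"
  Coev :: "'o \<Rightarrow> 'a"

locale rigid_category = monoidal_category C
  for C :: "('o, 'a, 'z) rigid_cat_scheme" (structure) +
  assumes right_dual: "x \<in> Obj C \<Longrightarrow> dual_pair C x (Rdual C x) (Ev C x) (Coev C x)"
    and left_dual_exists: "x \<in> Obj C \<Longrightarrow> \<exists>y e n. dual_pair C y x e n"

text \<open>
  For \<open>f : x \<rightarrow> x'\<close>, a right dual \<open>y'\<close> of \<open>x'\<close> with evaluation \<open>e'\<close> and a right dual \<open>y\<close> of \<open>x\<close>
  with coevaluation \<open>n\<close>, this is the dual morphism \<open>y' \<rightarrow> y\<close> of \<open>f\<close>.  For \<open>f = id\<close> it is the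
  canonical isomorphism between two right duals of the same object.
\<close>

definition dual_map ::
  "('o, 'a, 'z) mon_cat_scheme \<Rightarrow> 'o \<Rightarrow> 'a \<Rightarrow> 'o \<Rightarrow> 'a \<Rightarrow> 'a \<Rightarrow> 'a" where
  "dual_map C y' e' y n f =
     Lunit C y \<cdot>\<^bsub>C\<^esub> (e' \<boxtimes>\<^bsub>C\<^esub> Id C y) \<cdot>\<^bsub>C\<^esub> Inv C (Assoc C y' (Cod C f) y) \<cdot>\<^bsub>C\<^esub>
       (Id C y' \<boxtimes>\<^bsub>C\<^esub> ((f \<boxtimes>\<^bsub>C\<^esub> Id C y) \<cdot>\<^bsub>C\<^esub> n)) \<cdot>\<^bsub>C\<^esub> Inv C (Runit C y')"

definition Rdual_arr :: "('o, 'a, 'z) rigid_cat_scheme \<Rightarrow> 'a \<Rightarrow> 'a" where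
  "Rdual_arr C f = dual_map C (Rdual C (Cod C f)) (Ev C (Cod C f))
     (Rdual C (Dom C f)) (Coev C (Dom C f)) f"

text \<open>Evaluation and coevaluation exhibiting \<open>y* \<otimes> x*\<close> as a right dual of \<open>x \<otimes> y\<close>.\<close>

definition tens_ev :: "('o, 'a, 'z) rigid_cat_scheme \<Rightarrow> 'o \<Rightarrow> 'o \<Rightarrow> 'a" where
  "tens_ev C x y =
     Ev C y \<cdot>\<^bsub>C\<^esub>
     (Id C (Rdual C y) \<boxtimes>\<^bsub>C\<^esub>
       (Lunit C y \<cdot>\<^bsub>C\<^esub> (Ev C x \<boxtimes>\<^bsub>C\<^esub> Id C y) \<cdot>\<^bsub>C\<^esub> Inv C (Assoc C (Rdual C x) x y))) \<cdot>\<^bsub>C\<^esub>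
     Assoc C (Rdual C y) (Rdual C x) (x \<otimes>\<^bsub>C\<^esub> y)"

definition tens_coev :: "('o, 'a, 'z) rigid_cat_scheme \<Rightarrow> 'o \<Rightarrow> 'o \<Rightarrow> 'a" where
  "tens_coev C x y =
     Inv C (Assoc C x y (Rdual C y \<otimes>\<^bsub>C\<^esub> Rdual C x)) \<cdot>\<^bsub>C\<^esub>
     (Id C x \<boxtimes>\<^bsub>C\<^esub>
       (Assoc C y (Rdual C y) (Rdual C x) \<cdot>\<^bsub>C\<^esub> (Coev C y \<boxtimes>\<^bsub>C\<^esub> Id C (Rdual C x)) \<cdot>\<^bsub>C\<^esub>
        Inv C (Lunit C (Rdual C x)))) \<cdot>\<^bsub>C\<^esub>
     Coev C x"

text \<open>
  The coherence isomorphisms \<open>x** \<otimes> y** \<rightarrow> (x \<otimes> y)**\<close> and \<open>1 \<rightarrow> 1**\<close> of the monoidal functor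
  \<open>(-)**\<close>.  The first is \<open>x** \<otimes> y** \<rightarrow> (y* \<otimes> x*)*\<close> followed by the dual of
  \<open>(x \<otimes> y)* \<rightarrow> y* \<otimes> x*\<close>, both of which compare two right duals of one object; the second is
  \<open>1 \<rightarrow> 1*\<close> followed by the dual of \<open>1* \<rightarrow> 1\<close>.
\<close>

definition ddual_tens :: "('o, 'a, 'z) rigid_cat_scheme \<Rightarrow> 'o \<Rightarrow> 'o \<Rightarrow> 'a" where
  "ddual_tens C x y =
     (let x' = Rdual C x; y' = Rdual C y; yx = y' \<otimes>\<^bsub>C\<^esub> x'; xy = x \<otimes>\<^bsub>C\<^esub> y in
      Rdual_arr C (dual_map C (Rdual C xy) (Ev C xy) yx (tens_coev C x y) (Id C xy)) \<cdot>\<^bsub>C\<^esub>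
      dual_map C (Rdual C x' \<otimes>\<^bsub>C\<^esub> Rdual C y') (tens_ev C y' x') (Rdual C yx) (Coev C yx) (Id C yx))"

definition ddual_unit :: "('o, 'a, 'z) rigid_cat_scheme \<Rightarrow> 'a" where
  "ddual_unit C =
     (let u = Unit C in
      Rdual_arr C (dual_map C (Rdual C u) (Ev C u) u (Inv C (Lunit C u)) (Id C u)) \<cdot>\<^bsub>C\<^esub>
      dual_map C u (Lunit C u) (Rdual C u) (Coev C u) (Id C u))"

locale pivotal_structure = rigid_category C
  for C :: "('o, 'a, 'z) rigid_cat_scheme" (structure) and a :: "'o \<Rightarrow> 'a" +
  assumes piv_hom: "x \<in> Obj C \<Longrightarrow> a x \<in> hom C x (Rdual C (Rdual C x))"
    and piv_iso: "x \<in> Obj C \<Longrightarrow> iso C (a x)"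
    and piv_natural: "f \<in> hom C x y \<Longrightarrow> Rdual_arr C (Rdual_arr C f) \<cdot> a x = a y \<cdot> f"
    and piv_tens: "\<lbrakk>x \<in> Obj C; y \<in> Obj C\<rbrakk> \<Longrightarrow> a (x \<otimes> y) = ddual_tens C x y \<cdot> (a x \<boxtimes> a y)"
    and piv_unit: "a (Unit C) = ddual_unit C"

record ('o, 'a) fusion_cat = "('o, 'a) rigid_cat" +
  Ldual :: "'o \<Rightarrow> 'o"
  Lev :: "'o \<Rightarrow> 'a"
  Lcoev :: "'o \<Rightarrow> 'a"

locale fusion_category = finite_semisimple_category C + rigid_category C
  for C :: "('o, 'a, 'z) fusion_cat_scheme" (structure) +
  assumes left_dual: "x \<in> Obj C \<Longrightarrow> dual_pair C (Ldual C x) x (Lev C x) (Lcoev C x)"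
    and simple_Unit: "simple_object C (Unit C)"
    and TensA_Add_left: "\<lbrakk>f \<in> hom C x x'; g \<in> hom C x x'; h \<in> hom C y y'\<rbrakk>
      \<Longrightarrow> (f \<oplus> g) \<boxtimes> h = (f \<boxtimes> h) \<oplus> (g \<boxtimes> h)"
    and TensA_Add_right: "\<lbrakk>f \<in> hom C x x'; g \<in> hom C y y'; h \<in> hom C y y'\<rbrakk>
      \<Longrightarrow> f \<boxtimes> (g \<oplus> h) = (f \<boxtimes> g) \<oplus> (f \<boxtimes> h)"
    and TensA_Scale_left: "\<lbrakk>f \<in> hom C x x'; g \<in> hom C y y'\<rbrakk>
      \<Longrightarrow> Scale C r f \<boxtimes> g = Scale C r (f \<boxtimes> g)"
    and TensA_Scale_right: "\<lbrakk>f \<in> hom C x x'; g \<in> hom C y y'\<rbrakk>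
      \<Longrightarrow> f \<boxtimes> Scale C r g = Scale C r (f \<boxtimes> g)"


section \<open>Module categories, module functors and module natural transformations\<close>

text \<open>
  \<open>Mass M c d m\<close> goes from \<open>(c \<otimes> d) \<triangleright> m\<close> to \<open>c \<triangleright> (d \<triangleright> m)\<close> and \<open>Munit M m\<close> from
  \<open>1 \<triangleright> m\<close> to \<open>m\<close>.
\<close>

record ('c, 'k, 'o, 'a) module_cat = "('o, 'a) lin_cat" +
  ActO :: "'c \<Rightarrow> 'o \<Rightarrow> 'o"  (infixr "\<triangleright>\<index>" 70)
  ActA :: "'k \<Rightarrow> 'a \<Rightarrow> 'a"  (infixr "\<odot>\<index>" 70)
  Mass :: "'c \<Rightarrow> 'c \<Rightarrow> 'o \<Rightarrow> 'a"
  Munit :: "'o \<Rightarrow> 'a"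

locale module_category = C: fusion_category C + finite_semisimple_category M
  for C :: "('c, 'k, 'y) fusion_cat_scheme"
    and M :: "('c, 'k, 'o, 'a, 'z) module_cat_scheme" (structure) +
  assumes ActO_Obj: "\<lbrakk>c \<in> Obj C; m \<in> Obj M\<rbrakk> \<Longrightarrow> c \<triangleright> m \<in> Obj M"
    and ActA_hom: "\<lbrakk>k \<in> hom C c c'; g \<in> hom M m m'\<rbrakk> \<Longrightarrow> k \<odot> g \<in> hom M (c \<triangleright> m) (c' \<triangleright> m')"
    and ActA_Id: "\<lbrakk>c \<in> Obj C; m \<in> Obj M\<rbrakk> \<Longrightarrow> Id C c \<odot> Id M m = Id M (c \<triangleright> m)"
    and ActA_Comp: "\<lbrakk>k \<in> hom C c c'; k' \<in> hom C c' c''; g \<in> hom M m m'; g' \<in> hom M m' m''\<rbrakk>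
      \<Longrightarrow> (k' \<cdot>\<^bsub>C\<^esub> k) \<odot> (g' \<cdot> g) = (k' \<odot> g') \<cdot> (k \<odot> g)"
    and ActA_Add_left: "\<lbrakk>k \<in> hom C c c'; k' \<in> hom C c c'; g \<in> hom M m m'\<rbrakk>
      \<Longrightarrow> (k \<oplus>\<^bsub>C\<^esub> k') \<odot> g = (k \<odot> g) \<oplus> (k' \<odot> g)"
    and ActA_Add_right: "\<lbrakk>k \<in> hom C c c'; g \<in> hom M m m'; g' \<in> hom M m m'\<rbrakk>
      \<Longrightarrow> k \<odot> (g \<oplus> g') = (k \<odot> g) \<oplus> (k \<odot> g')"
    and ActA_Scale_left: "\<lbrakk>k \<in> hom C c c'; g \<in> hom M m m'\<rbrakk>
      \<Longrightarrow> Scale C r k \<odot> g = Scale M r (k \<odot> g)"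
    and ActA_Scale_right: "\<lbrakk>k \<in> hom C c c'; g \<in> hom M m m'\<rbrakk>
      \<Longrightarrow> k \<odot> Scale M r g = Scale M r (k \<odot> g)"
    and Mass_hom: "\<lbrakk>c \<in> Obj C; d \<in> Obj C; m \<in> Obj M\<rbrakk>
      \<Longrightarrow> Mass M c d m \<in> hom M ((c \<otimes>\<^bsub>C\<^esub> d) \<triangleright> m) (c \<triangleright> d \<triangleright> m)"
    and Mass_iso: "\<lbrakk>c \<in> Obj C; d \<in> Obj C; m \<in> Obj M\<rbrakk> \<Longrightarrow> iso M (Mass M c d m)"
    and Mass_natural: "\<lbrakk>k \<in> hom C c c'; l \<in> hom C d d'; g \<in> hom M m m'\<rbrakk>
      \<Longrightarrow> Mass M c' d' m' \<cdot> ((k \<boxtimes>\<^bsub>C\<^esub> l) \<odot> g) = (k \<odot> l \<odot> g) \<cdot> Mass M c d m"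
    and Munit_hom: "m \<in> Obj M \<Longrightarrow> Munit M m \<in> hom M (Unit C \<triangleright> m) m"
    and Munit_iso: "m \<in> Obj M \<Longrightarrow> iso M (Munit M m)"
    and Munit_natural: "f \<in> hom M m m' \<Longrightarrow> Munit M m' \<cdot> (Id C (Unit C) \<odot> f) = f \<cdot> Munit M m"
    and module_pentagon: "\<lbrakk>c \<in> Obj C; d \<in> Obj C; e \<in> Obj C; m \<in> Obj M\<rbrakk> \<Longrightarrow>
      (Id C c \<odot> Mass M d e m) \<cdot> Mass M c (d \<otimes>\<^bsub>C\<^esub> e) m \<cdot> (Assoc C c d e \<odot> Id M m)
        = Mass M c d (e \<triangleright> m) \<cdot> Mass M (c \<otimes>\<^bsub>C\<^esub> d) e m"
    and module_triangle: "\<lbrakk>c \<in> Obj C; m \<in> Obj M\<rbrakk> \<Longrightarrow>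
      (Id C c \<odot> Munit M m) \<cdot> Mass M c (Unit C) m = Runit C c \<odot> Id M m"

text \<open>\<open>FS F c m\<close> is the constraint \<open>F (c \<triangleright> m) \<rightarrow> c \<triangleright> F m\<close>.\<close>

record ('c, 'o, 'a, 'p, 'b) mfun =
  FO :: "'o \<Rightarrow> 'p"
  FA :: "'a \<Rightarrow> 'b"
  FS :: "'c \<Rightarrow> 'o \<Rightarrow> 'b"

locale module_functor = M: module_category C M + N: module_category C N
  for C :: "('c, 'k, 'y) fusion_cat_scheme"
    and M :: "('c, 'k, 'o, 'a, 'u) module_cat_scheme"
    and N :: "('c, 'k, 'p, 'b, 'v) module_cat_scheme"
    and F :: "('c, 'o, 'a, 'p, 'b) mfun" +
  assumes FO_Obj: "m \<in> Obj M \<Longrightarrow> FO F m \<in> Obj N"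
    and FA_hom: "f \<in> hom M m m' \<Longrightarrow> FA F f \<in> hom N (FO F m) (FO F m')"
    and FA_Id: "m \<in> Obj M \<Longrightarrow> FA F (Id M m) = Id N (FO F m)"
    and FA_Comp: "\<lbrakk>f \<in> hom M m m'; g \<in> hom M m' m''\<rbrakk>
      \<Longrightarrow> FA F (g \<cdot>\<^bsub>M\<^esub> f) = FA F g \<cdot>\<^bsub>N\<^esub> FA F f"
    and FA_Add: "\<lbrakk>f \<in> hom M m m'; g \<in> hom M m m'\<rbrakk>
      \<Longrightarrow> FA F (f \<oplus>\<^bsub>M\<^esub> g) = FA F f \<oplus>\<^bsub>N\<^esub> FA F g"
    and FS_hom: "\<lbrakk>c \<in> Obj C; m \<in> Obj M\<rbrakk>
      \<Longrightarrow> FS F c m \<in> hom N (FO F (c \<triangleright>\<^bsub>M\<^esub> m)) (c \<triangleright>\<^bsub>N\<^esub> FO F m)"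
    and FS_iso: "\<lbrakk>c \<in> Obj C; m \<in> Obj M\<rbrakk> \<Longrightarrow> iso N (FS F c m)"
    and FS_natural: "\<lbrakk>k \<in> hom C c c'; f \<in> hom M m m'\<rbrakk>
      \<Longrightarrow> FS F c' m' \<cdot>\<^bsub>N\<^esub> FA F (k \<odot>\<^bsub>M\<^esub> f) = (k \<odot>\<^bsub>N\<^esub> FA F f) \<cdot>\<^bsub>N\<^esub> FS F c m"
    and functor_pentagon: "\<lbrakk>c \<in> Obj C; d \<in> Obj C; m \<in> Obj M\<rbrakk> \<Longrightarrow>
      Mass N c d (FO F m) \<cdot>\<^bsub>N\<^esub> FS F (c \<otimes>\<^bsub>C\<^esub> d) m
        = (Id C c \<odot>\<^bsub>N\<^esub> FS F d m) \<cdot>\<^bsub>N\<^esub> FS F c (d \<triangleright>\<^bsub>M\<^esub> m) \<cdot>\<^bsub>N\<^esub> FA F (Mass M c d m)"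
    and functor_triangle: "m \<in> Obj M \<Longrightarrow>
      Munit N (FO F m) \<cdot>\<^bsub>N\<^esub> FS F (Unit C) m = FA F (Munit M m)"

definition id_mfun ::
  "('c, 'k, 'o, 'a, 'u) module_cat_scheme \<Rightarrow> ('c, 'o, 'a, 'o, 'a) mfun" where
  "id_mfun M = \<lparr>FO = (\<lambda>m. m), FA = (\<lambda>f. f), FS = (\<lambda>c m. Id M (c \<triangleright>\<^bsub>M\<^esub> m))\<rparr>"

text \<open>\<open>E\<close> is the target of \<open>K\<close>.\<close>

definition mfun_comp ::
  "('c, 'k, 'q, 'd, 'w) module_cat_scheme \<Rightarrow> ('c, 'p, 'b, 'q, 'd) mfun \<Rightarrow>
   ('c, 'o, 'a, 'p, 'b) mfun \<Rightarrow> ('c, 'o, 'a, 'q, 'd) mfun" where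
  "mfun_comp E K F = \<lparr>FO = (\<lambda>m. FO K (FO F m)), FA = (\<lambda>f. FA K (FA F f)),
     FS = (\<lambda>c m. FS K c (FO F m) \<cdot>\<^bsub>E\<^esub> FA K (FS F c m))\<rparr>"

text \<open>
  The components of a transformation are \<^const>\<open>undefined\<close> outside the objects of \<open>M\<close>, so that
  equality of transformations is equality of functions.
\<close>

locale module_nat_transf = F: module_functor C M N F + G: module_functor C M N G
  for C :: "('c, 'k, 'y) fusion_cat_scheme"
    and M :: "('c, 'k, 'o, 'a, 'u) module_cat_scheme"
    and N :: "('c, 'k, 'p, 'b, 'v) module_cat_scheme"
    and F G :: "('c, 'o, 'a, 'p, 'b) mfun" and \<rho> :: "'o \<Rightarrow> 'b" +
  assumes nat_extensional: "\<rho> \<in> extensional (Obj M)"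
    and nat_hom: "m \<in> Obj M \<Longrightarrow> \<rho> m \<in> hom N (FO F m) (FO G m)"
    and nat_natural: "f \<in> hom M m m' \<Longrightarrow> \<rho> m' \<cdot>\<^bsub>N\<^esub> FA F f = FA G f \<cdot>\<^bsub>N\<^esub> \<rho> m"
    and nat_module: "\<lbrakk>c \<in> Obj C; m \<in> Obj M\<rbrakk>
      \<Longrightarrow> FS G c m \<cdot>\<^bsub>N\<^esub> \<rho> (c \<triangleright>\<^bsub>M\<^esub> m) = (Id C c \<odot>\<^bsub>N\<^esub> \<rho> m) \<cdot>\<^bsub>N\<^esub> FS F c m"

locale module_nat_iso = module_nat_transf +
  assumes nat_iso: "m \<in> Obj M \<Longrightarrow> iso N (\<rho> m)"

definition vcomp ::
  "('o, 'a, 'u) cat_scheme \<Rightarrow> ('p, 'b, 'v) cat_scheme \<Rightarrow> ('o \<Rightarrow> 'b) \<Rightarrow> ('o \<Rightarrow> 'b) \<Rightarrow> 'o \<Rightarrow> 'b" where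
  "vcomp M N \<sigma> \<rho> = (\<lambda>m \<in> Obj M. \<sigma> m \<cdot>\<^bsub>N\<^esub> \<rho> m)"

text \<open>
  The horizontal composite \<open>K \<circ> F \<rightarrow> K' \<circ> F'\<close> of \<open>\<sigma> : K \<rightarrow> K'\<close> and \<open>\<rho> : F \<rightarrow> F'\<close>, where \<open>M\<close> is
  the source of \<open>F\<close> and \<open>E\<close> the target of \<open>K\<close>.
\<close>

definition hcomp ::
  "('o, 'a, 'u) cat_scheme \<Rightarrow> ('q, 'd, 'w) cat_scheme \<Rightarrow> ('c, 'p, 'b, 'q, 'd) mfun \<Rightarrow>
   ('c, 'o, 'a, 'p, 'b) mfun \<Rightarrow> ('p \<Rightarrow> 'd) \<Rightarrow> ('o \<Rightarrow> 'b) \<Rightarrow> 'o \<Rightarrow> 'd" where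
  "hcomp M E K F' \<sigma> \<rho> = (\<lambda>m \<in> Obj M. \<sigma> (FO F' m) \<cdot>\<^bsub>E\<^esub> FA K (\<rho> m))"


section \<open>Left adjoints of module functors\<close>

text \<open>
  A left adjoint of \<open>F : M \<rightarrow> N\<close> consists of a module functor \<open>N \<rightarrow> M\<close> and of the unit and the
  counit of the adjunction, which are required to be module natural transformations.
\<close>

record ('c, 'o, 'a, 'p, 'b) ladj =
  Lfun :: "('c, 'p, 'b, 'o, 'a) mfun"
  Lunt :: "'p \<Rightarrow> 'b"
  Lcnt :: "'o \<Rightarrow> 'a"

locale left_adjoint = F: module_functor C M N F + L: module_functor C N M "Lfun A" +
  unit: module_nat_transf C N N "id_mfun N" "mfun_comp N F (Lfun A)" "Lunt A" +
  counit: module_nat_transf C M M "mfun_comp M (Lfun A) F" "id_mfun M" "Lcnt A"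
  for C :: "('c, 'k, 'y) fusion_cat_scheme"
    and M :: "('c, 'k, 'o, 'a, 'u) module_cat_scheme"
    and N :: "('c, 'k, 'p, 'b, 'v) module_cat_scheme"
    and F :: "('c, 'o, 'a, 'p, 'b) mfun"
    and A :: "('c, 'o, 'a, 'p, 'b) ladj" +
  assumes adj_triangle_right: "m \<in> Obj M \<Longrightarrow>
      FA F (Lcnt A m) \<cdot>\<^bsub>N\<^esub> Lunt A (FO F m) = Id N (FO F m)"
    and adj_triangle_left: "n \<in> Obj N \<Longrightarrow>
      Lcnt A (FO (Lfun A) n) \<cdot>\<^bsub>M\<^esub> FA (Lfun A) (Lunt A n) = Id M (FO (Lfun A) n)"

text \<open>
  The transformation \<open>\<rho>\<^sup>l : G\<^sup>l \<rightarrow> F\<^sup>l\<close> induced by \<open>\<rho> : F \<rightarrow> G\<close>, where \<open>A\<close> and \<open>A'\<close> are left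
  adjoints of \<open>F, G : M \<rightarrow> N\<close>, and the transformation \<open>\<rho>\<^sup>l\<^sup>l : F\<^sup>l\<^sup>l \<rightarrow> G\<^sup>l\<^sup>l\<close>, where moreover \<open>B\<close> and
  \<open>B'\<close> are left adjoints of \<open>F\<^sup>l\<close> and \<open>G\<^sup>l\<close>.
\<close>

definition transf_l ::
  "('o, 'a, 'u) cat_scheme \<Rightarrow> ('p, 'b, 'v) cat_scheme \<Rightarrow> ('c, 'o, 'a, 'p, 'b) ladj \<Rightarrow>
   ('c, 'o, 'a, 'p, 'b) ladj \<Rightarrow> ('o \<Rightarrow> 'b) \<Rightarrow> 'p \<Rightarrow> 'a" where
  "transf_l M N A A' \<rho> = (\<lambda>n \<in> Obj N. Lcnt A' (FO (Lfun A) n) \<cdot>\<^bsub>M\<^esub>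
     FA (Lfun A') (\<rho> (FO (Lfun A) n) \<cdot>\<^bsub>N\<^esub> Lunt A n))"

definition transf_ll ::
  "('o, 'a, 'u) cat_scheme \<Rightarrow> ('p, 'b, 'v) cat_scheme \<Rightarrow>
   ('c, 'o, 'a, 'p, 'b) ladj \<Rightarrow> ('c, 'p, 'b, 'o, 'a) ladj \<Rightarrow>
   ('c, 'o, 'a, 'p, 'b) ladj \<Rightarrow> ('c, 'p, 'b, 'o, 'a) ladj \<Rightarrow> ('o \<Rightarrow> 'b) \<Rightarrow> 'o \<Rightarrow> 'b" where
  "transf_ll M N A B A' B' \<rho> = transf_l N M B' B (transf_l M N A A' \<rho>)"

text \<open>
  The identification \<open>(K \<circ> F)\<^sup>l = F\<^sup>l \<circ> K\<^sup>l\<close>: the composite of the left adjoints \<open>AK\<close> of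
  \<open>K : N \<rightarrow> E\<close> and \<open>AF\<close> of \<open>F : M \<rightarrow> N\<close>.
\<close>

definition comp_ladj ::
  "('c, 'k, 'o, 'a, 'u) module_cat_scheme \<Rightarrow> ('c, 'k, 'q, 'd, 'w) module_cat_scheme \<Rightarrow>
   ('c, 'p, 'b, 'q, 'd) mfun \<Rightarrow> ('c, 'p, 'b, 'q, 'd) ladj \<Rightarrow>
   ('c, 'o, 'a, 'p, 'b) mfun \<Rightarrow> ('c, 'o, 'a, 'p, 'b) ladj \<Rightarrow> ('c, 'o, 'a, 'q, 'd) ladj" where
  "comp_ladj M E K AK F AF =
     \<lparr>Lfun = mfun_comp M (Lfun AF) (Lfun AK),
      Lunt = (\<lambda>e \<in> Obj E. FA K (Lunt AF (FO (Lfun AK) e)) \<cdot>\<^bsub>E\<^esub> Lunt AK e),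
      Lcnt = (\<lambda>m \<in> Obj M. Lcnt AF m \<cdot>\<^bsub>M\<^esub> FA (Lfun AF) (Lcnt AK (FO F m)))\<rparr>"


section \<open>Module traces\<close>

text \<open>
  The identification \<open>(*c)** \<rightarrow> c*\<close>: the dual of the canonical isomorphism \<open>c \<rightarrow> (*c)*\<close> between two
  right duals of \<open>*c\<close>.
\<close>

definition ldual_ddual :: "('c, 'k, 'y) fusion_cat_scheme \<Rightarrow> 'c \<Rightarrow> 'k" where
  "ldual_ddual C c =
     (let d = Ldual C c in
      Rdual_arr C (dual_map C c (Lev C c) (Rdual C d) (Coev C d) (Id C d)))"

definition partial_trace ::
  "('c, 'k, 'y) fusion_cat_scheme \<Rightarrow> ('c \<Rightarrow> 'k) \<Rightarrow> ('c, 'k, 'o, 'a, 'u) module_cat_scheme \<Rightarrow>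
   'c \<Rightarrow> 'o \<Rightarrow> 'a \<Rightarrow> 'a" where
  "partial_trace C a M c m f =
     Munit M m \<cdot>\<^bsub>M\<^esub> (Ev C c \<odot>\<^bsub>M\<^esub> Id M m) \<cdot>\<^bsub>M\<^esub> Inv M (Mass M (Rdual C c) c m) \<cdot>\<^bsub>M\<^esub>
     ((ldual_ddual C c \<cdot>\<^bsub>C\<^esub> a (Ldual C c)) \<odot>\<^bsub>M\<^esub> f) \<cdot>\<^bsub>M\<^esub>
     Mass M (Ldual C c) c m \<cdot>\<^bsub>M\<^esub> (Lcoev C c \<odot>\<^bsub>M\<^esub> Id M m) \<cdot>\<^bsub>M\<^esub> Inv M (Munit M m)"

locale module_trace = C: pivotal_structure C a + M: module_category C M
  for C :: "('c, 'k, 'y) fusion_cat_scheme" and a :: "'c \<Rightarrow> 'k"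
    and M :: "('c, 'k, 'o, 'a, 'u) module_cat_scheme" (structure)
    and \<Theta> :: "'o \<Rightarrow> 'a \<Rightarrow> complex" +
  assumes trace_Add: "\<lbrakk>f \<in> hom M m m; g \<in> hom M m m\<rbrakk> \<Longrightarrow> \<Theta> m (f \<oplus> g) = \<Theta> m f + \<Theta> m g"
    and trace_Scale: "f \<in> hom M m m \<Longrightarrow> \<Theta> m (Scale M r f) = r * \<Theta> m f"
    and trace_symmetric: "\<lbrakk>f \<in> hom M m n; g \<in> hom M n m\<rbrakk> \<Longrightarrow> \<Theta> m (g \<cdot> f) = \<Theta> n (f \<cdot> g)"
    and trace_nondegenerate_left: "\<lbrakk>f \<in> hom M m n; \<And>g. g \<in> hom M n m \<Longrightarrow> \<Theta> m (g \<cdot> f) = 0\<rbrakk>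
      \<Longrightarrow> f = Zero M m n"
    and trace_nondegenerate_right: "\<lbrakk>g \<in> hom M n m; \<And>f. f \<in> hom M m n \<Longrightarrow> \<Theta> m (g \<cdot> f) = 0\<rbrakk>
      \<Longrightarrow> g = Zero M n m"
    and trace_compatible: "\<lbrakk>c \<in> Obj C; m \<in> Obj M; f \<in> hom M (c \<triangleright> m) (c \<triangleright> m)\<rbrakk>
      \<Longrightarrow> \<Theta> (c \<triangleright> m) f = \<Theta> m (partial_trace C a M c m f)"


section \<open>The canonical transformation to the double left adjoint\<close>

text \<open>Linear functionals on \<open>hom M x y\<close> are represented as functions extensional on that set.\<close>

definition trace_dual ::
  "('o, 'a, 'u) cat_scheme \<Rightarrow> ('o \<Rightarrow> 'a \<Rightarrow> complex) \<Rightarrow> 'o \<Rightarrow> 'o \<Rightarrow> 'a \<Rightarrow> ('a \<Rightarrow> complex)" where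
  "trace_dual M \<Theta> m m' f = (\<lambda>g \<in> hom M m' m. \<Theta> m (g \<cdot>\<^bsub>M\<^esub> f))"

text \<open>
  For a left adjoint \<open>A\<close> of \<open>F : M \<rightarrow> N\<close>: the bijections
  \<open>Hom\<^sub>N(n, F m) \<rightarrow> Hom\<^sub>M(F\<^sup>l n, m)\<close> and \<open>Hom\<^sub>M(F\<^sup>l n, m) \<rightarrow> Hom\<^sub>N(n, F m)\<close>.
\<close>

definition adj_transpose ::
  "('o, 'a, 'u) cat_scheme \<Rightarrow> ('c, 'o, 'a, 'p, 'b) ladj \<Rightarrow> 'o \<Rightarrow> 'b \<Rightarrow> 'a" where
  "adj_transpose M A m f = Lcnt A m \<cdot>\<^bsub>M\<^esub> FA (Lfun A) f"

definition adj_untranspose ::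
  "('p, 'b, 'v) cat_scheme \<Rightarrow> ('c, 'o, 'a, 'p, 'b) mfun \<Rightarrow> ('c, 'o, 'a, 'p, 'b) ladj \<Rightarrow>
   'p \<Rightarrow> 'a \<Rightarrow> 'b" where
  "adj_untranspose N F A n g = FA F g \<cdot>\<^bsub>N\<^esub> Lunt A n"

text \<open>
  With \<open>A\<close> a left adjoint of \<open>F : M \<rightarrow> N\<close> and \<open>B\<close> a left adjoint of \<open>F\<^sup>l\<close>, the composite
  \<open>Hom\<^sub>N(n, F m) \<rightarrow> Hom\<^sub>M(F\<^sup>l n, m) \<rightarrow> Hom\<^sub>M(m, F\<^sup>l n)* \<rightarrow> Hom\<^sub>N(F\<^sup>l\<^sup>l m, n)* \<rightarrow> Hom\<^sub>N(n, F\<^sup>l\<^sup>l m)\<close>.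
\<close>

definition double_adj_map ::
  "('o, 'a, 'u) cat_scheme \<Rightarrow> ('p, 'b, 'v) cat_scheme \<Rightarrow>
   ('o \<Rightarrow> 'a \<Rightarrow> complex) \<Rightarrow> ('p \<Rightarrow> 'b \<Rightarrow> complex) \<Rightarrow>
   ('c, 'o, 'a, 'p, 'b) ladj \<Rightarrow> ('c, 'p, 'b, 'o, 'a) ladj \<Rightarrow> 'p \<Rightarrow> 'o \<Rightarrow> 'b \<Rightarrow> 'b" where
  "double_adj_map M N \<Theta>M \<Theta>N A B n m f =
     (let Ln = FO (Lfun A) n; LLm = FO (Lfun B) m;
          \<phi> = trace_dual M \<Theta>M Ln m (adj_transpose M A m f);
          \<psi> = (\<lambda>h \<in> hom N LLm n. \<phi> (adj_untranspose M (Lfun A) B m h))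
      in the_inv_into (hom N n LLm) (trace_dual N \<Theta>N n LLm) \<psi>)"

definition canonical_transf ::
  "('o, 'a, 'u) cat_scheme \<Rightarrow> ('p, 'b, 'v) cat_scheme \<Rightarrow>
   ('o \<Rightarrow> 'a \<Rightarrow> complex) \<Rightarrow> ('p \<Rightarrow> 'b \<Rightarrow> complex) \<Rightarrow> ('c, 'o, 'a, 'p, 'b) mfun \<Rightarrow>
   ('c, 'o, 'a, 'p, 'b) ladj \<Rightarrow> ('c, 'p, 'b, 'o, 'a) ladj \<Rightarrow> 'o \<Rightarrow> 'b" where
  "canonical_transf M N \<Theta>M \<Theta>N F A B =
     (\<lambda>m \<in> Obj M. THE t. t \<in> hom N (FO F m) (FO (Lfun B) m) \<and>
        (\<forall>n \<in> Obj N. \<forall>f \<in> hom N n (FO F m). t \<cdot>\<^bsub>N\<^esub> f = double_adj_map M N \<Theta>M \<Theta>N A B n m f))"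


section \<open>The dual category\<close>

text \<open>
  An arrow is a triple of source, target and components, with the linear structure taken
  componentwise.  The argument \<open>lad\<close> chooses a left adjoint for each module endofunctor; it serves
  as right dual, with the counit as evaluation and the unit as coevaluation.
\<close>

definition fun_cat ::
  "('c, 'k, 'y) fusion_cat_scheme \<Rightarrow> ('c, 'k, 'o, 'a, 'u) module_cat_scheme \<Rightarrow>
   (('c, 'o, 'a, 'o, 'a) mfun \<Rightarrow> ('c, 'o, 'a, 'o, 'a) ladj) \<Rightarrow>
   (('c, 'o, 'a, 'o, 'a) mfun,
    ('c, 'o, 'a, 'o, 'a) mfun \<times> ('c, 'o, 'a, 'o, 'a) mfun \<times> ('o \<Rightarrow> 'a)) rigid_cat" where
  "fun_cat C M lad =
     (let comp = mfun_comp M; ident = (\<lambda>F. \<lambda>m \<in> Obj M. Id M (FO F m)) in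
     \<lparr>Obj = {F. module_functor C M M F},
      Arr = {(F, G, \<rho>). module_nat_transf C M M F G \<rho>},
      Dom = (\<lambda>(F, G, \<rho>). F),
      Cod = (\<lambda>(F, G, \<rho>). G),
      Id = (\<lambda>F. (F, F, ident F)),
      Comp = (\<lambda>(G, H, \<sigma>) (F, G', \<rho>). (F, H, vcomp M M \<sigma> \<rho>)),
      Zero = (\<lambda>F G. (F, G, \<lambda>m \<in> Obj M. Zero M (FO F m) (FO G m))),
      Add = (\<lambda>(F, G, \<rho>) (F', G', \<sigma>). (F, G, \<lambda>m \<in> Obj M. \<rho> m \<oplus>\<^bsub>M\<^esub> \<sigma> m)),
      Scale = (\<lambda>r (F, G, \<rho>). (F, G, \<lambda>m \<in> Obj M. Scale M r (\<rho> m))),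
      TensO = comp,
      TensA = (\<lambda>(K, K', \<sigma>) (F, F', \<rho>). (comp K F, comp K' F', hcomp M M K F' \<sigma> \<rho>)),
      Unit = id_mfun M,
      Assoc = (\<lambda>F G H. (comp (comp F G) H, comp F (comp G H), ident (comp F (comp G H)))),
      Lunit = (\<lambda>F. (comp (id_mfun M) F, F, ident F)),
      Runit = (\<lambda>F. (comp F (id_mfun M), F, ident F)),
      Rdual = (\<lambda>F. Lfun (lad F)),
      Ev = (\<lambda>F. (comp (Lfun (lad F)) F, id_mfun M, Lcnt (lad F))),
      Coev = (\<lambda>F. (id_mfun M, comp F (Lfun (lad F)), Lunt (lad F)))\<rparr>)"

definition fun_pivotal ::
  "('c, 'k, 'o, 'a, 'u) module_cat_scheme \<Rightarrow> ('o \<Rightarrow> 'a \<Rightarrow> complex) \<Rightarrow>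
   (('c, 'o, 'a, 'o, 'a) mfun \<Rightarrow> ('c, 'o, 'a, 'o, 'a) ladj) \<Rightarrow> ('c, 'o, 'a, 'o, 'a) mfun \<Rightarrow>
   ('c, 'o, 'a, 'o, 'a) mfun \<times> ('c, 'o, 'a, 'o, 'a) mfun \<times> ('o \<Rightarrow> 'a)" where
  "fun_pivotal M \<Theta> lad F =
     (let A = lad F; B = lad (Lfun A) in (F, Lfun B, canonical_transf M M \<Theta> \<Theta> F A B))"

end

theory Submission
  imports Defs
begin

text \<open>
  Write \<open>F\<^sup>l\<close> for the left adjoint of \<open>F\<close>, with counit \<open>\<epsilon>\<close>, and \<open>\<eta>\<close> for the unit of the adjunction
  between \<open>F\<^sup>l\<^sup>l\<close> and \<open>F\<^sup>l\<close>.  Since the traces are symmetric, the composite of bijections that defines \<open>a\<^sub>F\<close>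
  amounts to a single formula,
  \<open>\<Theta>\<^sub>N(h \<circ> a\<^sub>F m) = \<Theta>\<^sub>M(\<epsilon>\<^sub>m \<circ> F\<^sup>l h \<circ> \<eta>\<^sub>m)\<close> for all \<open>h : F\<^sup>l\<^sup>l m \<rightarrow> F m\<close>.
  Non-degeneracy and finite dimension make this a definition: the right-hand side is a linear
  functional of \<open>h\<close>, every linear functional on a morphism space is represented by the trace
  (\<open>trace_represents\<close>), and only one morphism represents it.  Linearity holds although functors are
  only assumed additive, because the action of the unit object carries the scalars (\<open>FA_Scale\<close>).

  Everything is read off from this formula (\<open>canonical_trace\<close>) by moving morphisms around the two
  traces.  Naturality of \<open>a\<^sub>F\<close> in \<open>m\<close> comes from naturality of \<open>\<epsilon>\<close> and \<open>\<eta>\<close>; naturality in \<open>F\<close> from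
  the compatibility of a mate \<open>\<rho>\<^sup>l\<close> with units and counits; the formula for a composite \<open>K \<circ> F\<close> from
  applying the formula for \<open>K\<close> and then the one for \<open>F\<close>; invertibility from the fact that
  transposition is bijective, so that post-composition with \<open>a\<^sub>F m\<close> is bijective.

  That \<open>a\<^sub>F\<close> is a module transformation rests on the compatibility of the traces with the action
  (\<open>canonical_module\<close>).  It replaces the traces over
  \<open>c \<triangleright> m\<close> and over \<open>F (c \<triangleright> m) \<cong> c \<triangleright> F m\<close> by traces of partial traces over \<open>m\<close> and \<open>F m\<close>.  Partial
  traces are natural, and a module functor, here \<open>F\<^sup>l\<close>, commutes with them by the coherence axioms of
  its constraint (\<open>FA_partial_trace_between\<close>).

  In the dual category the chosen left adjoint of \<open>F\<close> is its right dual, and the dual of a morphism is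
  its mate.  A left dual exists because \<open>a\<^sub>F\<close> turns the adjunction between \<open>F\<^sup>l\<^sup>l\<close> and \<open>F\<^sup>l\<close> into one
  between \<open>F\<close> and \<open>F\<^sup>l\<close>.  The coherence isomorphisms of the double dual are mates of mates of
  identities, which compare composite (or identity) adjoints with the chosen ones
  (\<open>double_comparison\<close>).  Naturality of \<open>a\<close> along such a comparison
  (\<open>canonical_transf_change_adjoints\<close>) therefore turns the formula for composites into the
  monoidality of the pivotal structure.
\<close>


section \<open>Composition in a category\<close>

lemma in_hom [simp]: "f \<in> hom C x y \<longleftrightarrow> f \<in> Arr C \<and> Dom C f = x \<and> Cod C f = y"
  by (simp add: hom_def)

context category
begin

declare Dom_Obj [simp] Cod_Obj [simp]

lemma Id_simps [simp]:
  assumes "x \<in> Obj C"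
  shows "Id C x \<in> Arr C" "Dom C (Id C x) = x" "Cod C (Id C x) = x"
  using Id_hom[OF assms] by auto

lemma Comp_simps [simp]:
  assumes "f \<in> Arr C" "g \<in> Arr C" "Dom C g = Cod C f"
  shows "g \<cdot> f \<in> Arr C" "Dom C (g \<cdot> f) = Dom C f" "Cod C (g \<cdot> f) = Cod C g"
  using Comp_hom[of f "Dom C f" "Cod C f" g "Cod C g"] assms by auto

lemma Comp_assoc_simp [simp]:
  "\<lbrakk>f \<in> Arr C; g \<in> Arr C; h \<in> Arr C; Dom C g = Cod C f; Dom C h = Cod C g\<rbrakk>
    \<Longrightarrow> (h \<cdot> g) \<cdot> f = h \<cdot> (g \<cdot> f)"
  using Comp_assoc[of f "Dom C f" "Cod C f" g "Cod C g" h "Cod C h"] by auto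

lemma Comp_Id_simps [simp]:
  "\<lbrakk>f \<in> Arr C; Cod C f = y\<rbrakk> \<Longrightarrow> Id C y \<cdot> f = f"
  "\<lbrakk>f \<in> Arr C; Dom C f = x\<rbrakk> \<Longrightarrow> f \<cdot> Id C x = f"
  using Comp_Id_left[of f "Dom C f" "Cod C f"] Comp_Id_right[of f "Dom C f" "Cod C f"] by auto

text \<open>Applies an equation between composites inside a longer composite bracketed to the right.\<close>

lemma Comp_extend:
  assumes "g \<cdot> f = k" "f \<in> Arr C" "g \<in> Arr C" "Dom C g = Cod C f" "x \<in> Arr C" "Cod C x = Dom C f"
  shows "g \<cdot> (f \<cdot> x) = k \<cdot> x"
  using assms Comp_assoc_simp[of x f g] by simp

lemma inverse_arrows_unique:
  assumes "inverse_arrows C f g" "inverse_arrows C f h"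
  shows "g = h"
proof -
  have "g = g \<cdot> (f \<cdot> h)" using assms by (simp add: inverse_arrows_def)
  also have "\<dots> = (g \<cdot> f) \<cdot> h" using assms by (subst Comp_assoc_simp) (auto simp: inverse_arrows_def)
  also have "\<dots> = h" using assms by (simp add: inverse_arrows_def)
  finally show ?thesis .
qed

lemma Inv_eqI: "inverse_arrows C f g \<Longrightarrow> Inv C f = g"
  unfolding Inv_def using inverse_arrows_unique by blast

lemma Inv_inverse_arrows: "iso C f \<Longrightarrow> inverse_arrows C f (Inv C f)"
  using Inv_eqI by (auto simp: iso_def)

lemma iso_Arr: "iso C f \<Longrightarrow> f \<in> Arr C"
  by (auto simp: iso_def inverse_arrows_def)

lemma Inv_simps [simp]:
  assumes "iso C f"
  shows "Inv C f \<in> Arr C" "Dom C (Inv C f) = Cod C f" "Cod C (Inv C f) = Dom C f"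
    "Inv C f \<cdot> f = Id C (Dom C f)" "f \<cdot> Inv C f = Id C (Cod C f)"
  using Inv_inverse_arrows[OF assms] by (auto simp: inverse_arrows_def)

lemma Inv_Comp_cancel [simp]:
  "\<lbrakk>iso C f; x \<in> Arr C; Cod C x = Dom C f\<rbrakk> \<Longrightarrow> Inv C f \<cdot> (f \<cdot> x) = x"
  "\<lbrakk>iso C f; x \<in> Arr C; Cod C x = Cod C f\<rbrakk> \<Longrightarrow> f \<cdot> (Inv C f \<cdot> x) = x"
  using Comp_extend[of "Inv C f" f "Id C (Dom C f)" x] Comp_extend[of f "Inv C f" "Id C (Cod C f)" x]
  by (simp_all add: iso_Arr)

lemma iso_Inv [simp]: "iso C f \<Longrightarrow> iso C (Inv C f)"
  by (auto simp: iso_Arr iso_def[of C "Inv C f"] inverse_arrows_def intro!: exI[of _ f])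

lemma Inv_Inv [simp]: "iso C f \<Longrightarrow> Inv C (Inv C f) = f"
  by (rule Inv_eqI) (simp add: inverse_arrows_def iso_Arr)

lemma iso_cancel_left:
  assumes "iso C f" "f \<cdot> x = f \<cdot> y" "x \<in> Arr C" "y \<in> Arr C" "Cod C x = Dom C f" "Cod C y = Dom C f"
  shows "x = y"
  using assms(2) Inv_Comp_cancel(1)[of f x] Inv_Comp_cancel(1)[of f y] assms by metis

lemma isoI:
  assumes "f \<in> Arr C" "g \<in> hom C (Cod C f) (Dom C f)"
    "g \<cdot> f = Id C (Dom C f)" "f \<cdot> g = Id C (Cod C f)"
  shows "iso C f" "Inv C f = g"
  using assms by (auto simp: iso_def inverse_arrows_def intro!: Inv_eqI)

lemma iso_Id [simp]:
  assumes "x \<in> Obj C" shows "iso C (Id C x)" "Inv C (Id C x) = Id C x"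
  using assms isoI[of "Id C x" "Id C x"] by simp_all

lemma iso_Comp [simp]:
  assumes "iso C f" "iso C g" "Dom C g = Cod C f"
  shows "iso C (g \<cdot> f)" "Inv C (g \<cdot> f) = Inv C f \<cdot> Inv C g"
  using assms isoI[of "g \<cdot> f" "Inv C f \<cdot> Inv C g"] by (simp_all add: iso_Arr)

end


section \<open>Linear structure\<close>

context linear_category
begin

lemma lin_simps [simp]:
  "\<lbrakk>x \<in> Obj C; y \<in> Obj C\<rbrakk> \<Longrightarrow> Zero C x y \<in> Arr C"
  "\<lbrakk>x \<in> Obj C; y \<in> Obj C\<rbrakk> \<Longrightarrow> Dom C (Zero C x y) = x"
  "\<lbrakk>x \<in> Obj C; y \<in> Obj C\<rbrakk> \<Longrightarrow> Cod C (Zero C x y) = y"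
  "\<lbrakk>f \<in> Arr C; g \<in> Arr C; Dom C g = Dom C f; Cod C g = Cod C f\<rbrakk> \<Longrightarrow> f \<oplus> g \<in> Arr C"
  "\<lbrakk>f \<in> Arr C; g \<in> Arr C; Dom C g = Dom C f; Cod C g = Cod C f\<rbrakk> \<Longrightarrow> Dom C (f \<oplus> g) = Dom C f"
  "\<lbrakk>f \<in> Arr C; g \<in> Arr C; Dom C g = Dom C f; Cod C g = Cod C f\<rbrakk> \<Longrightarrow> Cod C (f \<oplus> g) = Cod C f"
  "f \<in> Arr C \<Longrightarrow> Scale C r f \<in> Arr C"
  "f \<in> Arr C \<Longrightarrow> Dom C (Scale C r f) = Dom C f"
  "f \<in> Arr C \<Longrightarrow> Cod C (Scale C r f) = Cod C f"
  using Zero_hom[of x y] Add_hom[of f "Dom C f" "Cod C f" g] Scale_hom[of f "Dom C f" "Cod C f" r]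
  by auto

lemma Comp_linear_simps:
  "\<lbrakk>f \<in> Arr C; g \<in> Arr C; h \<in> Arr C; Dom C g = Dom C f; Cod C g = Cod C f; Dom C h = Cod C f\<rbrakk>
    \<Longrightarrow> h \<cdot> (f \<oplus> g) = (h \<cdot> f) \<oplus> (h \<cdot> g)"
  "\<lbrakk>f \<in> Arr C; g \<in> Arr C; h \<in> Arr C; Dom C g = Cod C f; Dom C h = Cod C f; Cod C h = Cod C g\<rbrakk>
    \<Longrightarrow> (g \<oplus> h) \<cdot> f = (g \<cdot> f) \<oplus> (h \<cdot> f)"
  "\<lbrakk>f \<in> Arr C; h \<in> Arr C; Dom C h = Cod C f\<rbrakk> \<Longrightarrow> h \<cdot> Scale C r f = Scale C r (h \<cdot> f)"
  "\<lbrakk>f \<in> Arr C; h \<in> Arr C; Dom C h = Cod C f\<rbrakk> \<Longrightarrow> Scale C r h \<cdot> f = Scale C r (h \<cdot> f)"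
  using Comp_Add_right[of f "Dom C f" "Cod C f" g h "Cod C h"]
    Comp_Add_left[of f "Dom C f" "Cod C f" g "Cod C g" h]
    Comp_Scale_right[of f "Dom C f" "Cod C f" h "Cod C h" r]
    Comp_Scale_left[of f "Dom C f" "Cod C f" h "Cod C h" r]
  by auto

lemma Scale_zero:
  assumes "f \<in> hom C x y"
  shows "Scale C 0 f = Zero C x y"
proof -
  have "Scale C 0 f = Scale C 1 f \<oplus> Scale C (- 1) f"
    using Scale_plus[OF assms, of 1 "- 1"] by simp
  also have "\<dots> = Zero C x y"
    using assms by (simp only: Scale_one[OF assms] Add_minus[OF assms])
  finally show ?thesis .
qed

lemma diff_zero_imp_eq:
  assumes f: "f \<in> hom C x y" and g: "g \<in> hom C x y" and z: "f \<oplus> Scale C (- 1) g = Zero C x y"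
  shows "f = g"
proof -
  have g': "Scale C (- 1) g \<in> hom C x y" using g by (rule Scale_hom)
  have "f = f \<oplus> (Scale C (- 1) g \<oplus> g)"
    using Add_commute[OF g g'] Add_minus[OF g] Add_Zero[OF f] by simp
  also have "\<dots> = Zero C x y \<oplus> g"
    using Add_assoc[OF f g' g] z by simp
  also have "\<dots> = g"
    using Add_commute[of "Zero C x y" x y g] Add_Zero[OF g] Zero_hom g by auto
  finally show ?thesis .
qed

lemma arrow_sum_simps [simp]:
  "arrow_sum C x y [] = Zero C x y"
  "arrow_sum C x y (f # fs) = f \<oplus> arrow_sum C x y fs"
  by (simp_all add: arrow_sum_def)

lemma arrow_sum_hom:
  "\<lbrakk>x \<in> Obj C; y \<in> Obj C; set fs \<subseteq> hom C x y\<rbrakk> \<Longrightarrow> arrow_sum C x y fs \<in> hom C x y"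
  by (induction fs) auto

end


section \<open>Module categories and module functors\<close>

context module_category
begin

lemma Act_simps [simp]:
  "\<lbrakk>c \<in> Obj C; m \<in> Obj M\<rbrakk> \<Longrightarrow> c \<triangleright> m \<in> Obj M"
  "\<lbrakk>k \<in> Arr C; g \<in> Arr M\<rbrakk> \<Longrightarrow> k \<odot> g \<in> Arr M"
  "\<lbrakk>k \<in> Arr C; g \<in> Arr M\<rbrakk> \<Longrightarrow> Dom M (k \<odot> g) = Dom C k \<triangleright> Dom M g"
  "\<lbrakk>k \<in> Arr C; g \<in> Arr M\<rbrakk> \<Longrightarrow> Cod M (k \<odot> g) = Cod C k \<triangleright> Cod M g"
  "\<lbrakk>c \<in> Obj C; m \<in> Obj M\<rbrakk> \<Longrightarrow> Id C c \<odot> Id M m = Id M (c \<triangleright> m)"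
  using ActO_Obj[of c m] ActA_hom[of k "Dom C k" "Cod C k" g "Dom M g" "Cod M g"] ActA_Id[of c m]
  by auto

lemma Mass_simps [simp]:
  assumes "c \<in> Obj C" "d \<in> Obj C" "m \<in> Obj M"
  shows "Mass M c d m \<in> Arr M" "Dom M (Mass M c d m) = (c \<otimes>\<^bsub>C\<^esub> d) \<triangleright> m"
    "Cod M (Mass M c d m) = c \<triangleright> d \<triangleright> m" "iso M (Mass M c d m)"
  using Mass_hom[OF assms] Mass_iso[OF assms] by auto

lemma Munit_simps [simp]:
  assumes "m \<in> Obj M"
  shows "Munit M m \<in> Arr M" "Dom M (Munit M m) = Unit C \<triangleright> m" "Cod M (Munit M m) = m"
    "iso M (Munit M m)"
  using Munit_hom[OF assms] Munit_iso[OF assms] by auto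

declare C.Unit_Obj [simp] C.TensO_Obj [simp]

lemma ActA_fuse:
  "\<lbrakk>k \<in> Arr C; k' \<in> Arr C; Dom C k' = Cod C k; g \<in> Arr M; g' \<in> Arr M; Dom M g' = Cod M g\<rbrakk>
    \<Longrightarrow> (k' \<odot> g') \<cdot> (k \<odot> g) = (k' \<cdot>\<^bsub>C\<^esub> k) \<odot> (g' \<cdot> g)"
  using ActA_Comp[of k "Dom C k" "Cod C k" k' "Cod C k'" g "Dom M g" "Cod M g" g' "Cod M g'"] by simp

lemma ActA_fuse_tail:
  "\<lbrakk>k \<in> Arr C; k' \<in> Arr C; Dom C k' = Cod C k; g \<in> Arr M; g' \<in> Arr M; Dom M g' = Cod M g;
    x \<in> Arr M; Cod M x = Dom C k \<triangleright> Dom M g\<rbrakk>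
    \<Longrightarrow> (k' \<odot> g') \<cdot> (k \<odot> g) \<cdot> x = ((k' \<cdot>\<^bsub>C\<^esub> k) \<odot> (g' \<cdot> g)) \<cdot> x"
  by (rule Comp_extend[OF ActA_fuse]) simp_all

lemma Mass_slide:
  "\<lbrakk>k \<in> Arr C; l \<in> Arr C; g \<in> Arr M; Cod C k = c; Cod C l = d; Cod M g = m\<rbrakk>
    \<Longrightarrow> Mass M c d m \<cdot> ((k \<boxtimes>\<^bsub>C\<^esub> l) \<odot> g) = (k \<odot> l \<odot> g) \<cdot> Mass M (Dom C k) (Dom C l) (Dom M g)"
  using Mass_natural[of k "Dom C k" c l "Dom C l" d g "Dom M g" m] by simp

lemma Munit_slide:
  "f \<in> Arr M \<Longrightarrow> Cod M f = m \<Longrightarrow> Munit M m \<cdot> (Id C (Unit C) \<odot> f) = f \<cdot> Munit M (Dom M f)"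
  using Munit_natural[of f "Dom M f" m] by simp

lemma iso_ActA [simp]:
  assumes "iso C k" "iso M g"
  shows "iso M (k \<odot> g)" "Inv M (k \<odot> g) = Inv C k \<odot> Inv M g"
proof -
  have *: "k \<odot> g \<in> Arr M" "Inv C k \<odot> Inv M g \<in> hom M (Cod M (k \<odot> g)) (Dom M (k \<odot> g))"
    "(Inv C k \<odot> Inv M g) \<cdot> (k \<odot> g) = Id M (Dom M (k \<odot> g))"
    "(k \<odot> g) \<cdot> (Inv C k \<odot> Inv M g) = Id M (Cod M (k \<odot> g))"
    using assms by (simp_all add: C.iso_Arr iso_Arr ActA_fuse)
  show "iso M (k \<odot> g)" "Inv M (k \<odot> g) = Inv C k \<odot> Inv M g"
    using isoI[OF *] by simp_all
qed

text \<open>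
  Scalars of \<open>M\<close> come from the action of the scalars of the unit object.  This is why a functor
  that respects the action respects scalars, even if it is only known to be additive.
\<close>

lemma Scale_via_unit:
  assumes "f \<in> Arr M"
  shows "Scale M r f =
    Munit M (Cod M f) \<cdot> (Scale C r (Id C (Unit C)) \<odot> f) \<cdot> Inv M (Munit M (Dom M f))"
proof -
  have "Scale C r (Id C (Unit C)) \<odot> f = Scale M r (Id C (Unit C) \<odot> f)"
    using assms ActA_Scale_left[of "Id C (Unit C)" "Unit C" "Unit C" f "Dom M f" "Cod M f" r] by simp
  then have "Munit M (Cod M f) \<cdot> (Scale C r (Id C (Unit C)) \<odot> f) \<cdot> Inv M (Munit M (Dom M f))
      = Scale M r ((Munit M (Cod M f) \<cdot> (Id C (Unit C) \<odot> f)) \<cdot> Inv M (Munit M (Dom M f)))"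
    using assms by (simp add: Comp_linear_simps)
  also have "\<dots> = Scale M r f"
    using assms by (simp add: Munit_slide)
  finally show ?thesis by simp
qed

end

context module_functor
begin

lemma FO_Obj_simp [simp]: "m \<in> Obj M \<Longrightarrow> FO F m \<in> Obj N"
  by (rule FO_Obj)

lemma FA_simps [simp]:
  "f \<in> Arr M \<Longrightarrow> FA F f \<in> Arr N"
  "f \<in> Arr M \<Longrightarrow> Dom N (FA F f) = FO F (Dom M f)"
  "f \<in> Arr M \<Longrightarrow> Cod N (FA F f) = FO F (Cod M f)"
  "m \<in> Obj M \<Longrightarrow> FA F (Id M m) = Id N (FO F m)"
  "\<lbrakk>f \<in> Arr M; g \<in> Arr M; Dom M g = Cod M f\<rbrakk> \<Longrightarrow> FA F (g \<cdot>\<^bsub>M\<^esub> f) = FA F g \<cdot>\<^bsub>N\<^esub> FA F f"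
  using FA_hom[of f "Dom M f" "Cod M f"] FA_Id[of m] FA_Comp[of f "Dom M f" "Cod M f" g "Cod M g"]
  by auto

lemma FS_simps [simp]:
  assumes "c \<in> Obj C" "m \<in> Obj M"
  shows "FS F c m \<in> Arr N" "Dom N (FS F c m) = FO F (c \<triangleright>\<^bsub>M\<^esub> m)"
    "Cod N (FS F c m) = c \<triangleright>\<^bsub>N\<^esub> FO F m" "iso N (FS F c m)"
  using FS_hom[OF assms] FS_iso[OF assms] by auto

lemma FA_iso [simp]:
  assumes "iso M f"
  shows "iso N (FA F f)" "FA F (Inv M f) = Inv N (FA F f)"
proof -
  have f: "f \<in> Arr M" using assms by (rule M.iso_Arr)
  have *: "FA F f \<in> Arr N" "FA F (Inv M f) \<in> hom N (Cod N (FA F f)) (Dom N (FA F f))"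
    "FA F (Inv M f) \<cdot>\<^bsub>N\<^esub> FA F f = Id N (Dom N (FA F f))"
    "FA F f \<cdot>\<^bsub>N\<^esub> FA F (Inv M f) = Id N (Cod N (FA F f))"
    using assms f by (simp_all flip: FA_simps(5))
  show "iso N (FA F f)" "FA F (Inv M f) = Inv N (FA F f)"
    using N.isoI[OF *] by simp_all
qed

lemma FS_slide:
  "\<lbrakk>k \<in> Arr C; f \<in> Arr M; Cod C k = c; Cod M f = m\<rbrakk>
    \<Longrightarrow> FS F c m \<cdot>\<^bsub>N\<^esub> FA F (k \<odot>\<^bsub>M\<^esub> f) = (k \<odot>\<^bsub>N\<^esub> FA F f) \<cdot>\<^bsub>N\<^esub> FS F (Dom C k) (Dom M f)"
  using FS_natural[of k "Dom C k" c f "Dom M f" m] by simp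

lemma FS_slide_tail:
  "\<lbrakk>k \<in> Arr C; f \<in> Arr M; Cod C k = c; Cod M f = m; x \<in> Arr N;
    Cod N x = FO F (Dom C k \<triangleright>\<^bsub>M\<^esub> Dom M f)\<rbrakk>
    \<Longrightarrow> FS F c m \<cdot>\<^bsub>N\<^esub> FA F (k \<odot>\<^bsub>M\<^esub> f) \<cdot>\<^bsub>N\<^esub> x
      = (k \<odot>\<^bsub>N\<^esub> FA F f) \<cdot>\<^bsub>N\<^esub> FS F (Dom C k) (Dom M f) \<cdot>\<^bsub>N\<^esub> x"
  using N.Comp_extend[OF FS_slide, of k f c m x] by auto

lemma FA_ActA:
  assumes "k \<in> Arr C" "f \<in> Arr M"
  shows "FA F (k \<odot>\<^bsub>M\<^esub> f) =
    Inv N (FS F (Cod C k) (Cod M f)) \<cdot>\<^bsub>N\<^esub> (k \<odot>\<^bsub>N\<^esub> FA F f) \<cdot>\<^bsub>N\<^esub> FS F (Dom C k) (Dom M f)"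
proof -
  have "FA F (k \<odot>\<^bsub>M\<^esub> f) =
      Inv N (FS F (Cod C k) (Cod M f)) \<cdot>\<^bsub>N\<^esub> FS F (Cod C k) (Cod M f) \<cdot>\<^bsub>N\<^esub> FA F (k \<odot>\<^bsub>M\<^esub> f)"
    using assms by simp
  then show ?thesis using assms by (simp only: FS_slide)
qed

lemma FA_Munit:
  "m \<in> Obj M \<Longrightarrow> FA F (Munit M m) = Munit N (FO F m) \<cdot>\<^bsub>N\<^esub> FS F (Unit C) m"
  by (simp add: functor_triangle)

lemma FA_Mass:
  assumes "c \<in> Obj C" "d \<in> Obj C" "m \<in> Obj M"
  shows "FA F (Mass M c d m) =
    Inv N (FS F c (d \<triangleright>\<^bsub>M\<^esub> m)) \<cdot>\<^bsub>N\<^esub> (Id C c \<odot>\<^bsub>N\<^esub> Inv N (FS F d m)) \<cdot>\<^bsub>N\<^esub>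
    Mass N c d (FO F m) \<cdot>\<^bsub>N\<^esub> FS F (c \<otimes>\<^bsub>C\<^esub> d) m"
  unfolding functor_pentagon[OF assms]
  using assms by (simp add: N.ActA_fuse_tail)

lemma FA_Scale:
  assumes "f \<in> Arr M"
  shows "FA F (Scale M r f) = Scale N r (FA F f)"
  using assms
  by (simp add: M.Scale_via_unit[OF assms] N.Scale_via_unit FA_Munit FA_ActA)

end

text \<open>
  Outside the objects and arrows of the source a module functor is arbitrary, so the associativity
  of the composition, for example, holds only in the sense of the following relation.
\<close>

definition mfun_agree ::
  "('c, 'k, 'y) fusion_cat_scheme \<Rightarrow> ('c, 'k, 'o, 'a, 'u) module_cat_scheme \<Rightarrow>
   ('c, 'o, 'a, 'p, 'b) mfun \<Rightarrow> ('c, 'o, 'a, 'p, 'b) mfun \<Rightarrow> bool" where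
  "mfun_agree C M F G \<longleftrightarrow> (\<forall>m \<in> Obj M. FO F m = FO G m) \<and> (\<forall>f \<in> Arr M. FA F f = FA G f) \<and>
     (\<forall>c \<in> Obj C. \<forall>m \<in> Obj M. FS F c m = FS G c m)"

lemma id_mfun_simps [simp]:
  "FO (id_mfun M) = (\<lambda>m. m)" "FA (id_mfun M) = (\<lambda>f. f)"
  "FS (id_mfun M) c m = Id M (c \<triangleright>\<^bsub>M\<^esub> m)"
  by (simp_all add: id_mfun_def)

lemma mfun_comp_simps [simp]:
  "FO (mfun_comp E K F) = (\<lambda>m. FO K (FO F m))" "FA (mfun_comp E K F) = (\<lambda>f. FA K (FA F f))"
  "FS (mfun_comp E K F) c m = FS K c (FO F m) \<cdot>\<^bsub>E\<^esub> FA K (FS F c m)"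
  by (simp_all add: mfun_comp_def)

lemma module_functor_id:
  assumes "module_category C M"
  shows "module_functor C M M (id_mfun M)"
proof -
  interpret module_category C M by fact
  show ?thesis
    by unfold_locales (simp_all del: iso_Inv)
qed

lemma module_functor_comp:
  assumes "module_functor C M N F" and "module_functor C N E K"
  shows "module_functor C M E (mfun_comp E K F)"
proof -
  interpret F: module_functor C M N F by fact
  interpret K: module_functor C N E K by fact
  have pentagon: "Mass E c d (FO K (FO F m)) \<cdot>\<^bsub>E\<^esub> FS K (c \<otimes>\<^bsub>C\<^esub> d) (FO F m) \<cdot>\<^bsub>E\<^esub> FA K (FS F (c \<otimes>\<^bsub>C\<^esub> d) m)
      = (Id C c \<odot>\<^bsub>E\<^esub> (FS K d (FO F m) \<cdot>\<^bsub>E\<^esub> FA K (FS F d m))) \<cdot>\<^bsub>E\<^esub>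
        FS K c (FO F (d \<triangleright>\<^bsub>M\<^esub> m)) \<cdot>\<^bsub>E\<^esub> FA K (FS F c (d \<triangleright>\<^bsub>M\<^esub> m)) \<cdot>\<^bsub>E\<^esub> FA K (FA F (Mass M c d m))"
    if "c \<in> Obj C" "d \<in> Obj C" "m \<in> Obj M" for c d m
  proof -
    have "Mass E c d (FO K (FO F m)) \<cdot>\<^bsub>E\<^esub> FS K (c \<otimes>\<^bsub>C\<^esub> d) (FO F m) \<cdot>\<^bsub>E\<^esub> FA K (FS F (c \<otimes>\<^bsub>C\<^esub> d) m)
      = (Mass E c d (FO K (FO F m)) \<cdot>\<^bsub>E\<^esub> FS K (c \<otimes>\<^bsub>C\<^esub> d) (FO F m)) \<cdot>\<^bsub>E\<^esub> FA K (FS F (c \<otimes>\<^bsub>C\<^esub> d) m)"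
      using that by simp
    also have "\<dots> = (Id C c \<odot>\<^bsub>E\<^esub> FS K d (FO F m)) \<cdot>\<^bsub>E\<^esub> FS K c (d \<triangleright>\<^bsub>N\<^esub> FO F m) \<cdot>\<^bsub>E\<^esub>
        FA K (Mass N c d (FO F m) \<cdot>\<^bsub>N\<^esub> FS F (c \<otimes>\<^bsub>C\<^esub> d) m)"
      using that by (simp add: K.functor_pentagon)
    also have "\<dots> = (Id C c \<odot>\<^bsub>E\<^esub> (FS K d (FO F m) \<cdot>\<^bsub>E\<^esub> FA K (FS F d m))) \<cdot>\<^bsub>E\<^esub>
        FS K c (FO F (d \<triangleright>\<^bsub>M\<^esub> m)) \<cdot>\<^bsub>E\<^esub> FA K (FS F c (d \<triangleright>\<^bsub>M\<^esub> m)) \<cdot>\<^bsub>E\<^esub> FA K (FA F (Mass M c d m))"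
      unfolding F.functor_pentagon[OF that]
      using that by (simp add: K.FS_slide_tail K.N.ActA_fuse_tail)
    finally show ?thesis .
  qed
  have triangle: "Munit E (FO K (FO F m)) \<cdot>\<^bsub>E\<^esub> FS K (Unit C) (FO F m) \<cdot>\<^bsub>E\<^esub> FA K (FS F (Unit C) m)
      = FA K (FA F (Munit M m))" if "m \<in> Obj M" for m
    using that by (simp add: F.FA_Munit K.FA_Munit)
  have natural: "(FS K c' (FO F m') \<cdot>\<^bsub>E\<^esub> FA K (FS F c' m')) \<cdot>\<^bsub>E\<^esub> FA K (FA F (k \<odot>\<^bsub>M\<^esub> f))
      = (k \<odot>\<^bsub>E\<^esub> FA K (FA F f)) \<cdot>\<^bsub>E\<^esub> FS K c (FO F m) \<cdot>\<^bsub>E\<^esub> FA K (FS F c m)"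
    if "k \<in> hom C c c'" "f \<in> hom M m m'" for c c' k m m' f
  proof -
    have [simp]: "k \<in> Arr C" "f \<in> Arr M" "c' \<in> Obj C" "m' \<in> Obj M" "c \<in> Obj C" "m \<in> Obj M"
      using that F.M.C.Dom_Obj F.M.C.Cod_Obj F.M.Dom_Obj F.M.Cod_Obj by fastforce+
    have "(FS K c' (FO F m') \<cdot>\<^bsub>E\<^esub> FA K (FS F c' m')) \<cdot>\<^bsub>E\<^esub> FA K (FA F (k \<odot>\<^bsub>M\<^esub> f))
        = FS K c' (FO F m') \<cdot>\<^bsub>E\<^esub> FA K (FS F c' m' \<cdot>\<^bsub>N\<^esub> FA F (k \<odot>\<^bsub>M\<^esub> f))"
      using that by simp
    also have "\<dots> = (k \<odot>\<^bsub>E\<^esub> FA K (FA F f)) \<cdot>\<^bsub>E\<^esub> FS K c (FO F m) \<cdot>\<^bsub>E\<^esub> FA K (FS F c m)"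
      using that F.FS_natural[OF that] by (simp add: K.FS_slide_tail)
    finally show ?thesis .
  qed
  show ?thesis
    using pentagon triangle natural by unfold_locales (simp_all add: F.FA_Add K.FA_Add)
qed


section \<open>Module natural transformations\<close>

context module_nat_transf
begin

lemma nat_simps [simp]:
  assumes "m \<in> Obj M"
  shows "\<rho> m \<in> Arr N" "Dom N (\<rho> m) = FO F m" "Cod N (\<rho> m) = FO G m"
  using nat_hom[OF assms] by auto

lemma nat_slide:
  "\<lbrakk>f \<in> Arr M; Cod M f = m\<rbrakk> \<Longrightarrow> \<rho> m \<cdot>\<^bsub>N\<^esub> FA F f = FA G f \<cdot>\<^bsub>N\<^esub> \<rho> (Dom M f)"
  using nat_natural[of f "Dom M f" m] by simp

lemma nat_slide_tail:
  "\<lbrakk>f \<in> Arr M; Cod M f = m; x \<in> Arr N; Cod N x = FO F (Dom M f)\<rbrakk>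
    \<Longrightarrow> \<rho> m \<cdot>\<^bsub>N\<^esub> FA F f \<cdot>\<^bsub>N\<^esub> x = FA G f \<cdot>\<^bsub>N\<^esub> \<rho> (Dom M f) \<cdot>\<^bsub>N\<^esub> x"
  using F.N.Comp_extend[OF nat_slide, of f m x] by auto

end

lemma vcomp_apply [simp]: "m \<in> Obj M \<Longrightarrow> vcomp M N \<sigma> \<rho> m = \<sigma> m \<cdot>\<^bsub>N\<^esub> \<rho> m"
  by (simp add: vcomp_def)

lemma module_nat_transf_restrictI:
  assumes "module_nat_transf C M N F G \<sigma>" and "\<And>m. m \<in> Obj M \<Longrightarrow> \<sigma> m = \<rho> m"
  shows "module_nat_transf C M N F G (\<lambda>m \<in> Obj M. \<rho> m)"
proof -
  have "(\<lambda>m \<in> Obj M. \<rho> m) = \<sigma>"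
    using module_nat_transf.nat_extensional[OF assms(1)] assms(2)
    by (intro extensionalityI[of _ "Obj M"]) auto
  then show ?thesis using assms(1) by simp
qed

text \<open>Transformations only see functors on objects and arrows of their source.\<close>

lemma module_nat_transf_cong:
  assumes "module_nat_transf C M N F G \<rho>" and "mfun_agree C M F F'" and "mfun_agree C M G G'"
    and "module_functor C M N F'" and "module_functor C M N G'"
  shows "module_nat_transf C M N F' G' \<rho>"
proof -
  interpret \<rho>: module_nat_transf C M N F G \<rho> by fact
  interpret F': module_functor C M N F' by fact
  interpret G': module_functor C M N G' by fact
  have eqs: "\<And>m. m \<in> Obj M \<Longrightarrow> FO F' m = FO F m" "\<And>f. f \<in> Arr M \<Longrightarrow> FA F' f = FA F f"
    "\<And>c m. \<lbrakk>c \<in> Obj C; m \<in> Obj M\<rbrakk> \<Longrightarrow> FS F' c m = FS F c m"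
    "\<And>m. m \<in> Obj M \<Longrightarrow> FO G' m = FO G m" "\<And>f. f \<in> Arr M \<Longrightarrow> FA G' f = FA G f"
    "\<And>c m. \<lbrakk>c \<in> Obj C; m \<in> Obj M\<rbrakk> \<Longrightarrow> FS G' c m = FS G c m"
    using assms(2,3) by (auto simp: mfun_agree_def)
  show ?thesis
    using \<rho>.nat_extensional \<rho>.nat_natural \<rho>.nat_module
    by unfold_locales (auto simp: eqs)
qed

lemma module_nat_transf_agree:
  assumes "mfun_agree C M F G" and "module_functor C M N F" and "module_functor C M N G"
  shows "module_nat_transf C M N F G (\<lambda>m \<in> Obj M. Id N (FO G m))"
proof -
  interpret F: module_functor C M N F by fact
  interpret G: module_functor C M N G by fact
  have eqs: "\<And>m. m \<in> Obj M \<Longrightarrow> FO F m = FO G m" "\<And>f. f \<in> Arr M \<Longrightarrow> FA F f = FA G f"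
    "\<And>c m. \<lbrakk>c \<in> Obj C; m \<in> Obj M\<rbrakk> \<Longrightarrow> FS F c m = FS G c m"
    using assms(1) by (auto simp: mfun_agree_def)
  show ?thesis
    by unfold_locales (auto simp: eqs)
qed

lemma module_nat_transf_id:
  assumes "module_functor C M N F"
  shows "module_nat_transf C M N F F (\<lambda>m \<in> Obj M. Id N (FO F m))"
  using module_nat_transf_agree[OF _ assms assms] by (simp add: mfun_agree_def)

lemma module_nat_transf_vcomp:
  assumes "module_nat_transf C M N F G \<rho>" and "module_nat_transf C M N G H \<sigma>"
  shows "module_nat_transf C M N F H (vcomp M N \<sigma> \<rho>)"
proof -
  interpret \<rho>: module_nat_transf C M N F G \<rho> by fact
  interpret \<sigma>: module_nat_transf C M N G H \<sigma> by fact
  have "FS H c m \<cdot>\<^bsub>N\<^esub> \<sigma> (c \<triangleright>\<^bsub>M\<^esub> m) \<cdot>\<^bsub>N\<^esub> \<rho> (c \<triangleright>\<^bsub>M\<^esub> m)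
      = (Id C c \<odot>\<^bsub>N\<^esub> (\<sigma> m \<cdot>\<^bsub>N\<^esub> \<rho> m)) \<cdot>\<^bsub>N\<^esub> FS F c m" if [simp]: "c \<in> Obj C" "m \<in> Obj M" for c m
  proof -
    have "FS H c m \<cdot>\<^bsub>N\<^esub> \<sigma> (c \<triangleright>\<^bsub>M\<^esub> m) \<cdot>\<^bsub>N\<^esub> \<rho> (c \<triangleright>\<^bsub>M\<^esub> m)
        = (FS H c m \<cdot>\<^bsub>N\<^esub> \<sigma> (c \<triangleright>\<^bsub>M\<^esub> m)) \<cdot>\<^bsub>N\<^esub> \<rho> (c \<triangleright>\<^bsub>M\<^esub> m)"
      by simp
    also have "\<dots> = (Id C c \<odot>\<^bsub>N\<^esub> \<sigma> m) \<cdot>\<^bsub>N\<^esub> FS G c m \<cdot>\<^bsub>N\<^esub> \<rho> (c \<triangleright>\<^bsub>M\<^esub> m)"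
      by (simp add: \<sigma>.nat_module)
    also have "\<dots> = (Id C c \<odot>\<^bsub>N\<^esub> (\<sigma> m \<cdot>\<^bsub>N\<^esub> \<rho> m)) \<cdot>\<^bsub>N\<^esub> FS F c m"
      by (simp add: \<rho>.nat_module \<rho>.F.N.ActA_fuse_tail)
    finally show ?thesis .
  qed
  then show ?thesis
    by unfold_locales (auto simp: vcomp_def \<rho>.nat_slide \<sigma>.nat_slide_tail)
qed

lemma module_nat_transf_whisker_left:
  assumes "module_nat_transf C M N F G \<rho>" and "module_functor C N E K"
  shows "module_nat_transf C M E (mfun_comp E K F) (mfun_comp E K G) (\<lambda>m \<in> Obj M. FA K (\<rho> m))"
proof -
  interpret \<rho>: module_nat_transf C M N F G \<rho> by fact
  interpret K: module_functor C N E K by fact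
  interpret KF: module_functor C M E "mfun_comp E K F"
    by (rule module_functor_comp) unfold_locales
  interpret KG: module_functor C M E "mfun_comp E K G"
    by (rule module_functor_comp) unfold_locales
  have "FA K (\<rho> m') \<cdot>\<^bsub>E\<^esub> FA K (FA F f) = FA K (FA G f) \<cdot>\<^bsub>E\<^esub> FA K (\<rho> m)"
    if "f \<in> hom M m m'" for f m m'
    using arg_cong[OF \<rho>.nat_natural[OF that], of "FA K"] that by auto
  moreover have "(FS K c (FO G m) \<cdot>\<^bsub>E\<^esub> FA K (FS G c m)) \<cdot>\<^bsub>E\<^esub> FA K (\<rho> (c \<triangleright>\<^bsub>M\<^esub> m))
      = (Id C c \<odot>\<^bsub>E\<^esub> FA K (\<rho> m)) \<cdot>\<^bsub>E\<^esub> FS K c (FO F m) \<cdot>\<^bsub>E\<^esub> FA K (FS F c m)"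
    if [simp]: "c \<in> Obj C" "m \<in> Obj M" for c m
  proof -
    have "(FS K c (FO G m) \<cdot>\<^bsub>E\<^esub> FA K (FS G c m)) \<cdot>\<^bsub>E\<^esub> FA K (\<rho> (c \<triangleright>\<^bsub>M\<^esub> m))
        = FS K c (FO G m) \<cdot>\<^bsub>E\<^esub> FA K (FS G c m \<cdot>\<^bsub>N\<^esub> \<rho> (c \<triangleright>\<^bsub>M\<^esub> m))"
      by simp
    also have "\<dots> = (Id C c \<odot>\<^bsub>E\<^esub> FA K (\<rho> m)) \<cdot>\<^bsub>E\<^esub> FS K c (FO F m) \<cdot>\<^bsub>E\<^esub> FA K (FS F c m)"
      unfolding \<rho>.nat_module[OF that] by (simp add: K.FS_slide_tail)
    finally show ?thesis .
  qed
  ultimately show ?thesis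
    by unfold_locales auto
qed

lemma module_nat_transf_whisker_right:
  assumes "module_nat_transf C N E K K' \<sigma>" and "module_functor C M N F"
  shows "module_nat_transf C M E (mfun_comp E K F) (mfun_comp E K' F) (\<lambda>m \<in> Obj M. \<sigma> (FO F m))"
proof -
  interpret \<sigma>: module_nat_transf C N E K K' \<sigma> by fact
  interpret F: module_functor C M N F by fact
  interpret KF: module_functor C M E "mfun_comp E K F"
    by (rule module_functor_comp) unfold_locales
  interpret KG: module_functor C M E "mfun_comp E K' F"
    by (rule module_functor_comp) unfold_locales
  have "(FS K' c (FO F m) \<cdot>\<^bsub>E\<^esub> FA K' (FS F c m)) \<cdot>\<^bsub>E\<^esub> \<sigma> (FO F (c \<triangleright>\<^bsub>M\<^esub> m))
      = (Id C c \<odot>\<^bsub>E\<^esub> \<sigma> (FO F m)) \<cdot>\<^bsub>E\<^esub> FS K c (FO F m) \<cdot>\<^bsub>E\<^esub> FA K (FS F c m)"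
    if [simp]: "c \<in> Obj C" "m \<in> Obj M" for c m
  proof -
    have "(FS K' c (FO F m) \<cdot>\<^bsub>E\<^esub> FA K' (FS F c m)) \<cdot>\<^bsub>E\<^esub> \<sigma> (FO F (c \<triangleright>\<^bsub>M\<^esub> m))
        = (FS K' c (FO F m) \<cdot>\<^bsub>E\<^esub> \<sigma> (c \<triangleright>\<^bsub>N\<^esub> FO F m)) \<cdot>\<^bsub>E\<^esub> FA K (FS F c m)"
      by (simp add: \<sigma>.nat_slide)
    then show ?thesis
      by (simp add: \<sigma>.nat_module)
  qed
  then show ?thesis
    by unfold_locales (auto simp: \<sigma>.nat_slide)
qed

lemma module_nat_transf_hcomp:
  assumes "module_nat_transf C M N F F' \<rho>" and "module_nat_transf C N E K K' \<sigma>"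
  shows "module_nat_transf C M E (mfun_comp E K F) (mfun_comp E K' F') (hcomp M E K F' \<sigma> \<rho>)"
proof -
  interpret \<rho>: module_nat_transf C M N F F' \<rho> by fact
  interpret \<sigma>: module_nat_transf C N E K K' \<sigma> by fact
  have "hcomp M E K F' \<sigma> \<rho> = vcomp M E (\<lambda>m \<in> Obj M. \<sigma> (FO F' m)) (\<lambda>m \<in> Obj M. FA K (\<rho> m))"
    by (auto simp: hcomp_def vcomp_def)
  then show ?thesis
    using module_nat_transf_vcomp[OF module_nat_transf_whisker_left[OF assms(1)]
        module_nat_transf_whisker_right[OF assms(2)]]
    by (simp add: \<sigma>.F.module_functor_axioms \<rho>.G.module_functor_axioms)
qed

lemma module_nat_transf_inverse:
  assumes "module_nat_iso C M N F G \<rho>"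
  shows "module_nat_transf C M N G F (\<lambda>m \<in> Obj M. Inv N (\<rho> m))"
proof -
  interpret module_nat_iso C M N F G \<rho> by fact
  note nat_iso [simp]
  have "Inv N (\<rho> m') \<cdot>\<^bsub>N\<^esub> FA G f = FA F f \<cdot>\<^bsub>N\<^esub> Inv N (\<rho> m)" if "f \<in> hom M m m'" for f m m'
  proof -
    have [simp]: "f \<in> Arr M" "m \<in> Obj M" "m' \<in> Obj M" "Dom M f = m" "Cod M f = m'"
      using that by auto
    have "Inv N (\<rho> m') \<cdot>\<^bsub>N\<^esub> FA G f = Inv N (\<rho> m') \<cdot>\<^bsub>N\<^esub> (FA G f \<cdot>\<^bsub>N\<^esub> \<rho> m) \<cdot>\<^bsub>N\<^esub> Inv N (\<rho> m)"
      by simp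
    also have "FA G f \<cdot>\<^bsub>N\<^esub> \<rho> m = \<rho> m' \<cdot>\<^bsub>N\<^esub> FA F f" by (simp add: nat_slide)
    finally show ?thesis by simp
  qed
  moreover have "FS F c m \<cdot>\<^bsub>N\<^esub> Inv N (\<rho> (c \<triangleright>\<^bsub>M\<^esub> m)) = (Id C c \<odot>\<^bsub>N\<^esub> Inv N (\<rho> m)) \<cdot>\<^bsub>N\<^esub> FS G c m"
    if [simp]: "c \<in> Obj C" "m \<in> Obj M" for c m
  proof -
    have "(Id C c \<odot>\<^bsub>N\<^esub> Inv N (\<rho> m)) \<cdot>\<^bsub>N\<^esub> FS G c m
        = (Id C c \<odot>\<^bsub>N\<^esub> Inv N (\<rho> m)) \<cdot>\<^bsub>N\<^esub> (FS G c m \<cdot>\<^bsub>N\<^esub> \<rho> (c \<triangleright>\<^bsub>M\<^esub> m)) \<cdot>\<^bsub>N\<^esub> Inv N (\<rho> (c \<triangleright>\<^bsub>M\<^esub> m))"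
      by simp
    also have "\<dots> = FS F c m \<cdot>\<^bsub>N\<^esub> Inv N (\<rho> (c \<triangleright>\<^bsub>M\<^esub> m))"
      unfolding nat_module[OF that] by (simp add: F.N.ActA_fuse_tail)
    finally show ?thesis by simp
  qed
  ultimately show ?thesis
    by unfold_locales auto
qed


section \<open>Adjunctions\<close>

context left_adjoint
begin

lemma unit_simps [simp]:
  assumes "n \<in> Obj N"
  shows "Lunt A n \<in> Arr N" "Dom N (Lunt A n) = n" "Cod N (Lunt A n) = FO F (FO (Lfun A) n)"
  using unit.nat_hom[OF assms] by auto

lemma counit_simps [simp]:
  assumes "m \<in> Obj M"
  shows "Lcnt A m \<in> Arr M" "Dom M (Lcnt A m) = FO (Lfun A) (FO F m)" "Cod M (Lcnt A m) = m"
  using counit.nat_hom[OF assms] by auto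

lemma unit_slide:
  "\<lbrakk>f \<in> Arr N; Cod N f = n\<rbrakk>
    \<Longrightarrow> Lunt A n \<cdot>\<^bsub>N\<^esub> f = FA F (FA (Lfun A) f) \<cdot>\<^bsub>N\<^esub> Lunt A (Dom N f)"
  using unit.nat_slide[of f n] by simp

lemma counit_slide:
  "\<lbrakk>f \<in> Arr M; Cod M f = m\<rbrakk>
    \<Longrightarrow> Lcnt A m \<cdot>\<^bsub>M\<^esub> FA (Lfun A) (FA F f) = f \<cdot>\<^bsub>M\<^esub> Lcnt A (Dom M f)"
  using counit.nat_slide[of f m] by simp

lemma counit_slide_tail:
  "\<lbrakk>f \<in> Arr M; Cod M f = m; x \<in> Arr M; Cod M x = FO (Lfun A) (FO F (Dom M f))\<rbrakk>
    \<Longrightarrow> Lcnt A m \<cdot>\<^bsub>M\<^esub> FA (Lfun A) (FA F f) \<cdot>\<^bsub>M\<^esub> x = f \<cdot>\<^bsub>M\<^esub> Lcnt A (Dom M f) \<cdot>\<^bsub>M\<^esub> x"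
  using counit.nat_slide_tail[of f m x] by simp

lemmas triangles [simp] = adj_triangle_right adj_triangle_left

lemma triangles_tail [simp]:
  "\<lbrakk>m \<in> Obj M; x \<in> Arr N; Cod N x = FO F m\<rbrakk>
    \<Longrightarrow> FA F (Lcnt A m) \<cdot>\<^bsub>N\<^esub> Lunt A (FO F m) \<cdot>\<^bsub>N\<^esub> x = x"
  "\<lbrakk>n \<in> Obj N; y \<in> Arr M; Cod M y = FO (Lfun A) n\<rbrakk>
    \<Longrightarrow> Lcnt A (FO (Lfun A) n) \<cdot>\<^bsub>M\<^esub> FA (Lfun A) (Lunt A n) \<cdot>\<^bsub>M\<^esub> y = y"
  using F.N.Comp_extend[OF adj_triangle_right, of m x] F.M.Comp_extend[OF adj_triangle_left, of n y]
  by simp_all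

text \<open>
  Transposing back recovers a morphism from its transpose.
\<close>

lemma unit_cancel:
  assumes "FA F x \<cdot>\<^bsub>N\<^esub> Lunt A n = FA F y \<cdot>\<^bsub>N\<^esub> Lunt A n" "n \<in> Obj N"
    and "x \<in> Arr M" "y \<in> Arr M" "Dom M x = FO (Lfun A) n" "Dom M y = FO (Lfun A) n" "Cod M y = Cod M x"
  shows "x = y"
proof -
  have "Lcnt A (Cod M x) \<cdot>\<^bsub>M\<^esub> FA (Lfun A) (FA F x \<cdot>\<^bsub>N\<^esub> Lunt A n)
      = Lcnt A (Cod M x) \<cdot>\<^bsub>M\<^esub> FA (Lfun A) (FA F y \<cdot>\<^bsub>N\<^esub> Lunt A n)"
    using assms(1) by simp
  then show ?thesis
    using assms(2-) by (simp add: counit_slide_tail)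
qed

lemma counit_cancel:
  assumes "Lcnt A m \<cdot>\<^bsub>M\<^esub> FA (Lfun A) x = Lcnt A m \<cdot>\<^bsub>M\<^esub> FA (Lfun A) y" "m \<in> Obj M"
    and "x \<in> Arr N" "y \<in> Arr N" "Cod N x = FO F m" "Cod N y = FO F m" "Dom N y = Dom N x"
  shows "x = y"
proof -
  have *: "FA F (Lcnt A m \<cdot>\<^bsub>M\<^esub> FA (Lfun A) z) \<cdot>\<^bsub>N\<^esub> Lunt A (Dom N z) = z"
    if "z \<in> Arr N" "Cod N z = FO F m" for z
    using that assms(2) by (simp flip: unit_slide)
  show ?thesis
    using *[of x] *[of y] assms by simp
qed

end

definition id_ladj :: "('c, 'k, 'o, 'a, 'u) module_cat_scheme \<Rightarrow> ('c, 'o, 'a, 'o, 'a) ladj" where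
  "id_ladj M = \<lparr>Lfun = id_mfun M, Lunt = (\<lambda>m \<in> Obj M. Id M m), Lcnt = (\<lambda>m \<in> Obj M. Id M m)\<rparr>"

lemma id_ladj_simps [simp]:
  "Lfun (id_ladj M) = id_mfun M" "Lunt (id_ladj M) = (\<lambda>m \<in> Obj M. Id M m)"
  "Lcnt (id_ladj M) = (\<lambda>m \<in> Obj M. Id M m)"
  by (simp_all add: id_ladj_def)

lemma comp_ladj_simps [simp]:
  "Lfun (comp_ladj M E K AK F AF) = mfun_comp M (Lfun AF) (Lfun AK)"
  "Lunt (comp_ladj M E K AK F AF) =
     (\<lambda>e \<in> Obj E. FA K (Lunt AF (FO (Lfun AK) e)) \<cdot>\<^bsub>E\<^esub> Lunt AK e)"
  "Lcnt (comp_ladj M E K AK F AF) =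
     (\<lambda>m \<in> Obj M. Lcnt AF m \<cdot>\<^bsub>M\<^esub> FA (Lfun AF) (Lcnt AK (FO F m)))"
  by (simp_all add: comp_ladj_def)

lemma left_adjoint_id:
  assumes "module_category C M"
  shows "left_adjoint C M M (id_mfun M) (id_ladj M)"
proof -
  interpret I: module_functor C M M "id_mfun M" by (rule module_functor_id) fact
  interpret II: module_functor C M M "mfun_comp M (id_mfun M) (id_mfun M)"
    by (rule module_functor_comp) unfold_locales
  have "mfun_agree C M (id_mfun M) (mfun_comp M (id_mfun M) (id_mfun M))"
    "mfun_agree C M (mfun_comp M (id_mfun M) (id_mfun M)) (id_mfun M)"
    by (simp_all add: mfun_agree_def)
  note module_nat_transf_agree[OF this(1) I.module_functor_axioms II.module_functor_axioms]
    module_nat_transf_agree[OF this(2) II.module_functor_axioms I.module_functor_axioms]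
  then show ?thesis
    by (simp add: left_adjoint_def left_adjoint_axioms_def
        I.module_functor_axioms II.module_functor_axioms)
qed

lemma left_adjoint_comp:
  assumes "left_adjoint C M N F A" and "left_adjoint C N E K A'"
  shows "left_adjoint C M E (mfun_comp E K F) (comp_ladj M E K A' F A)"
proof -
  interpret A: left_adjoint C M N F A by fact
  interpret A': left_adjoint C N E K A' by fact
  let ?L = "Lfun A" and ?L' = "Lfun A'"
  have KF: "module_functor C M E (mfun_comp E K F)"
    and LL: "module_functor C E M (mfun_comp M ?L ?L')"
    using A.F.module_functor_axioms A'.F.module_functor_axioms
      A.L.module_functor_axioms A'.L.module_functor_axioms
    by (blast intro: module_functor_comp)+
  interpret KF: module_functor C M E "mfun_comp E K F" by (rule KF)
  interpret LL: module_functor C E M "mfun_comp M ?L ?L'" by (rule LL)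
  have "module_nat_transf C E E (mfun_comp E K (mfun_comp N (id_mfun N) ?L'))
      (mfun_comp E K (mfun_comp N (mfun_comp N F ?L) ?L'))
      (\<lambda>e \<in> Obj E. FA K ((\<lambda>e \<in> Obj E. Lunt A (FO ?L' e)) e))"
    by (rule module_nat_transf_whisker_left[OF module_nat_transf_whisker_right
          [OF A.unit.module_nat_transf_axioms A'.L.module_functor_axioms] A'.F.module_functor_axioms])
  then have "module_nat_transf C E E (mfun_comp E K ?L') (mfun_comp E (mfun_comp E K F) (mfun_comp M ?L ?L'))
      (\<lambda>e \<in> Obj E. FA K ((\<lambda>e \<in> Obj E. Lunt A (FO ?L' e)) e))"
    by (rule module_nat_transf_cong)
      (auto simp: mfun_agree_def A'.unit.G.module_functor_axioms intro!: module_functor_comp[OF LL KF])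
  from module_nat_transf_vcomp[OF A'.unit.module_nat_transf_axioms this]
  have unit: "module_nat_transf C E E (id_mfun E) (mfun_comp E (mfun_comp E K F) (mfun_comp M ?L ?L'))
      (\<lambda>e \<in> Obj E. FA K (Lunt A (FO ?L' e)) \<cdot>\<^bsub>E\<^esub> Lunt A' e)"
    by (rule module_nat_transf_restrictI) simp
  have "module_nat_transf C M M (mfun_comp M ?L (mfun_comp N (mfun_comp N ?L' K) F))
      (mfun_comp M ?L (mfun_comp N (id_mfun N) F))
      (\<lambda>m \<in> Obj M. FA ?L ((\<lambda>m \<in> Obj M. Lcnt A' (FO F m)) m))"
    by (rule module_nat_transf_whisker_left[OF module_nat_transf_whisker_right
          [OF A'.counit.module_nat_transf_axioms A.F.module_functor_axioms] A.L.module_functor_axioms])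
  then have "module_nat_transf C M M (mfun_comp M (mfun_comp M ?L ?L') (mfun_comp E K F)) (mfun_comp M ?L F)
      (\<lambda>m \<in> Obj M. FA ?L ((\<lambda>m \<in> Obj M. Lcnt A' (FO F m)) m))"
    by (rule module_nat_transf_cong)
      (auto simp: mfun_agree_def A.counit.F.module_functor_axioms intro!: module_functor_comp[OF KF LL])
  from module_nat_transf_vcomp[OF this A.counit.module_nat_transf_axioms]
  have counit: "module_nat_transf C M M (mfun_comp M (mfun_comp M ?L ?L') (mfun_comp E K F)) (id_mfun M)
      (\<lambda>m \<in> Obj M. Lcnt A m \<cdot>\<^bsub>M\<^esub> FA ?L (Lcnt A' (FO F m)))"
    by (rule module_nat_transf_restrictI) simp
  have right: "FA K (FA F (Lcnt A m)) \<cdot>\<^bsub>E\<^esub> FA K (FA F (FA ?L (Lcnt A' (FO F m)))) \<cdot>\<^bsub>E\<^esub>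
      FA K (Lunt A (FO ?L' (FO K (FO F m)))) \<cdot>\<^bsub>E\<^esub> Lunt A' (FO K (FO F m)) = Id E (FO K (FO F m))"
    if [simp]: "m \<in> Obj M" for m
  proof -
    have "FA K (FA F (Lcnt A m)) \<cdot>\<^bsub>E\<^esub> FA K (FA F (FA ?L (Lcnt A' (FO F m)))) \<cdot>\<^bsub>E\<^esub>
        FA K (Lunt A (FO ?L' (FO K (FO F m)))) \<cdot>\<^bsub>E\<^esub> Lunt A' (FO K (FO F m))
      = FA K (FA F (Lcnt A m) \<cdot>\<^bsub>N\<^esub> FA F (FA ?L (Lcnt A' (FO F m))) \<cdot>\<^bsub>N\<^esub>
        Lunt A (FO ?L' (FO K (FO F m)))) \<cdot>\<^bsub>E\<^esub> Lunt A' (FO K (FO F m))"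
      by simp
    also have "FA F (Lcnt A m) \<cdot>\<^bsub>N\<^esub> FA F (FA ?L (Lcnt A' (FO F m))) \<cdot>\<^bsub>N\<^esub>
        Lunt A (FO ?L' (FO K (FO F m)))
      = FA F (Lcnt A m) \<cdot>\<^bsub>N\<^esub> Lunt A (FO F m) \<cdot>\<^bsub>N\<^esub> Lcnt A' (FO F m)"
      by (simp add: A.unit_slide del: A.triangles_tail)
    also have "\<dots> = Lcnt A' (FO F m)" by simp
    finally show ?thesis by simp
  qed
  have left: "Lcnt A (FO ?L (FO ?L' e)) \<cdot>\<^bsub>M\<^esub> FA ?L (Lcnt A' (FO F (FO ?L (FO ?L' e)))) \<cdot>\<^bsub>M\<^esub>
      FA ?L (FA ?L' (FA K (Lunt A (FO ?L' e)))) \<cdot>\<^bsub>M\<^esub> FA ?L (FA ?L' (Lunt A' e))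
      = Id M (FO ?L (FO ?L' e))"
    if [simp]: "e \<in> Obj E" for e
  proof -
    have "Lcnt A (FO ?L (FO ?L' e)) \<cdot>\<^bsub>M\<^esub> FA ?L (Lcnt A' (FO F (FO ?L (FO ?L' e)))) \<cdot>\<^bsub>M\<^esub>
        FA ?L (FA ?L' (FA K (Lunt A (FO ?L' e)))) \<cdot>\<^bsub>M\<^esub> FA ?L (FA ?L' (Lunt A' e))
      = Lcnt A (FO ?L (FO ?L' e)) \<cdot>\<^bsub>M\<^esub> FA ?L (Lcnt A' (FO F (FO ?L (FO ?L' e))) \<cdot>\<^bsub>N\<^esub>
        FA ?L' (FA K (Lunt A (FO ?L' e))) \<cdot>\<^bsub>N\<^esub> FA ?L' (Lunt A' e))"
      by simp
    also have "Lcnt A' (FO F (FO ?L (FO ?L' e))) \<cdot>\<^bsub>N\<^esub>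
        FA ?L' (FA K (Lunt A (FO ?L' e))) \<cdot>\<^bsub>N\<^esub> FA ?L' (Lunt A' e) = Lunt A (FO ?L' e)"
      by (simp add: A'.counit_slide_tail)
    finally show ?thesis by simp
  qed
  show ?thesis
    using unit counit left right
    by (simp add: left_adjoint_def left_adjoint_axioms_def KF.module_functor_axioms LL.module_functor_axioms)
qed

text \<open>
  Inserting the isomorphism and its inverse into unit and counit keeps the triangle identities: by
  naturality the two meet and cancel.
\<close>

lemma left_adjoint_transport:
  assumes "left_adjoint C M N F A" and "module_nat_iso C N M L (Lfun A) \<alpha>"
  shows "left_adjoint C M N F \<lparr>Lfun = L, Lunt = (\<lambda>n \<in> Obj N. FA F (Inv M (\<alpha> n)) \<cdot>\<^bsub>N\<^esub> Lunt A n),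
    Lcnt = (\<lambda>m \<in> Obj M. Lcnt A m \<cdot>\<^bsub>M\<^esub> \<alpha> (FO F m))\<rparr>"
proof -
  interpret A: left_adjoint C M N F A by fact
  interpret \<alpha>: module_nat_iso C N M L "Lfun A" \<alpha> by fact
  note \<alpha>.nat_iso [simp]
  have "module_nat_transf C N N (mfun_comp N F (Lfun A)) (mfun_comp N F L)
      (\<lambda>n \<in> Obj N. FA F ((\<lambda>n \<in> Obj N. Inv M (\<alpha> n)) n))"
    by (rule module_nat_transf_whisker_left[OF module_nat_transf_inverse[OF assms(2)]
          A.F.module_functor_axioms])
  from module_nat_transf_vcomp[OF A.unit.module_nat_transf_axioms this]
  have unit: "module_nat_transf C N N (id_mfun N) (mfun_comp N F L)
      (\<lambda>n \<in> Obj N. FA F (Inv M (\<alpha> n)) \<cdot>\<^bsub>N\<^esub> Lunt A n)"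
    by (rule module_nat_transf_restrictI) simp
  have "module_nat_transf C M M (mfun_comp M L F) (mfun_comp M (Lfun A) F)
      (\<lambda>m \<in> Obj M. \<alpha> (FO F m))"
    by (rule module_nat_transf_whisker_right[OF \<alpha>.module_nat_transf_axioms A.F.module_functor_axioms])
  from module_nat_transf_vcomp[OF this A.counit.module_nat_transf_axioms]
  have counit: "module_nat_transf C M M (mfun_comp M L F) (id_mfun M)
      (\<lambda>m \<in> Obj M. Lcnt A m \<cdot>\<^bsub>M\<^esub> \<alpha> (FO F m))"
    by (rule module_nat_transf_restrictI) simp
  have left: "Lcnt A (FO L n) \<cdot>\<^bsub>M\<^esub> \<alpha> (FO F (FO L n)) \<cdot>\<^bsub>M\<^esub>
      Inv M (FA L (FA F (\<alpha> n))) \<cdot>\<^bsub>M\<^esub> FA L (Lunt A n) = Id M (FO L n)"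
    if [simp]: "n \<in> Obj N" for n
  proof -
    have "Lcnt A (FO L n) \<cdot>\<^bsub>M\<^esub> \<alpha> (FO F (FO L n)) \<cdot>\<^bsub>M\<^esub>
        Inv M (FA L (FA F (\<alpha> n))) \<cdot>\<^bsub>M\<^esub> FA L (Lunt A n)
      = Lcnt A (FO L n) \<cdot>\<^bsub>M\<^esub> \<alpha> (FO F (FO L n)) \<cdot>\<^bsub>M\<^esub> FA L (FA F (Inv M (\<alpha> n)) \<cdot>\<^bsub>N\<^esub> Lunt A n)"
      by simp
    also have "\<dots> = (Lcnt A (FO L n) \<cdot>\<^bsub>M\<^esub> FA (Lfun A) (FA F (Inv M (\<alpha> n)))) \<cdot>\<^bsub>M\<^esub>
        FA (Lfun A) (Lunt A n) \<cdot>\<^bsub>M\<^esub> \<alpha> n"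
      by (subst \<alpha>.nat_slide) simp_all
    also have "\<dots> = Id M (FO L n)"
      by (subst A.counit_slide) simp_all
    finally show ?thesis .
  qed
  show ?thesis
    using unit counit left
    by (simp add: left_adjoint_def left_adjoint_axioms_def A.F.module_functor_axioms
        \<alpha>.F.module_functor_axioms)
qed


section \<open>Mates\<close>

text \<open>
  The mate \<open>\<rho>\<^sup>l : G\<^sup>l \<rightarrow> F\<^sup>l\<close> of \<open>\<rho> : F \<rightarrow> G\<close> is whiskered together from a unit, \<open>\<rho>\<close> and a counit, hence
  is a module natural transformation.  It is used only through its compatibility with the units
  and with the counits.
\<close>

locale mate = A: left_adjoint C M N F A + A': left_adjoint C M N G A' +
  \<rho>: module_nat_transf C M N F G \<rho>
  for C :: "('c, 'k, 'y) fusion_cat_scheme"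
    and M :: "('c, 'k, 'o, 'a, 'u) module_cat_scheme"
    and N :: "('c, 'k, 'p, 'b, 'v) module_cat_scheme"
    and F G :: "('c, 'o, 'a, 'p, 'b) mfun"
    and A A' :: "('c, 'o, 'a, 'p, 'b) ladj"
    and \<rho> :: "'o \<Rightarrow> 'b"
begin

sublocale transf_l: module_nat_transf C N M "Lfun A'" "Lfun A" "transf_l M N A A' \<rho>"
proof -
  let ?L = "Lfun A" and ?L' = "Lfun A'"
  have 1: "module_nat_transf C N M (mfun_comp M ?L' (id_mfun N)) (mfun_comp M ?L' (mfun_comp N F ?L))
      (\<lambda>n \<in> Obj N. FA ?L' (Lunt A n))"
    by (rule module_nat_transf_whisker_left[OF A.unit.module_nat_transf_axioms A'.L.module_functor_axioms])
  have 2: "module_nat_transf C N M (mfun_comp M ?L' (mfun_comp N F ?L)) (mfun_comp M ?L' (mfun_comp N G ?L))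
      (\<lambda>n \<in> Obj N. FA ?L' ((\<lambda>n \<in> Obj N. \<rho> (FO ?L n)) n))"
    by (rule module_nat_transf_whisker_left[OF module_nat_transf_whisker_right
          [OF \<rho>.module_nat_transf_axioms A.L.module_functor_axioms] A'.L.module_functor_axioms])
  have "module_nat_transf C N M (mfun_comp M (mfun_comp M ?L' G) ?L) (mfun_comp M (id_mfun M) ?L)
      (\<lambda>n \<in> Obj N. Lcnt A' (FO ?L n))"
    by (rule module_nat_transf_whisker_right[OF A'.counit.module_nat_transf_axioms A.L.module_functor_axioms])
  then have 3: "module_nat_transf C N M (mfun_comp M ?L' (mfun_comp N G ?L)) (mfun_comp M (id_mfun M) ?L)
      (\<lambda>n \<in> Obj N. Lcnt A' (FO ?L n))"
    by (rule module_nat_transf_cong)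
      (auto simp: mfun_agree_def intro!: module_functor_comp module_functor_id
        A.L.module_functor_axioms A'.L.module_functor_axioms A'.F.module_functor_axioms
        A.F.M.module_category_axioms)
  have "module_nat_transf C N M ?L' ?L
    (vcomp N M (\<lambda>n \<in> Obj N. Lcnt A' (FO ?L n)) (vcomp N M (\<lambda>n \<in> Obj N. FA ?L' ((\<lambda>n \<in> Obj N. \<rho> (FO ?L n)) n))
      (\<lambda>n \<in> Obj N. FA ?L' (Lunt A n))))"
    by (rule module_nat_transf_cong[OF module_nat_transf_vcomp[OF module_nat_transf_vcomp[OF 1 2] 3]])
      (auto simp: mfun_agree_def A.L.module_functor_axioms A'.L.module_functor_axioms)
  then show "module_nat_transf C N M ?L' ?L (transf_l M N A A' \<rho>)"
    unfolding transf_l_def by (rule module_nat_transf_restrictI) simp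
qed

lemma transf_l_unit:
  assumes [simp]: "n \<in> Obj N"
  shows "FA G (transf_l M N A A' \<rho> n) \<cdot>\<^bsub>N\<^esub> Lunt A' n = \<rho> (FO (Lfun A) n) \<cdot>\<^bsub>N\<^esub> Lunt A n"
proof -
  have "FA G (transf_l M N A A' \<rho> n) \<cdot>\<^bsub>N\<^esub> Lunt A' n = FA G (Lcnt A' (FO (Lfun A) n)) \<cdot>\<^bsub>N\<^esub>
      FA G (FA (Lfun A') (\<rho> (FO (Lfun A) n) \<cdot>\<^bsub>N\<^esub> Lunt A n)) \<cdot>\<^bsub>N\<^esub> Lunt A' n"
    by (simp add: transf_l_def)
  also have "FA G (FA (Lfun A') (\<rho> (FO (Lfun A) n) \<cdot>\<^bsub>N\<^esub> Lunt A n)) \<cdot>\<^bsub>N\<^esub> Lunt A' n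
      = Lunt A' (FO G (FO (Lfun A) n)) \<cdot>\<^bsub>N\<^esub> \<rho> (FO (Lfun A) n) \<cdot>\<^bsub>N\<^esub> Lunt A n"
    by (subst A'.unit_slide) simp_all
  finally show ?thesis by simp
qed

lemma transf_l_counit:
  assumes [simp]: "m \<in> Obj M"
  shows "Lcnt A m \<cdot>\<^bsub>M\<^esub> transf_l M N A A' \<rho> (FO F m) = Lcnt A' m \<cdot>\<^bsub>M\<^esub> FA (Lfun A') (\<rho> m)"
proof -
  have "Lcnt A m \<cdot>\<^bsub>M\<^esub> transf_l M N A A' \<rho> (FO F m) = (Lcnt A m \<cdot>\<^bsub>M\<^esub> Lcnt A' (FO (Lfun A) (FO F m))) \<cdot>\<^bsub>M\<^esub>
      FA (Lfun A') (\<rho> (FO (Lfun A) (FO F m)) \<cdot>\<^bsub>N\<^esub> Lunt A (FO F m))"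
    by (simp add: transf_l_def)
  also have "Lcnt A m \<cdot>\<^bsub>M\<^esub> Lcnt A' (FO (Lfun A) (FO F m))
      = Lcnt A' m \<cdot>\<^bsub>M\<^esub> FA (Lfun A') (FA G (Lcnt A m))"
    by (simp add: A'.counit_slide)
  also have "(Lcnt A' m \<cdot>\<^bsub>M\<^esub> FA (Lfun A') (FA G (Lcnt A m))) \<cdot>\<^bsub>M\<^esub>
      FA (Lfun A') (\<rho> (FO (Lfun A) (FO F m)) \<cdot>\<^bsub>N\<^esub> Lunt A (FO F m))
    = Lcnt A' m \<cdot>\<^bsub>M\<^esub> FA (Lfun A') ((FA G (Lcnt A m) \<cdot>\<^bsub>N\<^esub> \<rho> (FO (Lfun A) (FO F m))) \<cdot>\<^bsub>N\<^esub> Lunt A (FO F m))"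
    by simp
  also have "FA G (Lcnt A m) \<cdot>\<^bsub>N\<^esub> \<rho> (FO (Lfun A) (FO F m)) = \<rho> m \<cdot>\<^bsub>N\<^esub> FA F (Lcnt A m)"
    by (simp add: \<rho>.nat_slide)
  finally show ?thesis by simp
qed

end

text \<open>
  A morphism out of \<open>H\<^sup>l n\<close> is determined by its transpose along the adjunction of \<open>H\<close>, and the
  transpose of a mate is known from its compatibility with the units.
\<close>

lemma transf_l_vcomp:
  assumes "mate C M N F G A A' \<rho>" and "mate C M N G H A' A'' \<sigma>"
  shows "transf_l M N A A'' (vcomp M N \<sigma> \<rho>) = vcomp N M (transf_l M N A A' \<rho>) (transf_l M N A' A'' \<sigma>)"
proof -
  interpret \<rho>: mate C M N F G A A' \<rho> by fact
  interpret \<sigma>: mate C M N G H A' A'' \<sigma> by fact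
  interpret \<sigma>\<rho>: module_nat_transf C M N F H "vcomp M N \<sigma> \<rho>"
    by (rule module_nat_transf_vcomp) unfold_locales
  interpret \<sigma>\<rho>: mate C M N F H A A'' "vcomp M N \<sigma> \<rho>" ..
  have "transf_l M N A A'' (vcomp M N \<sigma> \<rho>) n = transf_l M N A A' \<rho> n \<cdot>\<^bsub>M\<^esub> transf_l M N A' A'' \<sigma> n"
    if [simp]: "n \<in> Obj N" for n
  proof (rule \<sigma>.A'.unit_cancel[of _ n])
    show "FA H (transf_l M N A A'' (vcomp M N \<sigma> \<rho>) n) \<cdot>\<^bsub>N\<^esub> Lunt A'' n
        = FA H (transf_l M N A A' \<rho> n \<cdot>\<^bsub>M\<^esub> transf_l M N A' A'' \<sigma> n) \<cdot>\<^bsub>N\<^esub> Lunt A'' n"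
    proof -
      have "FA H (transf_l M N A A' \<rho> n \<cdot>\<^bsub>M\<^esub> transf_l M N A' A'' \<sigma> n) \<cdot>\<^bsub>N\<^esub> Lunt A'' n
          = (FA H (transf_l M N A A' \<rho> n) \<cdot>\<^bsub>N\<^esub> \<sigma> (FO (Lfun A') n)) \<cdot>\<^bsub>N\<^esub> Lunt A' n"
        by (simp add: \<sigma>.transf_l_unit)
      also have "\<dots> = \<sigma> (FO (Lfun A) n) \<cdot>\<^bsub>N\<^esub> FA G (transf_l M N A A' \<rho> n) \<cdot>\<^bsub>N\<^esub> Lunt A' n"
        by (simp add: \<sigma>.\<rho>.nat_slide_tail)
      also have "\<dots> = FA H (transf_l M N A A'' (vcomp M N \<sigma> \<rho>) n) \<cdot>\<^bsub>N\<^esub> Lunt A'' n"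
        by (simp add: \<rho>.transf_l_unit \<sigma>\<rho>.transf_l_unit)
      finally show ?thesis by simp
    qed
  qed simp_all
  then show ?thesis
    using \<sigma>\<rho>.transf_l.nat_extensional
    by (intro extensionalityI[of _ "Obj N"]) (auto simp: vcomp_def)
qed


section \<open>Functionals represented by a trace\<close>

text \<open>
  Duality in a finite-dimensional space, by eliminating one coordinate \<open>j\<close> at a time.  If some
  element of \<open>S\<close> has a nonzero coordinate at \<open>j\<close>, subtracting its multiples leaves the problem for
  the elements that vanish at \<open>j\<close>.  If there is none, then the coordinate at \<open>j\<close> is itself a
  relation that holds on \<open>S\<close>, which forces \<open>\<psi> j = 0\<close>.
\<close>

lemma subspace_interpolation:
  fixes S :: "('i \<Rightarrow> complex) set"
  assumes "finite I" and "S \<noteq> {}"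
    and "\<And>f g. \<lbrakk>f \<in> S; g \<in> S\<rbrakk> \<Longrightarrow> (\<lambda>i. f i + g i) \<in> S" and "\<And>r f. f \<in> S \<Longrightarrow> (\<lambda>i. r * f i) \<in> S"
    and "\<And>r. (\<And>f. f \<in> S \<Longrightarrow> (\<Sum>i\<in>I. r i * f i) = 0) \<Longrightarrow> (\<Sum>i\<in>I. r i * \<psi> i) = 0"
  shows "\<exists>f \<in> S. \<forall>i \<in> I. f i = \<psi> i"
  using assms
proof (induction I arbitrary: S \<psi> rule: finite_induct)
  case empty
  then show ?case by auto
next
  case (insert j J)
  note add = insert.prems(2) and scale = insert.prems(3) and relations = insert.prems(4)
  show ?case
  proof (cases "\<exists>g \<in> S. g j \<noteq> 0")
    case True
    then obtain g0 where "g0 \<in> S" "g0 j \<noteq> 0" by blast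
    then obtain g where g: "g \<in> S" "g j = 1"
      using scale[of g0 "1 / g0 j"] by auto
    \<comment> \<open>\<open>f \<mapsto> f - f j * g\<close> projects \<open>S\<close> onto its elements that vanish at \<open>j\<close>.\<close>
    let ?S = "{f \<in> S. f j = 0}"
    have proj: "(\<lambda>i. f i - f j * g i) \<in> ?S" if "f \<in> S" for f
      using add[OF that scale[OF g(1), of "- f j"]] g(2) by simp
    have "\<exists>f \<in> ?S. \<forall>i \<in> J. f i = \<psi> i - \<psi> j * g i"
    proof (rule insert.IH)
      show "?S \<noteq> {}" using proj g(1) by blast
      show "(\<Sum>i\<in>J. r i * (\<psi> i - \<psi> j * g i)) = 0"
        if r: "\<And>f. f \<in> ?S \<Longrightarrow> (\<Sum>i\<in>J. r i * f i) = 0" for r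
      proof -
        let ?s = "\<Sum>i\<in>J. r i * g i"
        have split: "(\<Sum>i\<in>insert j J. (r(j := - ?s)) i * f i) = (\<Sum>i\<in>J. r i * (f i - f j * g i))" for f
        proof -
          have "(\<Sum>i\<in>J. (r(j := - ?s)) i * f i) = (\<Sum>i\<in>J. r i * f i)"
            using insert.hyps by (intro sum.cong) auto
          then show ?thesis
            using insert.hyps by (simp add: right_diff_distrib sum_subtractf sum_distrib_left mult_ac)
        qed
        show ?thesis
          using relations[of "r(j := - ?s)"] r[OF proj] unfolding split by blast
      qed
    qed (use add scale in auto)
    then obtain f where f: "f \<in> S" "f j = 0" "\<And>i. i \<in> J \<Longrightarrow> f i = \<psi> i - \<psi> j * g i" by blast
    have "(\<lambda>i. f i + \<psi> j * g i) \<in> S"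
      by (rule add[OF f(1) scale[OF g(1)]])
    then show ?thesis using f g by (intro bexI) auto
  next
    case False
    have rel: "(\<Sum>i\<in>insert j J. (r(j := s)) i * f i) = s * f j + (\<Sum>i\<in>J. r i * f i)" for r f and s :: complex
      using insert.hyps by (auto intro!: sum.cong)
    have "\<psi> j = 0"
      using relations[of "(\<lambda>_. 0)(j := 1)"] False unfolding rel by simp
    moreover have "\<exists>f \<in> S. \<forall>i \<in> J. f i = \<psi> i"
    proof (rule insert.IH)
      show "(\<Sum>i\<in>J. r i * \<psi> i) = 0" if "\<And>f. f \<in> S \<Longrightarrow> (\<Sum>i\<in>J. r i * f i) = 0" for r
        using relations[of "r(j := 0)"] that unfolding rel by simp
    qed (use insert.prems in auto)
    ultimately show ?thesis using False by auto
  qed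
qed

definition (in linear_category) linear_functional :: "'o \<Rightarrow> 'o \<Rightarrow> ('a \<Rightarrow> complex) \<Rightarrow> bool" where
  "linear_functional x y \<psi> \<longleftrightarrow>
     (\<forall>f \<in> hom C x y. \<forall>g \<in> hom C x y. \<psi> (f \<oplus> g) = \<psi> f + \<psi> g) \<and>
     (\<forall>r. \<forall>f \<in> hom C x y. \<psi> (Scale C r f) = r * \<psi> f)"

context linear_category
begin

lemma linear_functional_Zero:
  assumes "linear_functional x y \<psi>" "x \<in> Obj C" "y \<in> Obj C"
  shows "\<psi> (Zero C x y) = 0"
proof -
  have "\<psi> (Scale C 0 (Zero C x y)) = 0 * \<psi> (Zero C x y)"
    using assms unfolding linear_functional_def by (metis Zero_hom)
  then show ?thesis using Scale_zero[OF Zero_hom[OF assms(2,3)]] by simp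
qed

lemma linear_functional_arrow_sum:
  assumes "linear_functional x y \<psi>" "x \<in> Obj C" "y \<in> Obj C"
    and "length rs = length bs" "set bs \<subseteq> hom C x y"
  shows "\<psi> (arrow_sum C x y (map2 (Scale C) rs bs)) = (\<Sum>i<length bs. rs ! i * \<psi> (bs ! i))"
  using assms(4,5)
proof (induction rs bs rule: list_induct2)
  case Nil
  then show ?case using linear_functional_Zero[OF assms(1-3)] by simp
next
  case (Cons r rs b bs)
  have "set (map2 (Scale C) rs bs) \<subseteq> hom C x y"
    using Cons.prems by (auto dest!: set_zip_rightD)
  then have "arrow_sum C x y (map2 (Scale C) rs bs) \<in> hom C x y"
    by (rule arrow_sum_hom[OF assms(2,3)])
  moreover have "b \<in> hom C x y" "Scale C r b \<in> hom C x y"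
    using Cons.prems by auto
  ultimately show ?case
    using assms(1) Cons by (simp add: linear_functional_def sum.lessThan_Suc_shift del: in_hom sum.lessThan_Suc)
qed

end

context module_trace
begin

lemma trace_functional:
  assumes "f \<in> hom M m n"
  shows "M.linear_functional n m (\<lambda>h. \<Theta> m (h \<cdot> f))"
  using assms by (auto simp: M.linear_functional_def M.Comp_linear_simps trace_Add trace_Scale)

lemma trace_eqI:
  assumes f: "f \<in> hom M m n" and g: "g \<in> hom M m n"
    and eq: "\<And>h. h \<in> hom M n m \<Longrightarrow> \<Theta> m (h \<cdot> f) = \<Theta> m (h \<cdot> g)"
  shows "f = g"
proof (rule M.diff_zero_imp_eq[OF f g], rule trace_nondegenerate_left)
  fix h assume h: "h \<in> hom M n m"
  then have "\<Theta> m (h \<cdot> (f \<oplus> Scale M (- 1) g)) = \<Theta> m (h \<cdot> f) + (- 1) * \<Theta> m (h \<cdot> g)"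
    using f g by (simp add: M.Comp_linear_simps trace_Add trace_Scale)
  then show "\<Theta> m (h \<cdot> (f \<oplus> Scale M (- 1) g)) = 0" using eq[OF h] by simp
qed (use f g in simp)

text \<open>
  Take the values of the pairing on a finite spanning set of \<open>Hom(n, m)\<close> as coordinates of a morphism
  \<open>m \<rightarrow> n\<close>.  By non-degeneracy a linear relation between the coordinates of all morphisms is a linear
  relation between the spanning morphisms, and the functional \<open>\<psi>\<close> respects it.
\<close>

lemma trace_represents:
  assumes [simp]: "m \<in> Obj M" "n \<in> Obj M" and \<psi>: "M.linear_functional n m \<psi>"
  shows "\<exists>f \<in> hom M m n. \<forall>h \<in> hom M n m. \<Theta> m (h \<cdot> f) = \<psi> h"
proof -
  obtain bs where "set bs \<subseteq> hom M n m \<and> (\<forall>h \<in> hom M n m.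
      \<exists>rs. length rs = length bs \<and> h = arrow_sum M n m (map2 (Scale M) rs bs))"
    using M.finite_dimensional[OF assms(2,1)] by (rule exE)
  then have bs: "set bs \<subseteq> hom M n m" and
    span: "\<And>h. h \<in> hom M n m \<Longrightarrow> \<exists>rs. length rs = length bs \<and> h = arrow_sum M n m (map2 (Scale M) rs bs)"
    by (simp_all del: in_hom)
  have b: "bs ! i \<in> hom M n m" if "i < length bs" for i
    using subsetD[OF bs nth_mem[OF that]] .
  define coords where "coords f = (\<lambda>i. if i < length bs then \<Theta> m (bs ! i \<cdot> f) else 0)" for f
  have "\<exists>v \<in> coords ` hom M m n. \<forall>i \<in> {..<length bs}. v i = \<psi> (bs ! i)"
  proof (rule subspace_interpolation)
    show "coords ` hom M m n \<noteq> {}"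
      using M.Zero_hom[OF assms(1,2)] by blast
    show "(\<lambda>i. u i + v i) \<in> coords ` hom M m n"
      if uv: "u \<in> coords ` hom M m n" "v \<in> coords ` hom M m n" for u v
    proof -
      obtain f g where fg: "f \<in> hom M m n" "g \<in> hom M m n" "u = coords f" "v = coords g"
        using uv by blast
      then have "(\<lambda>i. u i + v i) = coords (f \<oplus> g)"
        using b by (auto simp: coords_def M.Comp_linear_simps trace_Add fun_eq_iff)
      then show ?thesis using fg M.Add_hom by blast
    qed
    show "(\<lambda>i. r * u i) \<in> coords ` hom M m n" if u: "u \<in> coords ` hom M m n" for r u
    proof -
      obtain f where f: "f \<in> hom M m n" "u = coords f" using u by blast
      then have "(\<lambda>i. r * u i) = coords (Scale M r f)"
        using b by (auto simp: coords_def M.Comp_linear_simps trace_Scale fun_eq_iff)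
      then show ?thesis using f M.Scale_hom by blast
    qed
    show "(\<Sum>i<length bs. r i * \<psi> (bs ! i)) = 0"
      if r: "\<And>v. v \<in> coords ` hom M m n \<Longrightarrow> (\<Sum>i<length bs. r i * v i) = 0" for r
    proof -
      let ?rs = "map r [0..<length bs]"
      let ?h = "arrow_sum M n m (map2 (Scale M) ?rs bs)"
      have sum: "\<phi> ?h = (\<Sum>i<length bs. r i * \<phi> (bs ! i))" if "M.linear_functional n m \<phi>" for \<phi>
        using M.linear_functional_arrow_sum[OF that assms(2,1) _ bs, of ?rs] by simp
      have "?h \<in> hom M n m"
        using bs by (intro M.arrow_sum_hom) (auto dest!: set_zip_rightD)
      moreover have "\<Theta> m (?h \<cdot> f) = 0" if f: "f \<in> hom M m n" for f
        using r[of "coords f"] f unfolding sum[OF trace_functional[OF f]] by (simp add: coords_def)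
      \<comment> \<open>Here non-degeneracy turns a relation between coordinates into one between morphisms.\<close>
      ultimately have "?h = Zero M n m"
        by (rule trace_nondegenerate_right)
      then show ?thesis
        using M.linear_functional_Zero[OF \<psi> assms(2,1)] sum[OF \<psi>] by simp
    qed
  qed simp
  then obtain f where f: "f \<in> hom M m n" and basis: "\<And>i. i < length bs \<Longrightarrow> \<Theta> m (bs ! i \<cdot> f) = \<psi> (bs ! i)"
    by (auto simp: coords_def)
  have "\<Theta> m (h \<cdot> f) = \<psi> h" if h: "h \<in> hom M n m" for h
  proof -
    obtain rs where rs: "length rs = length bs" "h = arrow_sum M n m (map2 (Scale M) rs bs)"
      using span[OF h] by blast
    show ?thesis
      unfolding rs(2) M.linear_functional_arrow_sum[OF trace_functional[OF f] assms(2,1) rs(1) bs]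
        M.linear_functional_arrow_sum[OF \<psi> assms(2,1) rs(1) bs]
      using basis by simp
  qed
  then show ?thesis using f by blast
qed

end


section \<open>Partial traces\<close>

context monoidal_category
begin

lemma tensor_simps [simp]:
  "\<lbrakk>x \<in> Obj C; y \<in> Obj C\<rbrakk> \<Longrightarrow> x \<otimes> y \<in> Obj C"
  "Unit C \<in> Obj C"
  "\<lbrakk>f \<in> Arr C; g \<in> Arr C\<rbrakk> \<Longrightarrow> f \<boxtimes> g \<in> Arr C"
  "\<lbrakk>f \<in> Arr C; g \<in> Arr C\<rbrakk> \<Longrightarrow> Dom C (f \<boxtimes> g) = Dom C f \<otimes> Dom C g"
  "\<lbrakk>f \<in> Arr C; g \<in> Arr C\<rbrakk> \<Longrightarrow> Cod C (f \<boxtimes> g) = Cod C f \<otimes> Cod C g"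
  "\<lbrakk>x \<in> Obj C; y \<in> Obj C\<rbrakk> \<Longrightarrow> Id C x \<boxtimes> Id C y = Id C (x \<otimes> y)"
  "\<lbrakk>x \<in> Obj C; y \<in> Obj C; z \<in> Obj C\<rbrakk> \<Longrightarrow> Assoc C x y z \<in> Arr C"
  "\<lbrakk>x \<in> Obj C; y \<in> Obj C; z \<in> Obj C\<rbrakk> \<Longrightarrow> Dom C (Assoc C x y z) = (x \<otimes> y) \<otimes> z"
  "\<lbrakk>x \<in> Obj C; y \<in> Obj C; z \<in> Obj C\<rbrakk> \<Longrightarrow> Cod C (Assoc C x y z) = x \<otimes> (y \<otimes> z)"
  "\<lbrakk>x \<in> Obj C; y \<in> Obj C; z \<in> Obj C\<rbrakk> \<Longrightarrow> iso C (Assoc C x y z)"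
  "x \<in> Obj C \<Longrightarrow> Lunit C x \<in> Arr C" "x \<in> Obj C \<Longrightarrow> Dom C (Lunit C x) = Unit C \<otimes> x"
  "x \<in> Obj C \<Longrightarrow> Cod C (Lunit C x) = x" "x \<in> Obj C \<Longrightarrow> iso C (Lunit C x)"
  "x \<in> Obj C \<Longrightarrow> Runit C x \<in> Arr C" "x \<in> Obj C \<Longrightarrow> Dom C (Runit C x) = x \<otimes> Unit C"
  "x \<in> Obj C \<Longrightarrow> Cod C (Runit C x) = x" "x \<in> Obj C \<Longrightarrow> iso C (Runit C x)"
  using TensO_Obj[of x y] Unit_Obj TensA_hom[of f "Dom C f" "Cod C f" g "Dom C g" "Cod C g"]
    TensA_Id[of x y] Assoc_hom[of x y z] Assoc_iso[of x y z] Lunit_hom[of x] Lunit_iso[of x]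
    Runit_hom[of x] Runit_iso[of x]
  by auto

lemma dual_map_hom:
  assumes "f \<in> hom C x x'" "y \<in> Obj C" "y' \<in> Obj C"
    and "e' \<in> hom C (y' \<otimes> x') (Unit C)" "n \<in> hom C (Unit C) (x \<otimes> y)"
  shows "dual_map C y' e' y n f \<in> hom C y' y"
proof -
  have "x \<in> Obj C" "x' \<in> Obj C" using assms(1) by auto
  then show ?thesis using assms by (simp add: dual_map_def)
qed

end

lemma (in rigid_category) rdual_simps [simp]:
  assumes "x \<in> Obj C"
  shows "Rdual C x \<in> Obj C"
    "Ev C x \<in> Arr C" "Dom C (Ev C x) = Rdual C x \<otimes> x" "Cod C (Ev C x) = Unit C"
    "Coev C x \<in> Arr C" "Dom C (Coev C x) = Unit C" "Cod C (Coev C x) = x \<otimes> Rdual C x"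
  using right_dual[OF assms] by (auto simp: dual_pair_def)

lemma (in rigid_category) Rdual_arr_hom:
  assumes "f \<in> hom C x y"
  shows "Rdual_arr C f \<in> hom C (Rdual C y) (Rdual C x)"
proof -
  have [simp]: "x \<in> Obj C" "y \<in> Obj C" "Dom C f = x" "Cod C f = y" using assms by auto
  show ?thesis
    unfolding Rdual_arr_def \<open>Dom C f = x\<close> \<open>Cod C f = y\<close> by (rule dual_map_hom[of _ x y]) (use assms in simp_all)
qed

lemma (in fusion_category) ldual_simps [simp]:
  assumes "x \<in> Obj C"
  shows "Ldual C x \<in> Obj C"
    "Lev C x \<in> Arr C" "Dom C (Lev C x) = x \<otimes> Ldual C x" "Cod C (Lev C x) = Unit C"
    "Lcoev C x \<in> Arr C" "Dom C (Lcoev C x) = Unit C" "Cod C (Lcoev C x) = Ldual C x \<otimes> x"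
  using left_dual[OF assms] by (auto simp: dual_pair_def)

text \<open>
  The partial trace of a morphism \<open>c \<triangleright> m \<rightarrow> c \<triangleright> m'\<close> with different \<open>m\<close> and \<open>m'\<close>, formed with an
  arbitrary morphism \<open>\<kappa>\<close> from the left to the right dual of \<open>c\<close>.  In this generality it is natural
  in \<open>m\<close> and \<open>m'\<close>.
\<close>

definition partial_trace_between ::
  "('c, 'k, 'y) fusion_cat_scheme \<Rightarrow> 'k \<Rightarrow> ('c, 'k, 'o, 'a, 'u) module_cat_scheme \<Rightarrow>
   'c \<Rightarrow> 'o \<Rightarrow> 'o \<Rightarrow> 'a \<Rightarrow> 'a" where
  "partial_trace_between C \<kappa> M c m m' f =
     Munit M m' \<cdot>\<^bsub>M\<^esub> (Ev C c \<odot>\<^bsub>M\<^esub> Id M m') \<cdot>\<^bsub>M\<^esub> Inv M (Mass M (Rdual C c) c m') \<cdot>\<^bsub>M\<^esub>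
     (\<kappa> \<odot>\<^bsub>M\<^esub> f) \<cdot>\<^bsub>M\<^esub>
     Mass M (Ldual C c) c m \<cdot>\<^bsub>M\<^esub> (Lcoev C c \<odot>\<^bsub>M\<^esub> Id M m) \<cdot>\<^bsub>M\<^esub> Inv M (Munit M m)"

context module_category
begin

lemma Inv_Mass_slide_tail:
  assumes [simp]: "c \<in> Obj C" "d \<in> Obj C" "g \<in> Arr M" "x \<in> Arr M" and [simp]: "Cod M g = m" "m \<in> Obj M"
    and [simp]: "Cod M x = c \<triangleright> d \<triangleright> Dom M g"
  shows "Inv M (Mass M c d m) \<cdot> (Id C c \<odot> Id C d \<odot> g) \<cdot> x
    = (Id C (c \<otimes>\<^bsub>C\<^esub> d) \<odot> g) \<cdot> Inv M (Mass M c d (Dom M g)) \<cdot> x"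
proof (rule iso_cancel_left[of "Mass M c d m"])
  have "(Mass M c d m \<cdot> (Id C (c \<otimes>\<^bsub>C\<^esub> d) \<odot> g)) \<cdot> Inv M (Mass M c d (Dom M g)) \<cdot> x
      = (Id C c \<odot> Id C d \<odot> g) \<cdot> x"
    using Mass_slide[of "Id C c" "Id C d" g c d m] by simp
  then show "Mass M c d m \<cdot> Inv M (Mass M c d m) \<cdot> (Id C c \<odot> Id C d \<odot> g) \<cdot> x
    = Mass M c d m \<cdot> (Id C (c \<otimes>\<^bsub>C\<^esub> d) \<odot> g) \<cdot> Inv M (Mass M c d (Dom M g)) \<cdot> x"
    by simp
qed simp_all

lemma partial_trace_between_simps [simp]:
  assumes "c \<in> Obj C" "\<kappa> \<in> hom C (Ldual C c) (Rdual C c)"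
    and "f \<in> Arr M" "Dom M f = c \<triangleright> m" "Cod M f = c \<triangleright> m'" "m \<in> Obj M" "m' \<in> Obj M"
  shows "partial_trace_between C \<kappa> M c m m' f \<in> Arr M"
    "Dom M (partial_trace_between C \<kappa> M c m m' f) = m"
    "Cod M (partial_trace_between C \<kappa> M c m m' f) = m'"
  using assms by (simp_all add: partial_trace_between_def)

lemma partial_trace_between_post:
  assumes "c \<in> Obj C" "\<kappa> \<in> hom C (Ldual C c) (Rdual C c)"
    and "f \<in> hom M (c \<triangleright> m) (c \<triangleright> m')" "g \<in> hom M m' m''" "m \<in> Obj M"
  shows "partial_trace_between C \<kappa> M c m m'' ((Id C c \<odot> g) \<cdot> f)
    = g \<cdot> partial_trace_between C \<kappa> M c m m' f"
proof -
  have [simp]: "c \<in> Obj C" "\<kappa> \<in> Arr C" "Dom C \<kappa> = Ldual C c" "Cod C \<kappa> = Rdual C c"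
    "f \<in> Arr M" "Dom M f = c \<triangleright> m" "Cod M f = c \<triangleright> m'" "g \<in> Arr M" "Dom M g = m'"
    "Cod M g = m''" "m \<in> Obj M" "m' \<in> Obj M" "m'' \<in> Obj M"
    using assms by auto
  let ?r = "Mass M (Ldual C c) c m \<cdot> (Lcoev C c \<odot> Id M m) \<cdot> Inv M (Munit M m)"
  have "partial_trace_between C \<kappa> M c m m'' ((Id C c \<odot> g) \<cdot> f)
    = Munit M m'' \<cdot> (Ev C c \<odot> Id M m'') \<cdot> Inv M (Mass M (Rdual C c) c m'') \<cdot>
      (Id C (Rdual C c) \<odot> Id C c \<odot> g) \<cdot> (\<kappa> \<odot> f) \<cdot> ?r"
    unfolding partial_trace_between_def by (simp add: ActA_fuse_tail)
  also have "\<dots> = (Munit M m'' \<cdot> (Id C (Unit C) \<odot> g)) \<cdot> (Ev C c \<odot> Id M m') \<cdot>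
      Inv M (Mass M (Rdual C c) c m') \<cdot> (\<kappa> \<odot> f) \<cdot> ?r"
    by (subst Inv_Mass_slide_tail) (simp_all add: ActA_fuse_tail)
  also have "\<dots> = g \<cdot> partial_trace_between C \<kappa> M c m m' f"
    unfolding partial_trace_between_def by (simp add: Munit_slide)
  finally show ?thesis .
qed

lemma partial_trace_between_pre:
  assumes "c \<in> Obj C" "\<kappa> \<in> hom C (Ldual C c) (Rdual C c)"
    and "f \<in> hom M (c \<triangleright> m') (c \<triangleright> m'')" "g \<in> hom M m m'" "m'' \<in> Obj M"
  shows "partial_trace_between C \<kappa> M c m m'' (f \<cdot> (Id C c \<odot> g))
    = partial_trace_between C \<kappa> M c m' m'' f \<cdot> g"
proof -
  have [simp]: "c \<in> Obj C" "\<kappa> \<in> Arr C" "Dom C \<kappa> = Ldual C c" "Cod C \<kappa> = Rdual C c"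
    "f \<in> Arr M" "Dom M f = c \<triangleright> m'" "Cod M f = c \<triangleright> m''" "g \<in> Arr M" "Dom M g = m"
    "Cod M g = m'" "m \<in> Obj M" "m' \<in> Obj M" "m'' \<in> Obj M"
    using assms by auto
  let ?l = "Munit M m'' \<cdot> (Ev C c \<odot> Id M m'') \<cdot> Inv M (Mass M (Rdual C c) c m'')"
  have "Munit M m' \<cdot> (Id C (Unit C) \<odot> g) \<cdot> Inv M (Munit M m) = g"
    using Comp_extend[OF Munit_slide[of g m'], of "Inv M (Munit M m)"] by simp
  then have unit: "(Id C (Unit C) \<odot> g) \<cdot> Inv M (Munit M m) = Inv M (Munit M m') \<cdot> g"
    using iso_cancel_left[of "Munit M m'" "(Id C (Unit C) \<odot> g) \<cdot> Inv M (Munit M m)"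
        "Inv M (Munit M m') \<cdot> g"] by simp
  have "partial_trace_between C \<kappa> M c m m'' (f \<cdot> (Id C c \<odot> g))
    = ?l \<cdot> (\<kappa> \<odot> f) \<cdot> (Id C (Ldual C c) \<odot> Id C c \<odot> g) \<cdot>
      Mass M (Ldual C c) c m \<cdot> (Lcoev C c \<odot> Id M m) \<cdot> Inv M (Munit M m)"
    unfolding partial_trace_between_def by (simp add: ActA_fuse_tail)
  also have "\<dots> = ?l \<cdot> (\<kappa> \<odot> f) \<cdot> ((Id C (Ldual C c) \<odot> Id C c \<odot> g) \<cdot>
      Mass M (Ldual C c) c m) \<cdot> (Lcoev C c \<odot> Id M m) \<cdot> Inv M (Munit M m)"
    by simp
  also have "(Id C (Ldual C c) \<odot> Id C c \<odot> g) \<cdot> Mass M (Ldual C c) c m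
      = Mass M (Ldual C c) c m' \<cdot> (Id C (Ldual C c \<otimes>\<^bsub>C\<^esub> c) \<odot> g)"
    using Mass_slide[of "Id C (Ldual C c)" "Id C c" g "Ldual C c" c m'] by simp
  also have "?l \<cdot> (\<kappa> \<odot> f) \<cdot> (Mass M (Ldual C c) c m' \<cdot> (Id C (Ldual C c \<otimes>\<^bsub>C\<^esub> c) \<odot> g)) \<cdot>
      (Lcoev C c \<odot> Id M m) \<cdot> Inv M (Munit M m)
    = ?l \<cdot> (\<kappa> \<odot> f) \<cdot> Mass M (Ldual C c) c m' \<cdot> (Lcoev C c \<odot> Id M m') \<cdot>
      (Id C (Unit C) \<odot> g) \<cdot> Inv M (Munit M m)"
    by (simp add: ActA_fuse_tail)
  also have "\<dots> = partial_trace_between C \<kappa> M c m' m'' f \<cdot> g"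
    unfolding partial_trace_between_def by (simp add: unit)
  finally show ?thesis .
qed

end

text \<open>
  The coherence axioms of the constraint of a module functor move it past each factor of a partial
  trace.
\<close>

lemma (in module_functor) FA_partial_trace_between:
  assumes [simp]: "c \<in> Obj C" and \<kappa>: "\<kappa> \<in> hom C (Ldual C c) (Rdual C c)"
    and f: "f \<in> hom M (c \<triangleright>\<^bsub>M\<^esub> m) (c \<triangleright>\<^bsub>M\<^esub> m')" and [simp]: "m \<in> Obj M" "m' \<in> Obj M"
  shows "FA F (partial_trace_between C \<kappa> M c m m' f) = partial_trace_between C \<kappa> N c (FO F m) (FO F m')
    (FS F c m' \<cdot>\<^bsub>N\<^esub> FA F f \<cdot>\<^bsub>N\<^esub> Inv N (FS F c m))"
proof -
  have [simp]: "\<kappa> \<in> Arr C" "Dom C \<kappa> = Ldual C c" "Cod C \<kappa> = Rdual C c"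
    "f \<in> Arr M" "Dom M f = c \<triangleright>\<^bsub>M\<^esub> m" "Cod M f = c \<triangleright>\<^bsub>M\<^esub> m'"
    using \<kappa> f by simp_all
  let ?e = "Mass M (Rdual C c) c m'" and ?d = "Mass M (Ldual C c) c m"
  have post: "FA F (Munit M m') \<cdot>\<^bsub>N\<^esub> FA F (Ev C c \<odot>\<^bsub>M\<^esub> Id M m') \<cdot>\<^bsub>N\<^esub> FA F (Inv M ?e) =
      Munit N (FO F m') \<cdot>\<^bsub>N\<^esub> (Ev C c \<odot>\<^bsub>N\<^esub> Id N (FO F m')) \<cdot>\<^bsub>N\<^esub>
      Inv N (Mass N (Rdual C c) c (FO F m')) \<cdot>\<^bsub>N\<^esub>
      (Id C (Rdual C c) \<odot>\<^bsub>N\<^esub> FS F c m') \<cdot>\<^bsub>N\<^esub> FS F (Rdual C c) (c \<triangleright>\<^bsub>M\<^esub> m')"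
    by (simp add: FA_Munit FA_ActA FA_Mass)
  have pre: "FA F ?d \<cdot>\<^bsub>N\<^esub> FA F (Lcoev C c \<odot>\<^bsub>M\<^esub> Id M m) \<cdot>\<^bsub>N\<^esub> FA F (Inv M (Munit M m)) =
      Inv N (FS F (Ldual C c) (c \<triangleright>\<^bsub>M\<^esub> m)) \<cdot>\<^bsub>N\<^esub> (Id C (Ldual C c) \<odot>\<^bsub>N\<^esub> Inv N (FS F c m)) \<cdot>\<^bsub>N\<^esub>
      Mass N (Ldual C c) c (FO F m) \<cdot>\<^bsub>N\<^esub> (Lcoev C c \<odot>\<^bsub>N\<^esub> Id N (FO F m)) \<cdot>\<^bsub>N\<^esub> Inv N (Munit N (FO F m))"
    by (simp add: FA_Munit FA_ActA FA_Mass)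
  have "FA F (partial_trace_between C \<kappa> M c m m' f) =
      (FA F (Munit M m') \<cdot>\<^bsub>N\<^esub> FA F (Ev C c \<odot>\<^bsub>M\<^esub> Id M m') \<cdot>\<^bsub>N\<^esub> FA F (Inv M ?e)) \<cdot>\<^bsub>N\<^esub>
      FA F (\<kappa> \<odot>\<^bsub>M\<^esub> f) \<cdot>\<^bsub>N\<^esub>
      (FA F ?d \<cdot>\<^bsub>N\<^esub> FA F (Lcoev C c \<odot>\<^bsub>M\<^esub> Id M m) \<cdot>\<^bsub>N\<^esub> FA F (Inv M (Munit M m)))"
    unfolding partial_trace_between_def by simp
  also have "\<dots> = partial_trace_between C \<kappa> N c (FO F m) (FO F m')
      (FS F c m' \<cdot>\<^bsub>N\<^esub> FA F f \<cdot>\<^bsub>N\<^esub> Inv N (FS F c m))"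
    unfolding post pre partial_trace_between_def by (simp add: FA_ActA N.ActA_fuse_tail)
  finally show ?thesis .
qed

context module_trace
begin

lemma ldual_piv_hom:
  assumes [simp]: "c \<in> Obj C"
  shows "ldual_ddual C c \<cdot>\<^bsub>C\<^esub> a (Ldual C c) \<in> hom C (Ldual C c) (Rdual C c)"
proof -
  let ?d = "Ldual C c"
  have "dual_map C c (Lev C c) (Rdual C ?d) (Coev C ?d) (Id C ?d) \<in> hom C c (Rdual C ?d)"
    by (rule C.dual_map_hom[of _ ?d ?d]) simp_all
  then have "ldual_ddual C c \<in> hom C (Rdual C (Rdual C ?d)) (Rdual C c)"
    unfolding ldual_ddual_def Let_def by (rule C.Rdual_arr_hom)
  then show ?thesis
    using C.piv_hom[of ?d] by simp
qed

lemma trace_partial_trace: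
  assumes "c \<in> Obj C" "m \<in> Obj M" "f \<in> hom M (c \<triangleright> m) (c \<triangleright> m)"
  shows "\<Theta> (c \<triangleright> m) f =
    \<Theta> m (partial_trace_between C (ldual_ddual C c \<cdot>\<^bsub>C\<^esub> a (Ldual C c)) M c m m f)"
  using trace_compatible[OF assms] by (simp add: partial_trace_def partial_trace_between_def)

end


section \<open>The canonical transformation\<close>

locale traced_double_adjoint =
  A: left_adjoint C M N F A + B: left_adjoint C N M "Lfun A" B +
  M: module_trace C a M \<Theta>M + N: module_trace C a N \<Theta>N
  for C :: "('c, 'k, 'y) fusion_cat_scheme" and a :: "'c \<Rightarrow> 'k"
    and M :: "('c, 'k, 'o, 'a, 'u) module_cat_scheme"
    and N :: "('c, 'k, 'p, 'b, 'v) module_cat_scheme"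
    and \<Theta>M :: "'o \<Rightarrow> 'a \<Rightarrow> complex" and \<Theta>N :: "'p \<Rightarrow> 'b \<Rightarrow> complex"
    and F :: "('c, 'o, 'a, 'p, 'b) mfun"
    and A :: "('c, 'o, 'a, 'p, 'b) ladj" and B :: "('c, 'p, 'b, 'o, 'a) ladj"
begin

abbreviation L where "L \<equiv> Lfun A"
abbreviation LL where "LL \<equiv> Lfun B"
abbreviation \<alpha> where "\<alpha> \<equiv> canonical_transf M N \<Theta>M \<Theta>N F A B"

text \<open>
  The trace pairing with \<open>\<alpha> m\<close> is the trace of the image under \<open>F\<^sup>l\<close>, closed off with the counit of
  one adjunction and the unit of the other.  All properties of \<open>\<alpha>\<close> are read off from this formula.
\<close>

definition closed_trace :: "'o \<Rightarrow> 'b \<Rightarrow> complex" where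
  "closed_trace m h = \<Theta>M m (Lcnt A m \<cdot>\<^bsub>M\<^esub> FA L h \<cdot>\<^bsub>M\<^esub> Lunt B m)"

lemma closed_trace_functional:
  assumes [simp]: "m \<in> Obj M"
  shows "A.F.N.linear_functional (FO LL m) (FO F m) (closed_trace m)"
proof -
  have "closed_trace m (f \<oplus>\<^bsub>N\<^esub> g) = closed_trace m f + closed_trace m g"
    if "f \<in> hom N (FO LL m) (FO F m)" "g \<in> hom N (FO LL m) (FO F m)" for f g
    using that A.L.FA_Add[OF that]
    by (simp add: closed_trace_def A.F.M.Comp_linear_simps M.trace_Add)
  moreover have "closed_trace m (Scale N r f) = r * closed_trace m f"
    if "f \<in> hom N (FO LL m) (FO F m)" for r f
    using that by (simp add: closed_trace_def A.L.FA_Scale A.F.M.Comp_linear_simps M.trace_Scale)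
  ultimately show ?thesis
    by (auto simp: A.F.N.linear_functional_def)
qed

lemma double_adj_map_eqI:
  assumes "n \<in> Obj N" "m \<in> Obj M" "f \<in> hom N n (FO F m)" "t \<in> hom N n (FO LL m)"
    and eq: "\<And>h. h \<in> hom N (FO LL m) n \<Longrightarrow>
      \<Theta>N n (h \<cdot>\<^bsub>N\<^esub> t) = \<Theta>M (FO L n) ((FA L h \<cdot>\<^bsub>M\<^esub> Lunt B m) \<cdot>\<^bsub>M\<^esub> (Lcnt A m \<cdot>\<^bsub>M\<^esub> FA L f))"
  shows "double_adj_map M N \<Theta>M \<Theta>N A B n m f = t"
proof -
  have inj: "inj_on (trace_dual N \<Theta>N n (FO LL m)) (hom N n (FO LL m))"
  proof (rule inj_onI, rule N.trace_eqI)
    fix t t' h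
    assume "trace_dual N \<Theta>N n (FO LL m) t = trace_dual N \<Theta>N n (FO LL m) t'"
      and h: "h \<in> hom N (FO LL m) n"
    then have "trace_dual N \<Theta>N n (FO LL m) t h = trace_dual N \<Theta>N n (FO LL m) t' h"
      by simp
    then show "\<Theta>N n (h \<cdot>\<^bsub>N\<^esub> t) = \<Theta>N n (h \<cdot>\<^bsub>N\<^esub> t')"
      using h by (simp add: trace_dual_def)
  qed
  show ?thesis
    unfolding double_adj_map_def Let_def
  proof (rule the_inv_into_f_eq[OF inj])
    show "trace_dual N \<Theta>N n (FO LL m) t = (\<lambda>h \<in> hom N (FO LL m) n.
        trace_dual M \<Theta>M (FO L n) m (adj_transpose M A m f) (adj_untranspose M L B m h))"
      unfolding trace_dual_def
    proof (rule restrict_ext)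
      fix h assume h: "h \<in> hom N (FO LL m) n"
      then show "\<Theta>N n (h \<cdot>\<^bsub>N\<^esub> t) = (\<lambda>g \<in> hom M m (FO L n). \<Theta>M (FO L n) (g \<cdot>\<^bsub>M\<^esub> adj_transpose M A m f))
          (adj_untranspose M L B m h)"
        using eq[OF h] assms by (simp add: adj_transpose_def adj_untranspose_def)
    qed
  qed (use assms in simp)
qed

text \<open>
  Symmetry of both traces moves \<open>f\<close> to the other side of \<open>h\<close>.  So the requirement on all \<open>n\<close> and \<open>f\<close>
  that characterises \<open>\<alpha> m\<close> by the Yoneda lemma amounts to its case \<open>n = F m\<close>, \<open>f = id\<close>.
\<close>

lemma double_adj_map_postcomp:
  assumes m: "m \<in> Obj M" and t: "t \<in> hom N (FO F m) (FO LL m)"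
    and trace: "\<And>h. h \<in> hom N (FO LL m) (FO F m) \<Longrightarrow> \<Theta>N (FO F m) (h \<cdot>\<^bsub>N\<^esub> t) = closed_trace m h"
    and n: "n \<in> Obj N" and f: "f \<in> hom N n (FO F m)"
  shows "double_adj_map M N \<Theta>M \<Theta>N A B n m f = t \<cdot>\<^bsub>N\<^esub> f"
proof (rule double_adj_map_eqI[OF n m f])
  fix h assume h: "h \<in> hom N (FO LL m) n"
  have "\<Theta>N n ((h \<cdot>\<^bsub>N\<^esub> t) \<cdot>\<^bsub>N\<^esub> f) = \<Theta>N (FO F m) (f \<cdot>\<^bsub>N\<^esub> (h \<cdot>\<^bsub>N\<^esub> t))"
    using h t f m by (intro N.trace_symmetric) auto
  also have "\<dots> = closed_trace m (f \<cdot>\<^bsub>N\<^esub> h)"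
    using h t f m trace[of "f \<cdot>\<^bsub>N\<^esub> h"] by simp
  also have "\<dots> = \<Theta>M m ((Lcnt A m \<cdot>\<^bsub>M\<^esub> FA L f) \<cdot>\<^bsub>M\<^esub> (FA L h \<cdot>\<^bsub>M\<^esub> Lunt B m))"
    using h f m by (simp add: closed_trace_def)
  also have "\<dots> = \<Theta>M (FO L n) ((FA L h \<cdot>\<^bsub>M\<^esub> Lunt B m) \<cdot>\<^bsub>M\<^esub> (Lcnt A m \<cdot>\<^bsub>M\<^esub> FA L f))"
    using h f m by (intro M.trace_symmetric) auto
  finally show "\<Theta>N n (h \<cdot>\<^bsub>N\<^esub> (t \<cdot>\<^bsub>N\<^esub> f))
      = \<Theta>M (FO L n) ((FA L h \<cdot>\<^bsub>M\<^esub> Lunt B m) \<cdot>\<^bsub>M\<^esub> (Lcnt A m \<cdot>\<^bsub>M\<^esub> FA L f))"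
    using h t f m by simp
qed (use assms in simp)

lemma canonical_eqI:
  assumes m: "m \<in> Obj M" and t: "t \<in> hom N (FO F m) (FO LL m)"
    and trace: "\<And>h. h \<in> hom N (FO LL m) (FO F m) \<Longrightarrow> \<Theta>N (FO F m) (h \<cdot>\<^bsub>N\<^esub> t) = closed_trace m h"
  shows "\<alpha> m = t"
proof -
  have "(THE t. t \<in> hom N (FO F m) (FO LL m) \<and>
      (\<forall>n \<in> Obj N. \<forall>f \<in> hom N n (FO F m). t \<cdot>\<^bsub>N\<^esub> f = double_adj_map M N \<Theta>M \<Theta>N A B n m f)) = t"
  proof (rule the_equality)
    show "t \<in> hom N (FO F m) (FO LL m) \<and>
        (\<forall>n \<in> Obj N. \<forall>f \<in> hom N n (FO F m). t \<cdot>\<^bsub>N\<^esub> f = double_adj_map M N \<Theta>M \<Theta>N A B n m f)"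
      using t double_adj_map_postcomp[OF m t trace] by (simp del: in_hom)
  next
    fix s
    assume s: "s \<in> hom N (FO F m) (FO LL m) \<and>
      (\<forall>n \<in> Obj N. \<forall>f \<in> hom N n (FO F m). s \<cdot>\<^bsub>N\<^esub> f = double_adj_map M N \<Theta>M \<Theta>N A B n m f)"
    have "s \<cdot>\<^bsub>N\<^esub> Id N (FO F m) = double_adj_map M N \<Theta>M \<Theta>N A B (FO F m) m (Id N (FO F m))"
      using bspec[OF bspec[OF conjunct2[OF s]], of "FO F m" "Id N (FO F m)"] m by simp
    also have "\<dots> = t \<cdot>\<^bsub>N\<^esub> Id N (FO F m)"
      using m double_adj_map_postcomp[OF m t trace, of "FO F m" "Id N (FO F m)"] by simp
    finally show "s = t" using s t m by simp
  qed
  then show ?thesis using m by (simp add: canonical_transf_def)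
qed

text \<open>
  Existence: the closed trace is a linear functional, and the trace of \<open>N\<close> represents it.
\<close>

lemma canonical_spec:
  assumes m: "m \<in> Obj M"
  shows "\<alpha> m \<in> hom N (FO F m) (FO LL m) \<and>
    (\<forall>h \<in> hom N (FO LL m) (FO F m). \<Theta>N (FO F m) (h \<cdot>\<^bsub>N\<^esub> \<alpha> m) = closed_trace m h)"
proof -
  obtain t where t: "t \<in> hom N (FO F m) (FO LL m)"
    "\<And>h. h \<in> hom N (FO LL m) (FO F m) \<Longrightarrow> \<Theta>N (FO F m) (h \<cdot>\<^bsub>N\<^esub> t) = closed_trace m h"
    using N.trace_represents[OF _ _ closed_trace_functional[OF m]] m by (auto simp del: in_hom)
  then show ?thesis using canonical_eqI[OF m t] by (simp del: in_hom)
qed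

lemma canonical_simps [simp]:
  assumes "m \<in> Obj M"
  shows "\<alpha> m \<in> Arr N" "Dom N (\<alpha> m) = FO F m" "Cod N (\<alpha> m) = FO LL m"
  using canonical_spec[OF assms] by auto

lemma canonical_trace:
  assumes "m \<in> Obj M" "h \<in> Arr N" "Dom N h = FO LL m" "Cod N h = FO F m"
  shows "\<Theta>N (FO F m) (h \<cdot>\<^bsub>N\<^esub> \<alpha> m) = closed_trace m h"
  using canonical_spec[OF assms(1)] assms(2-) by auto

lemma canonical_extensional: "\<alpha> \<in> extensional (Obj M)"
  by (simp add: canonical_transf_def)

lemma canonical_natural:
  assumes "f \<in> hom M m m'"
  shows "\<alpha> m' \<cdot>\<^bsub>N\<^esub> FA F f = FA LL f \<cdot>\<^bsub>N\<^esub> \<alpha> m"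
proof -
  have [simp]: "f \<in> Arr M" "Dom M f = m" "Cod M f = m'" "m \<in> Obj M" "m' \<in> Obj M"
    using assms by auto
  show ?thesis
  proof (rule N.trace_eqI)
    fix h assume "h \<in> hom N (FO LL m') (FO F m)"
    then have [simp]: "h \<in> Arr N" "Dom N h = FO LL m'" "Cod N h = FO F m" by auto
    have "\<Theta>N (FO F m) ((h \<cdot>\<^bsub>N\<^esub> \<alpha> m') \<cdot>\<^bsub>N\<^esub> FA F f) = \<Theta>N (FO F m') (FA F f \<cdot>\<^bsub>N\<^esub> (h \<cdot>\<^bsub>N\<^esub> \<alpha> m'))"
      by (rule N.trace_symmetric) simp_all
    also have "\<dots> = closed_trace m' (FA F f \<cdot>\<^bsub>N\<^esub> h)"
      using canonical_trace[of m' "FA F f \<cdot>\<^bsub>N\<^esub> h"] by simp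
    also have "\<dots> = \<Theta>M m' (f \<cdot>\<^bsub>M\<^esub> (Lcnt A m \<cdot>\<^bsub>M\<^esub> FA L h \<cdot>\<^bsub>M\<^esub> Lunt B m'))"
      by (simp add: closed_trace_def A.counit_slide_tail)
    also have "\<dots> = \<Theta>M m ((Lcnt A m \<cdot>\<^bsub>M\<^esub> FA L h \<cdot>\<^bsub>M\<^esub> Lunt B m') \<cdot>\<^bsub>M\<^esub> f)"
      by (rule M.trace_symmetric) simp_all
    also have "\<dots> = closed_trace m (h \<cdot>\<^bsub>N\<^esub> FA LL f)"
      by (simp add: closed_trace_def B.unit_slide)
    also have "\<dots> = \<Theta>N (FO F m) ((h \<cdot>\<^bsub>N\<^esub> FA LL f) \<cdot>\<^bsub>N\<^esub> \<alpha> m)"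
      by (rule canonical_trace[symmetric]) simp_all
    finally show "\<Theta>N (FO F m) (h \<cdot>\<^bsub>N\<^esub> (\<alpha> m' \<cdot>\<^bsub>N\<^esub> FA F f)) = \<Theta>N (FO F m) (h \<cdot>\<^bsub>N\<^esub> (FA LL f \<cdot>\<^bsub>N\<^esub> \<alpha> m))"
      by simp
  qed simp_all
qed

text \<open>
  The trace pairing determines the transpose \<open>F\<^sup>l n \<rightarrow> m\<close> of \<open>f : n \<rightarrow> F m\<close> from \<open>\<alpha> m \<circ> f\<close>, and every
  functional on \<open>Hom(m, F\<^sup>l n)\<close> comes from such a transpose.  Hence post-composition with
  \<open>\<alpha> m\<close> is bijective.
\<close>

lemma canonical_postcomp_trace:
  assumes [simp]: "m \<in> Obj M" "f \<in> Arr N" "Cod N f = FO F m" "Dom N f = n"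
    and [simp]: "h \<in> Arr N" "Dom N h = FO LL m" "Cod N h = n"
  shows "\<Theta>N n (h \<cdot>\<^bsub>N\<^esub> \<alpha> m \<cdot>\<^bsub>N\<^esub> f)
    = \<Theta>M (FO L n) ((FA L h \<cdot>\<^bsub>M\<^esub> Lunt B m) \<cdot>\<^bsub>M\<^esub> (Lcnt A m \<cdot>\<^bsub>M\<^esub> FA L f))"
proof -
  have "\<Theta>N n ((h \<cdot>\<^bsub>N\<^esub> \<alpha> m) \<cdot>\<^bsub>N\<^esub> f) = \<Theta>N (FO F m) (f \<cdot>\<^bsub>N\<^esub> (h \<cdot>\<^bsub>N\<^esub> \<alpha> m))"
    by (rule N.trace_symmetric) simp_all
  also have "\<dots> = closed_trace m (f \<cdot>\<^bsub>N\<^esub> h)"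
    using canonical_trace[of m "f \<cdot>\<^bsub>N\<^esub> h"] by simp
  also have "\<dots> = \<Theta>M m ((Lcnt A m \<cdot>\<^bsub>M\<^esub> FA L f) \<cdot>\<^bsub>M\<^esub> (FA L h \<cdot>\<^bsub>M\<^esub> Lunt B m))"
    by (simp add: closed_trace_def)
  also have "\<dots> = \<Theta>M (FO L n) ((FA L h \<cdot>\<^bsub>M\<^esub> Lunt B m) \<cdot>\<^bsub>M\<^esub> (Lcnt A m \<cdot>\<^bsub>M\<^esub> FA L f))"
    using A.F.N.Dom_Obj[of f] A.F.N.Cod_Obj[of f]
    by (intro M.trace_symmetric) simp_all
  finally show ?thesis using A.F.N.Dom_Obj[of f] by simp
qed

lemma canonical_iso:
  assumes m [simp]: "m \<in> Obj M"
  shows "iso N (\<alpha> m)"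
proof -
  let ?n = "FO LL m"
  \<comment> \<open>\<open>g\<close> represents the functional that transposition turns into the trace pairing with the identity
    of \<open>F\<^sup>l\<^sup>l m\<close>, so that its transpose is a preimage of that identity under post-composition with \<open>\<alpha> m\<close>.\<close>
  define \<psi> where "\<psi> u = \<Theta>N ?n (Lcnt B ?n \<cdot>\<^bsub>N\<^esub> FA LL u)" for u
  have "A.F.M.linear_functional m (FO L ?n) \<psi>"
    by (auto simp: A.F.M.linear_functional_def \<psi>_def B.L.FA_Add B.L.FA_Scale A.F.N.Comp_linear_simps
        N.trace_Add N.trace_Scale)
  then obtain g where g: "g \<in> hom M (FO L ?n) m"
    "\<And>u. u \<in> hom M m (FO L ?n) \<Longrightarrow> \<Theta>M (FO L ?n) (u \<cdot>\<^bsub>M\<^esub> g) = \<psi> u"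
    using M.trace_represents[of "FO L ?n" m \<psi>] by (auto simp del: in_hom)
  then have [simp]: "g \<in> Arr M" "Dom M g = FO L ?n" "Cod M g = m" by auto
  let ?f = "FA F g \<cdot>\<^bsub>N\<^esub> Lunt A ?n"
  have right: "\<alpha> m \<cdot>\<^bsub>N\<^esub> ?f = Id N ?n"
  proof (rule N.trace_eqI)
    fix h assume "h \<in> hom N ?n ?n"
    then have [simp]: "h \<in> Arr N" "Dom N h = ?n" "Cod N h = ?n" by auto
    have "\<Theta>N ?n (h \<cdot>\<^bsub>N\<^esub> \<alpha> m \<cdot>\<^bsub>N\<^esub> ?f)
        = \<Theta>M (FO L ?n) ((FA L h \<cdot>\<^bsub>M\<^esub> Lunt B m) \<cdot>\<^bsub>M\<^esub> (Lcnt A m \<cdot>\<^bsub>M\<^esub> FA L ?f))"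
      by (rule canonical_postcomp_trace) simp_all
    also have "Lcnt A m \<cdot>\<^bsub>M\<^esub> FA L ?f = g"
      by (simp add: A.counit_slide_tail)
    also have "\<Theta>M (FO L ?n) ((FA L h \<cdot>\<^bsub>M\<^esub> Lunt B m) \<cdot>\<^bsub>M\<^esub> g) = \<psi> (FA L h \<cdot>\<^bsub>M\<^esub> Lunt B m)"
      by (rule g(2)) simp
    also have "\<dots> = \<Theta>N ?n h"
      by (simp add: \<psi>_def B.counit_slide_tail)
    finally show "\<Theta>N ?n (h \<cdot>\<^bsub>N\<^esub> (\<alpha> m \<cdot>\<^bsub>N\<^esub> ?f)) = \<Theta>N ?n (h \<cdot>\<^bsub>N\<^esub> Id N ?n)"
      by simp
  qed simp_all
  have left: "?f \<cdot>\<^bsub>N\<^esub> \<alpha> m = Id N (FO F m)"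
  proof (rule A.counit_cancel[OF _ m])
    let ?x = "?f \<cdot>\<^bsub>N\<^esub> \<alpha> m" and ?y = "Id N (FO F m)"
    have eq: "\<alpha> m \<cdot>\<^bsub>N\<^esub> ?x = \<alpha> m \<cdot>\<^bsub>N\<^esub> ?y"
      using A.F.N.Comp_assoc_simp[of "\<alpha> m" ?f "\<alpha> m"] right by simp
    show "Lcnt A m \<cdot>\<^bsub>M\<^esub> FA L ?x = Lcnt A m \<cdot>\<^bsub>M\<^esub> FA L ?y"
    proof (rule M.trace_eqI)
      fix u assume "u \<in> hom M m (FO L (FO F m))"
      then have [simp]: "u \<in> Arr M" "Dom M u = m" "Cod M u = FO L (FO F m)" by auto
      let ?h = "Lcnt B (FO F m) \<cdot>\<^bsub>N\<^esub> FA LL u"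
      have "FA L (FA LL u) \<cdot>\<^bsub>M\<^esub> Lunt B m = Lunt B (FO L (FO F m)) \<cdot>\<^bsub>M\<^esub> u"
        by (simp add: B.unit_slide)
      then have u: "FA L ?h \<cdot>\<^bsub>M\<^esub> Lunt B m = u"
        by simp
      have trace: "\<Theta>M (FO L (FO F m)) (u \<cdot>\<^bsub>M\<^esub> Lcnt A m \<cdot>\<^bsub>M\<^esub> FA L z) = \<Theta>N (FO F m) (?h \<cdot>\<^bsub>N\<^esub> \<alpha> m \<cdot>\<^bsub>N\<^esub> z)"
        if "z \<in> Arr N" "Dom N z = FO F m" "Cod N z = FO F m" for z
        using canonical_postcomp_trace[of m z "FO F m" ?h] that unfolding u by simp
      have "\<Theta>M (FO L (FO F m)) (u \<cdot>\<^bsub>M\<^esub> Lcnt A m \<cdot>\<^bsub>M\<^esub> FA L ?x) = \<Theta>N (FO F m) (?h \<cdot>\<^bsub>N\<^esub> \<alpha> m \<cdot>\<^bsub>N\<^esub> ?x)"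
        by (rule trace) simp_all
      also have "\<dots> = \<Theta>N (FO F m) (?h \<cdot>\<^bsub>N\<^esub> \<alpha> m \<cdot>\<^bsub>N\<^esub> ?y)"
        by (simp only: eq)
      also have "\<dots> = \<Theta>M (FO L (FO F m)) (u \<cdot>\<^bsub>M\<^esub> Lcnt A m \<cdot>\<^bsub>M\<^esub> FA L ?y)"
        by (rule trace[symmetric]) simp_all
      finally show "\<Theta>M (FO L (FO F m)) (u \<cdot>\<^bsub>M\<^esub> (Lcnt A m \<cdot>\<^bsub>M\<^esub> FA L ?x))
          = \<Theta>M (FO L (FO F m)) (u \<cdot>\<^bsub>M\<^esub> (Lcnt A m \<cdot>\<^bsub>M\<^esub> FA L ?y))" .
    qed simp_all
  qed simp_all
  show ?thesis
    using right left by (intro A.F.N.isoI(1)[of _ ?f]) simp_all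
qed

text \<open>
  Only here does the compatibility of the traces with the action enter.  It turns the traces over
  \<open>c \<triangleright> m\<close> and \<open>c \<triangleright> F m\<close> into traces over \<open>m\<close> and \<open>F m\<close> of partial traces, and \<open>F\<^sup>l\<close> preserves
  partial traces.
\<close>

lemma canonical_module:
  assumes [simp]: "c \<in> Obj C" "m \<in> Obj M"
  shows "FS LL c m \<cdot>\<^bsub>N\<^esub> \<alpha> (c \<triangleright>\<^bsub>M\<^esub> m) = (Id C c \<odot>\<^bsub>N\<^esub> \<alpha> m) \<cdot>\<^bsub>N\<^esub> FS F c m"
proof (rule N.trace_eqI)
  fix h assume "h \<in> hom N (c \<triangleright>\<^bsub>N\<^esub> FO LL m) (FO F (c \<triangleright>\<^bsub>M\<^esub> m))"
  then have [simp]: "h \<in> Arr N" "Dom N h = c \<triangleright>\<^bsub>N\<^esub> FO LL m" "Cod N h = FO F (c \<triangleright>\<^bsub>M\<^esub> m)" by auto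
  let ?\<kappa> = "ldual_ddual C c \<cdot>\<^bsub>C\<^esub> a (Ldual C c)"
  note \<kappa> = M.ldual_piv_hom[OF assms(1)]
  let ?tM = "partial_trace_between C ?\<kappa> M c" and ?tN = "partial_trace_between C ?\<kappa> N c"
  note A.F.M.partial_trace_between_simps[OF assms(1) \<kappa>, simp]
    A.F.N.partial_trace_between_simps[OF assms(1) \<kappa>, simp]
  let ?g = "FA L h \<cdot>\<^bsub>M\<^esub> Inv M (FS L c (FO LL m))"
  have unit: "FS L c (FO LL m) \<cdot>\<^bsub>M\<^esub> FA L (FS LL c m) \<cdot>\<^bsub>M\<^esub> Lunt B (c \<triangleright>\<^bsub>M\<^esub> m) = Id C c \<odot>\<^bsub>M\<^esub> Lunt B m"
    using B.unit.nat_module[OF assms] by simp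
  have unit': "FA L (FS LL c m) \<cdot>\<^bsub>M\<^esub> Lunt B (c \<triangleright>\<^bsub>M\<^esub> m)
      = Inv M (FS L c (FO LL m)) \<cdot>\<^bsub>M\<^esub> (Id C c \<odot>\<^bsub>M\<^esub> Lunt B m)"
    unfolding unit[symmetric] by simp
  have counit: "(Id C c \<odot>\<^bsub>M\<^esub> Lcnt A m) \<cdot>\<^bsub>M\<^esub> FS L c (FO F m) \<cdot>\<^bsub>M\<^esub> FA L (FS F c m) = Lcnt A (c \<triangleright>\<^bsub>M\<^esub> m)"
    using A.counit.nat_module[OF assms] by simp
  have "\<Theta>N (FO F (c \<triangleright>\<^bsub>M\<^esub> m)) ((h \<cdot>\<^bsub>N\<^esub> FS LL c m) \<cdot>\<^bsub>N\<^esub> \<alpha> (c \<triangleright>\<^bsub>M\<^esub> m))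
      = closed_trace (c \<triangleright>\<^bsub>M\<^esub> m) (h \<cdot>\<^bsub>N\<^esub> FS LL c m)"
    by (rule canonical_trace) simp_all
  also have "\<dots> = \<Theta>M (c \<triangleright>\<^bsub>M\<^esub> m) (Lcnt A (c \<triangleright>\<^bsub>M\<^esub> m) \<cdot>\<^bsub>M\<^esub> ?g \<cdot>\<^bsub>M\<^esub> (Id C c \<odot>\<^bsub>M\<^esub> Lunt B m))"
    by (simp add: closed_trace_def unit')
  also have "\<dots> = \<Theta>M m (?tM m m (Lcnt A (c \<triangleright>\<^bsub>M\<^esub> m) \<cdot>\<^bsub>M\<^esub> ?g \<cdot>\<^bsub>M\<^esub> (Id C c \<odot>\<^bsub>M\<^esub> Lunt B m)))"
    by (rule M.trace_partial_trace) simp_all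
  finally have lhs: "\<Theta>N (FO F (c \<triangleright>\<^bsub>M\<^esub> m)) ((h \<cdot>\<^bsub>N\<^esub> FS LL c m) \<cdot>\<^bsub>N\<^esub> \<alpha> (c \<triangleright>\<^bsub>M\<^esub> m))
      = \<Theta>M m (?tM m m (Lcnt A (c \<triangleright>\<^bsub>M\<^esub> m) \<cdot>\<^bsub>M\<^esub> ?g \<cdot>\<^bsub>M\<^esub> (Id C c \<odot>\<^bsub>M\<^esub> Lunt B m)))" .
  let ?q = "FS F c m \<cdot>\<^bsub>N\<^esub> h"
  have "\<Theta>N (FO F (c \<triangleright>\<^bsub>M\<^esub> m)) ((h \<cdot>\<^bsub>N\<^esub> (Id C c \<odot>\<^bsub>N\<^esub> \<alpha> m)) \<cdot>\<^bsub>N\<^esub> FS F c m)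
      = \<Theta>N (c \<triangleright>\<^bsub>N\<^esub> FO F m) (FS F c m \<cdot>\<^bsub>N\<^esub> (h \<cdot>\<^bsub>N\<^esub> (Id C c \<odot>\<^bsub>N\<^esub> \<alpha> m)))"
    by (rule N.trace_symmetric) simp_all
  also have "\<dots> = \<Theta>N (FO F m) (?tN (FO F m) (FO F m) (FS F c m \<cdot>\<^bsub>N\<^esub> (h \<cdot>\<^bsub>N\<^esub> (Id C c \<odot>\<^bsub>N\<^esub> \<alpha> m))))"
    by (rule N.trace_partial_trace) simp_all
  also have "?tN (FO F m) (FO F m) (FS F c m \<cdot>\<^bsub>N\<^esub> (h \<cdot>\<^bsub>N\<^esub> (Id C c \<odot>\<^bsub>N\<^esub> \<alpha> m)))
      = ?tN (FO LL m) (FO F m) ?q \<cdot>\<^bsub>N\<^esub> \<alpha> m"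
    using A.F.N.partial_trace_between_pre[OF assms(1) \<kappa>, of ?q "FO LL m" "FO F m" "\<alpha> m" "FO F m"]
    by simp
  also have "\<Theta>N (FO F m) (?tN (FO LL m) (FO F m) ?q \<cdot>\<^bsub>N\<^esub> \<alpha> m) = closed_trace m (?tN (FO LL m) (FO F m) ?q)"
    by (rule canonical_trace) simp_all
  also have "\<dots> = \<Theta>M m (Lcnt A m \<cdot>\<^bsub>M\<^esub> ?tM (FO L (FO LL m)) (FO L (FO F m))
      (FS L c (FO F m) \<cdot>\<^bsub>M\<^esub> FA L ?q \<cdot>\<^bsub>M\<^esub> Inv M (FS L c (FO LL m))) \<cdot>\<^bsub>M\<^esub> Lunt B m)"
    unfolding closed_trace_def by (subst A.L.FA_partial_trace_between[OF assms(1) \<kappa>]) simp_all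
  also have "Lcnt A m \<cdot>\<^bsub>M\<^esub> ?tM (FO L (FO LL m)) (FO L (FO F m))
      (FS L c (FO F m) \<cdot>\<^bsub>M\<^esub> FA L ?q \<cdot>\<^bsub>M\<^esub> Inv M (FS L c (FO LL m))) \<cdot>\<^bsub>M\<^esub> Lunt B m
    = Lcnt A m \<cdot>\<^bsub>M\<^esub> ?tM m (FO L (FO F m))
      ((FS L c (FO F m) \<cdot>\<^bsub>M\<^esub> FA L ?q \<cdot>\<^bsub>M\<^esub> Inv M (FS L c (FO LL m))) \<cdot>\<^bsub>M\<^esub> (Id C c \<odot>\<^bsub>M\<^esub> Lunt B m))"
    by (subst A.F.M.partial_trace_between_pre[OF assms(1) \<kappa>, where m' = "FO L (FO LL m)"]) simp_all
  also have "\<dots> = ?tM m m ((Id C c \<odot>\<^bsub>M\<^esub> Lcnt A m) \<cdot>\<^bsub>M\<^esub>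
      ((FS L c (FO F m) \<cdot>\<^bsub>M\<^esub> FA L ?q \<cdot>\<^bsub>M\<^esub> Inv M (FS L c (FO LL m))) \<cdot>\<^bsub>M\<^esub> (Id C c \<odot>\<^bsub>M\<^esub> Lunt B m)))"
    by (rule A.F.M.partial_trace_between_post[OF assms(1) \<kappa>, symmetric]) simp_all
  also have "(Id C c \<odot>\<^bsub>M\<^esub> Lcnt A m) \<cdot>\<^bsub>M\<^esub>
      ((FS L c (FO F m) \<cdot>\<^bsub>M\<^esub> FA L ?q \<cdot>\<^bsub>M\<^esub> Inv M (FS L c (FO LL m))) \<cdot>\<^bsub>M\<^esub> (Id C c \<odot>\<^bsub>M\<^esub> Lunt B m))
    = Lcnt A (c \<triangleright>\<^bsub>M\<^esub> m) \<cdot>\<^bsub>M\<^esub> ?g \<cdot>\<^bsub>M\<^esub> (Id C c \<odot>\<^bsub>M\<^esub> Lunt B m)"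
    unfolding counit[symmetric] by simp
  finally have rhs: "\<Theta>N (FO F (c \<triangleright>\<^bsub>M\<^esub> m)) ((h \<cdot>\<^bsub>N\<^esub> (Id C c \<odot>\<^bsub>N\<^esub> \<alpha> m)) \<cdot>\<^bsub>N\<^esub> FS F c m)
      = \<Theta>M m (?tM m m (Lcnt A (c \<triangleright>\<^bsub>M\<^esub> m) \<cdot>\<^bsub>M\<^esub> ?g \<cdot>\<^bsub>M\<^esub> (Id C c \<odot>\<^bsub>M\<^esub> Lunt B m)))" .
  show "\<Theta>N (FO F (c \<triangleright>\<^bsub>M\<^esub> m)) (h \<cdot>\<^bsub>N\<^esub> (FS LL c m \<cdot>\<^bsub>N\<^esub> \<alpha> (c \<triangleright>\<^bsub>M\<^esub> m)))
      = \<Theta>N (FO F (c \<triangleright>\<^bsub>M\<^esub> m)) (h \<cdot>\<^bsub>N\<^esub> ((Id C c \<odot>\<^bsub>N\<^esub> \<alpha> m) \<cdot>\<^bsub>N\<^esub> FS F c m))"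
    using lhs rhs by simp
qed simp_all

lemma canonical_module_nat_iso: "module_nat_iso C M N F LL \<alpha>"
  using canonical_extensional canonical_natural canonical_module canonical_iso
  by unfold_locales simp_all

end


section \<open>Naturality, composition and rescaling\<close>

text \<open>
  The compatibility of mates with units and counits moves \<open>\<rho>\<close> in the closed trace from behind \<open>h\<close>,
  where \<open>\<rho>\<^sup>l\<^sup>l\<close> stands, to the front of \<open>h\<close>, and the symmetry of the trace of \<open>N\<close> moves it around.
\<close>

lemma canonical_transf_natural:
  assumes "traced_double_adjoint C a M N \<Theta>M \<Theta>N F A B"
    and "traced_double_adjoint C a M N \<Theta>M \<Theta>N G A' B'"
    and "module_nat_transf C M N F G \<rho>"
  shows "vcomp M N (transf_ll M N A B A' B' \<rho>) (canonical_transf M N \<Theta>M \<Theta>N F A B) =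
    vcomp M N (canonical_transf M N \<Theta>M \<Theta>N G A' B') \<rho>"
proof -
  interpret F: traced_double_adjoint C a M N \<Theta>M \<Theta>N F A B by fact
  interpret G: traced_double_adjoint C a M N \<Theta>M \<Theta>N G A' B' by fact
  interpret \<rho>: module_nat_transf C M N F G \<rho> by fact
  interpret l: mate C M N F G A A' \<rho> ..
  interpret ll: mate C N M "Lfun A'" "Lfun A" B' B "transf_l M N A A' \<rho>" ..
  let ?l = "transf_l M N A A' \<rho>" and ?ll = "transf_l N M B' B (transf_l M N A A' \<rho>)"
  have "?ll m \<cdot>\<^bsub>N\<^esub> F.\<alpha> m = G.\<alpha> m \<cdot>\<^bsub>N\<^esub> \<rho> m" if [simp]: "m \<in> Obj M" for m
  proof (rule F.N.trace_eqI)
    fix h assume "h \<in> hom N (FO (Lfun B') m) (FO F m)"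
    then have [simp]: "h \<in> Arr N" "Dom N h = FO (Lfun B') m" "Cod N h = FO F m" by auto
    have "\<Theta>N (FO F m) ((h \<cdot>\<^bsub>N\<^esub> ?ll m) \<cdot>\<^bsub>N\<^esub> F.\<alpha> m) = F.closed_trace m (h \<cdot>\<^bsub>N\<^esub> ?ll m)"
      by (rule F.canonical_trace) simp_all
    also have "\<dots> = \<Theta>M m (Lcnt A m \<cdot>\<^bsub>M\<^esub> FA (Lfun A) h \<cdot>\<^bsub>M\<^esub> ?l (FO (Lfun B') m) \<cdot>\<^bsub>M\<^esub> Lunt B' m)"
      by (simp add: F.closed_trace_def ll.transf_l_unit)
    also have "\<dots> = \<Theta>M m (Lcnt A m \<cdot>\<^bsub>M\<^esub> (FA (Lfun A) h \<cdot>\<^bsub>M\<^esub> ?l (FO (Lfun B') m)) \<cdot>\<^bsub>M\<^esub> Lunt B' m)"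
      by simp
    also have "FA (Lfun A) h \<cdot>\<^bsub>M\<^esub> ?l (FO (Lfun B') m) = ?l (FO F m) \<cdot>\<^bsub>M\<^esub> FA (Lfun A') h"
      by (simp add: l.transf_l.nat_slide)
    also have "Lcnt A m \<cdot>\<^bsub>M\<^esub> (?l (FO F m) \<cdot>\<^bsub>M\<^esub> FA (Lfun A') h) \<cdot>\<^bsub>M\<^esub> Lunt B' m
        = (Lcnt A m \<cdot>\<^bsub>M\<^esub> ?l (FO F m)) \<cdot>\<^bsub>M\<^esub> FA (Lfun A') h \<cdot>\<^bsub>M\<^esub> Lunt B' m"
      by simp
    also have "\<Theta>M m \<dots> = G.closed_trace m (\<rho> m \<cdot>\<^bsub>N\<^esub> h)"
      by (simp add: l.transf_l_counit G.closed_trace_def)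
    also have "\<dots> = \<Theta>N (FO G m) ((\<rho> m \<cdot>\<^bsub>N\<^esub> h) \<cdot>\<^bsub>N\<^esub> G.\<alpha> m)"
      by (rule G.canonical_trace[symmetric]) simp_all
    also have "\<dots> = \<Theta>N (FO G m) (\<rho> m \<cdot>\<^bsub>N\<^esub> (h \<cdot>\<^bsub>N\<^esub> G.\<alpha> m))"
      by simp
    also have "\<dots> = \<Theta>N (FO F m) ((h \<cdot>\<^bsub>N\<^esub> G.\<alpha> m) \<cdot>\<^bsub>N\<^esub> \<rho> m)"
      by (rule F.N.trace_symmetric) simp_all
    finally show "\<Theta>N (FO F m) (h \<cdot>\<^bsub>N\<^esub> (?ll m \<cdot>\<^bsub>N\<^esub> F.\<alpha> m)) = \<Theta>N (FO F m) (h \<cdot>\<^bsub>N\<^esub> (G.\<alpha> m \<cdot>\<^bsub>N\<^esub> \<rho> m))"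
      by simp
  qed simp_all
  then show ?thesis
    by (auto simp: vcomp_def transf_ll_def)
qed

lemma traced_double_adjoint_comp:
  assumes "traced_double_adjoint C a M N \<Theta>M \<Theta>N F A B"
    and "traced_double_adjoint C a N E \<Theta>N \<Theta>E K A' B'"
  shows "traced_double_adjoint C a M E \<Theta>M \<Theta>E (mfun_comp E K F)
    (comp_ladj M E K A' F A) (comp_ladj E M (Lfun A) B (Lfun A') B')"
proof -
  interpret F: traced_double_adjoint C a M N \<Theta>M \<Theta>N F A B by fact
  interpret K: traced_double_adjoint C a N E \<Theta>N \<Theta>E K A' B' by fact
  show ?thesis
    using left_adjoint_comp[OF F.A.left_adjoint_axioms K.A.left_adjoint_axioms]
      left_adjoint_comp[OF K.B.left_adjoint_axioms F.B.left_adjoint_axioms]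
      F.M.module_trace_axioms K.N.module_trace_axioms
    by (simp add: traced_double_adjoint_def)
qed

text \<open>
  Pairing the horizontal composite with \<open>h\<close> moves \<open>h\<close> first through the adjunctions of \<open>K\<close> and
  then through those of \<open>F\<close>, and this is how the composite adjunctions act.
\<close>

lemma canonical_transf_comp:
  assumes "traced_double_adjoint C a M N \<Theta>M \<Theta>N F A B"
    and "traced_double_adjoint C a N E \<Theta>N \<Theta>E K A' B'"
  shows "canonical_transf M E \<Theta>M \<Theta>E (mfun_comp E K F)
      (comp_ladj M E K A' F A) (comp_ladj E M (Lfun A) B (Lfun A') B') =
    hcomp M E K (Lfun B) (canonical_transf N E \<Theta>N \<Theta>E K A' B') (canonical_transf M N \<Theta>M \<Theta>N F A B)"
proof -
  interpret F: traced_double_adjoint C a M N \<Theta>M \<Theta>N F A B by fact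
  interpret K: traced_double_adjoint C a N E \<Theta>N \<Theta>E K A' B' by fact
  interpret KF: traced_double_adjoint C a M E \<Theta>M \<Theta>E "mfun_comp E K F"
    "comp_ladj M E K A' F A" "comp_ladj E M (Lfun A) B (Lfun A') B'"
    by (rule traced_double_adjoint_comp) fact+
  have "KF.\<alpha> m = K.\<alpha> (FO (Lfun B) m) \<cdot>\<^bsub>E\<^esub> FA K (F.\<alpha> m)" if [simp]: "m \<in> Obj M" for m
  proof (rule KF.canonical_eqI)
    fix h assume "h \<in> hom E (FO KF.LL m) (FO (mfun_comp E K F) m)"
    then have [simp]: "h \<in> Arr E" "Dom E h = FO (Lfun B') (FO (Lfun B) m)" "Cod E h = FO K (FO F m)"
      by auto
    let ?n = "FO (Lfun B) m"
    let ?g = "Lcnt A' (FO F m) \<cdot>\<^bsub>N\<^esub> FA (Lfun A') h \<cdot>\<^bsub>N\<^esub> Lunt B' ?n"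
    have "\<Theta>E (FO K (FO F m)) ((h \<cdot>\<^bsub>E\<^esub> K.\<alpha> ?n) \<cdot>\<^bsub>E\<^esub> FA K (F.\<alpha> m))
        = \<Theta>E (FO K ?n) (FA K (F.\<alpha> m) \<cdot>\<^bsub>E\<^esub> (h \<cdot>\<^bsub>E\<^esub> K.\<alpha> ?n))"
      by (rule K.N.trace_symmetric) simp_all
    also have "\<dots> = K.closed_trace ?n (FA K (F.\<alpha> m) \<cdot>\<^bsub>E\<^esub> h)"
      using K.canonical_trace[of ?n "FA K (F.\<alpha> m) \<cdot>\<^bsub>E\<^esub> h"] by simp
    also have "\<dots> = \<Theta>N ?n (F.\<alpha> m \<cdot>\<^bsub>N\<^esub> ?g)"
      by (simp add: K.closed_trace_def K.A.counit_slide_tail)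
    also have "\<dots> = \<Theta>N (FO F m) (?g \<cdot>\<^bsub>N\<^esub> F.\<alpha> m)"
      by (rule F.N.trace_symmetric) simp_all
    also have "\<dots> = F.closed_trace m ?g"
      by (rule F.canonical_trace) simp_all
    also have "\<dots> = KF.closed_trace m h"
      by (simp add: F.closed_trace_def KF.closed_trace_def)
    finally show "\<Theta>E (FO (mfun_comp E K F) m) (h \<cdot>\<^bsub>E\<^esub> (K.\<alpha> ?n \<cdot>\<^bsub>E\<^esub> FA K (F.\<alpha> m))) = KF.closed_trace m h"
      by simp
  qed simp_all
  then show ?thesis
    using KF.canonical_extensional
    by (intro extensionalityI[of _ "Obj M"]) (auto simp: hcomp_def)
qed

lemma module_trace_rescale:
  assumes "module_trace C a M \<Theta>" and "z \<noteq> 0"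
  shows "module_trace C a M (\<lambda>m f. z * \<Theta> m f)"
proof -
  interpret module_trace C a M \<Theta> by fact
  show ?thesis
  proof unfold_locales
    show "z * \<Theta> m (g \<cdot>\<^bsub>M\<^esub> f) = z * \<Theta> n (f \<cdot>\<^bsub>M\<^esub> g)" if "f \<in> hom M m n" "g \<in> hom M n m" for f g m n
      using trace_symmetric[OF that] by simp
    show "f = Zero M m n" if "f \<in> hom M m n" "\<And>g. g \<in> hom M n m \<Longrightarrow> z * \<Theta> m (g \<cdot>\<^bsub>M\<^esub> f) = 0" for f m n
      using trace_nondegenerate_left[OF that(1)] that(2) \<open>z \<noteq> 0\<close> by (simp del: in_hom)
    show "g = Zero M n m" if "g \<in> hom M n m" "\<And>f. f \<in> hom M m n \<Longrightarrow> z * \<Theta> m (g \<cdot>\<^bsub>M\<^esub> f) = 0" for g m n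
      using trace_nondegenerate_right[OF that(1)] that(2) \<open>z \<noteq> 0\<close> by (simp del: in_hom)
  qed (auto simp: trace_Add trace_Scale trace_compatible distrib_left)
qed

text \<open>
  The scalar multiplies both the trace pairing with \<open>\<alpha> m\<close> and the closed trace that it has to equal.
\<close>

lemma canonical_transf_rescale:
  assumes "traced_double_adjoint C a M N \<Theta>M \<Theta>N F A B" and "z \<noteq> 0"
  shows "canonical_transf M N (\<lambda>m f. z * \<Theta>M m f) (\<lambda>n f. z * \<Theta>N n f) F A B =
    canonical_transf M N \<Theta>M \<Theta>N F A B"
proof -
  interpret T: traced_double_adjoint C a M N \<Theta>M \<Theta>N F A B by fact
  interpret zT: traced_double_adjoint C a M N "\<lambda>m f. z * \<Theta>M m f" "\<lambda>n f. z * \<Theta>N n f" F A B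
    using module_trace_rescale[OF T.M.module_trace_axioms \<open>z \<noteq> 0\<close>]
      module_trace_rescale[OF T.N.module_trace_axioms \<open>z \<noteq> 0\<close>]
    by (simp add: traced_double_adjoint_def T.A.left_adjoint_axioms T.B.left_adjoint_axioms)
  have "zT.\<alpha> m = T.\<alpha> m" if [simp]: "m \<in> Obj M" for m
  proof (rule zT.canonical_eqI)
    fix h assume "h \<in> hom N (FO (Lfun B) m) (FO F m)"
    then show "z * \<Theta>N (FO F m) (h \<cdot>\<^bsub>N\<^esub> T.\<alpha> m) = zT.closed_trace m h"
      by (simp add: T.canonical_trace T.closed_trace_def zT.closed_trace_def)
  qed simp_all
  then show ?thesis
    using T.canonical_extensional zT.canonical_extensional
    by (intro extensionalityI[of _ "Obj M"]) auto
qed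


section \<open>The dual category\<close>

lemma vcomp_extensional [simp]: "vcomp M N \<sigma> \<rho> \<in> extensional (Obj M)"
  by (simp add: vcomp_def)

lemma hcomp_extensional [simp]: "hcomp M E K F' \<sigma> \<rho> \<in> extensional (Obj M)"
  by (simp add: hcomp_def)

lemma transf_l_extensional [simp]: "transf_l M N A A' \<rho> \<in> extensional (Obj N)"
  by (simp add: transf_l_def)

lemma hcomp_apply [simp]:
  "m \<in> Obj M \<Longrightarrow> hcomp M E K F' \<sigma> \<rho> m = \<sigma> (FO F' m) \<cdot>\<^bsub>E\<^esub> FA K (\<rho> m)"
  by (simp add: hcomp_def)

locale dual_category = module_category C M
  for C :: "('c, 'k, 'y) fusion_cat_scheme"
    and M :: "('c, 'k, 'o, 'a, 'u) module_cat_scheme" +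
  fixes lad :: "('c, 'o, 'a, 'o, 'a) mfun \<Rightarrow> ('c, 'o, 'a, 'o, 'a) ladj"
  assumes lad: "module_functor C M M F \<Longrightarrow> left_adjoint C M M F (lad F)"
begin

abbreviation D where "D \<equiv> fun_cat C M lad"
abbreviation ident where "ident F \<equiv> (\<lambda>m \<in> Obj M. Id M (FO F m))"
abbreviation comp where "comp \<equiv> mfun_comp M"

lemma dual_category_simps [simp]:
  "F \<in> Obj D \<longleftrightarrow> module_functor C M M F"
  "(F, G, \<rho>) \<in> Arr D \<longleftrightarrow> module_nat_transf C M M F G \<rho>"
  "Dom D (F, G, \<rho>) = F" "Cod D (F, G, \<rho>) = G"
  "Id D F = (F, F, ident F)"
  "(G, H, \<sigma>) \<cdot>\<^bsub>D\<^esub> (F, G', \<rho>) = (F, H, vcomp M M \<sigma> \<rho>)"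
  "K \<otimes>\<^bsub>D\<^esub> F = comp K F"
  "(K, K', \<sigma>) \<boxtimes>\<^bsub>D\<^esub> (F, F', \<rho>) = (comp K F, comp K' F', hcomp M M K F' \<sigma> \<rho>)"
  "Unit D = id_mfun M"
  "Assoc D F G H = (comp (comp F G) H, comp F (comp G H), ident (comp F (comp G H)))"
  "Lunit D F = (comp (id_mfun M) F, F, ident F)"
  "Runit D F = (comp F (id_mfun M), F, ident F)"
  "Rdual D F = Lfun (lad F)"
  "Ev D F = (comp (Lfun (lad F)) F, id_mfun M, Lcnt (lad F))"
  "Coev D F = (id_mfun M, comp F (Lfun (lad F)), Lunt (lad F))"
  by (simp_all add: fun_cat_def Let_def)

lemma arrowE:
  assumes "f \<in> hom D F G"
  obtains \<rho> where "f = (F, G, \<rho>)" "module_nat_transf C M M F G \<rho>"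
  using assms by (cases f) auto

lemma comp_functor [simp]:
  "\<lbrakk>module_functor C M M K; module_functor C M M F\<rbrakk> \<Longrightarrow> module_functor C M M (comp K F)"
  by (rule module_functor_comp)

lemma id_functor [simp]: "module_functor C M M (id_mfun M)"
  by (rule module_functor_id) (rule module_category_axioms)

lemma ident_transf [simp]: "module_functor C M M F \<Longrightarrow> module_nat_transf C M M F F (ident F)"
  by (rule module_nat_transf_id)

lemma category_dual: "category D"
proof
  show "Dom D f \<in> Obj D" "Cod D f \<in> Obj D" if "f \<in> Arr D" for f
    using that by (cases f; simp add: module_nat_transf_def)+
  show "Id D F \<in> hom D F F" if "F \<in> Obj D" for F
    using that by simp
  show "g \<cdot>\<^bsub>D\<^esub> f \<in> hom D F H" if "f \<in> hom D F G" "g \<in> hom D G H" for f g F G H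
    using that by (elim arrowE) (simp add: module_nat_transf_vcomp)
  show "Id D G \<cdot>\<^bsub>D\<^esub> f = f" "f \<cdot>\<^bsub>D\<^esub> Id D F = f" if f: "f \<in> hom D F G" for f F G
  proof -
    obtain \<rho> where \<rho>: "f = (F, G, \<rho>)" "module_nat_transf C M M F G \<rho>"
      using f by (rule arrowE)
    interpret module_nat_transf C M M F G \<rho> by fact
    show "Id D G \<cdot>\<^bsub>D\<^esub> f = f" "f \<cdot>\<^bsub>D\<^esub> Id D F = f"
      by (auto simp: \<rho>(1) nat_extensional intro!: extensionalityI[of _ "Obj M"])
  qed
  show "(h \<cdot>\<^bsub>D\<^esub> g) \<cdot>\<^bsub>D\<^esub> f = h \<cdot>\<^bsub>D\<^esub> (g \<cdot>\<^bsub>D\<^esub> f)"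
    if f: "f \<in> hom D F G" and g: "g \<in> hom D G H" and h: "h \<in> hom D H K" for f g h F G H K
  proof -
    obtain \<rho> where \<rho>: "f = (F, G, \<rho>)" "module_nat_transf C M M F G \<rho>"
      using f by (rule arrowE)
    obtain \<sigma> where \<sigma>: "g = (G, H, \<sigma>)" "module_nat_transf C M M G H \<sigma>"
      using g by (rule arrowE)
    obtain \<tau> where \<tau>: "h = (H, K, \<tau>)" "module_nat_transf C M M H K \<tau>"
      using h by (rule arrowE)
    interpret \<rho>: module_nat_transf C M M F G \<rho> by fact
    interpret \<sigma>: module_nat_transf C M M G H \<sigma> by fact
    interpret \<tau>: module_nat_transf C M M H K \<tau> by fact
    show ?thesis
      by (auto simp: \<rho>(1) \<sigma>(1) \<tau>(1) intro!: extensionalityI[of _ "Obj M"])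
  qed
qed

sublocale D: category D
  by (rule category_dual)

text \<open>The structural isomorphisms are identities between functors that agree on the objects.\<close>

lemma agree_iso:
  assumes "mfun_agree C M F G" and "module_functor C M M F" and "module_functor C M M G"
  shows "(F, G, ident G) \<in> Arr D" "iso D (F, G, ident G)" "Inv D (F, G, ident G) = (G, F, ident F)"
proof -
  interpret F: module_functor C M M F by fact
  interpret G: module_functor C M M G by fact
  have sym: "mfun_agree C M G F" and FO: "\<And>m. m \<in> Obj M \<Longrightarrow> FO F m = FO G m"
    using assms(1) by (auto simp: mfun_agree_def)
  have *: "(F, G, ident G) \<in> Arr D"
    "(G, F, ident F) \<in> hom D (Cod D (F, G, ident G)) (Dom D (F, G, ident G))"
    "(G, F, ident F) \<cdot>\<^bsub>D\<^esub> (F, G, ident G) = Id D (Dom D (F, G, ident G))"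
    "(F, G, ident G) \<cdot>\<^bsub>D\<^esub> (G, F, ident F) = Id D (Cod D (F, G, ident G))"
    using module_nat_transf_agree[OF assms] module_nat_transf_agree[OF sym assms(3,2)]
    by (auto simp: FO intro!: extensionalityI[of _ "Obj M"])
  show "(F, G, ident G) \<in> Arr D" "iso D (F, G, ident G)" "Inv D (F, G, ident G) = (G, F, ident F)"
    using *(1) D.isoI[OF *] by auto
qed

lemma nat_iso_iso:
  assumes "module_nat_iso C M M F G \<rho>"
  shows "iso D (F, G, \<rho>)"
proof -
  interpret \<rho>: module_nat_iso C M M F G \<rho> by fact
  note \<rho>.nat_iso [simp]
  show ?thesis
    using module_nat_transf_inverse[OF assms] \<rho>.module_nat_transf_axioms
    by (intro D.isoI(1)[of _ "(G, F, \<lambda>m \<in> Obj M. Inv M (\<rho> m))"])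
      (auto intro!: extensionalityI[of _ "Obj M"])
qed

lemma agree_assoc:
  assumes "module_functor C M M F" and "module_functor C M M G" and "module_functor C M M H"
  shows "mfun_agree C M (comp (comp F G) H) (comp F (comp G H))"
proof -
  interpret F: module_functor C M M F by fact
  interpret G: module_functor C M M G by fact
  interpret H: module_functor C M M H by fact
  show ?thesis by (simp add: mfun_agree_def)
qed

lemma agree_unit:
  assumes "module_functor C M M F"
  shows "mfun_agree C M (comp (id_mfun M) F) F" "mfun_agree C M (comp F (id_mfun M)) F"
proof -
  interpret module_functor C M M F by fact
  show "mfun_agree C M (comp (id_mfun M) F) F" "mfun_agree C M (comp F (id_mfun M)) F"
    by (simp_all add: mfun_agree_def)
qed

lemmas Assoc_agree_iso = agree_iso[OF agree_assoc]
lemmas Lunit_agree_iso = agree_iso[OF agree_unit(1)]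
lemmas Runit_agree_iso = agree_iso[OF agree_unit(2)]

lemma Inv_structure [simp]:
  assumes "module_functor C M M F"
  shows "\<lbrakk>module_functor C M M G; module_functor C M M H\<rbrakk> \<Longrightarrow>
      Inv D (Assoc D F G H) = (comp F (comp G H), comp (comp F G) H, ident (comp (comp F G) H))"
    "Inv D (Lunit D F) = (F, comp (id_mfun M) F, ident (comp (id_mfun M) F))"
    "Inv D (Runit D F) = (F, comp F (id_mfun M), ident (comp F (id_mfun M)))"
  using assms Assoc_agree_iso(3)[of F G H] Lunit_agree_iso(3)[of F] Runit_agree_iso(3)[of F]
  by (simp_all del: mfun_comp_simps id_mfun_simps)

lemma monoidal_category_dual: "monoidal_category D"
proof unfold_locales
  show "Unit D \<in> Obj D" by simp
  show "F \<otimes>\<^bsub>D\<^esub> G \<in> Obj D" if "F \<in> Obj D" "G \<in> Obj D" for F G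
    using that by simp
  show "f \<boxtimes>\<^bsub>D\<^esub> g \<in> hom D (F \<otimes>\<^bsub>D\<^esub> G) (F' \<otimes>\<^bsub>D\<^esub> G')"
    if "f \<in> hom D F F'" "g \<in> hom D G G'" for f g F F' G G'
    using that by (elim arrowE) (simp add: module_nat_transf_hcomp)
  show "Id D F \<boxtimes>\<^bsub>D\<^esub> Id D G = Id D (F \<otimes>\<^bsub>D\<^esub> G)" if FG: "F \<in> Obj D" "G \<in> Obj D" for F G
  proof -
    interpret F: module_functor C M M F using FG by simp
    interpret G: module_functor C M M G using FG by simp
    show ?thesis by (auto intro!: extensionalityI[of _ "Obj M"])
  qed
  show "(f' \<cdot>\<^bsub>D\<^esub> f) \<boxtimes>\<^bsub>D\<^esub> (g' \<cdot>\<^bsub>D\<^esub> g) = (f' \<boxtimes>\<^bsub>D\<^esub> g') \<cdot>\<^bsub>D\<^esub> (f \<boxtimes>\<^bsub>D\<^esub> g)"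
    if f: "f \<in> hom D F F'" and f': "f' \<in> hom D F' F''" and g: "g \<in> hom D G G'" and g': "g' \<in> hom D G' G''"
    for f f' g g' F F' F'' G G' G''
  proof -
    obtain \<rho> where \<rho>: "f = (F, F', \<rho>)" "module_nat_transf C M M F F' \<rho>" using f by (rule arrowE)
    obtain \<rho>' where \<rho>': "f' = (F', F'', \<rho>')" "module_nat_transf C M M F' F'' \<rho>'" using f' by (rule arrowE)
    obtain \<sigma> where \<sigma>: "g = (G, G', \<sigma>)" "module_nat_transf C M M G G' \<sigma>" using g by (rule arrowE)
    obtain \<sigma>' where \<sigma>': "g' = (G', G'', \<sigma>')" "module_nat_transf C M M G' G'' \<sigma>'" using g' by (rule arrowE)
    interpret \<rho>: module_nat_transf C M M F F' \<rho> by fact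
    interpret \<rho>': module_nat_transf C M M F' F'' \<rho>' by fact
    interpret \<sigma>: module_nat_transf C M M G G' \<sigma> by fact
    interpret \<sigma>': module_nat_transf C M M G' G'' \<sigma>' by fact
    show ?thesis
      by (auto simp: \<rho>(1) \<rho>'(1) \<sigma>(1) \<sigma>'(1) \<rho>.nat_slide_tail intro!: extensionalityI[of _ "Obj M"])
  qed
  show "Assoc D F G H \<in> hom D ((F \<otimes>\<^bsub>D\<^esub> G) \<otimes>\<^bsub>D\<^esub> H) (F \<otimes>\<^bsub>D\<^esub> (G \<otimes>\<^bsub>D\<^esub> H))"
    "iso D (Assoc D F G H)" if "F \<in> Obj D" "G \<in> Obj D" "H \<in> Obj D" for F G H
    using that Assoc_agree_iso[of F G H] by (simp_all del: mfun_comp_simps)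
  show "Assoc D F' G' H' \<cdot>\<^bsub>D\<^esub> ((f \<boxtimes>\<^bsub>D\<^esub> g) \<boxtimes>\<^bsub>D\<^esub> h) = (f \<boxtimes>\<^bsub>D\<^esub> (g \<boxtimes>\<^bsub>D\<^esub> h)) \<cdot>\<^bsub>D\<^esub> Assoc D F G H"
    if f: "f \<in> hom D F F'" and g: "g \<in> hom D G G'" and h: "h \<in> hom D H H'" for f g h F F' G G' H H'
  proof -
    obtain \<rho> where \<rho>: "f = (F, F', \<rho>)" "module_nat_transf C M M F F' \<rho>" using f by (rule arrowE)
    obtain \<sigma> where \<sigma>: "g = (G, G', \<sigma>)" "module_nat_transf C M M G G' \<sigma>" using g by (rule arrowE)
    obtain \<tau> where \<tau>: "h = (H, H', \<tau>)" "module_nat_transf C M M H H' \<tau>" using h by (rule arrowE)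
    interpret \<rho>: module_nat_transf C M M F F' \<rho> by fact
    interpret \<sigma>: module_nat_transf C M M G G' \<sigma> by fact
    interpret \<tau>: module_nat_transf C M M H H' \<tau> by fact
    show ?thesis
      by (auto simp: \<rho>(1) \<sigma>(1) \<tau>(1) intro!: extensionalityI[of _ "Obj M"])
  qed
  show "Lunit D F \<in> hom D (Unit D \<otimes>\<^bsub>D\<^esub> F) F" "iso D (Lunit D F)"
    "Runit D F \<in> hom D (F \<otimes>\<^bsub>D\<^esub> Unit D) F" "iso D (Runit D F)" if "F \<in> Obj D" for F
    using that Lunit_agree_iso[of F] Runit_agree_iso[of F] by simp_all
  show "Lunit D G \<cdot>\<^bsub>D\<^esub> (Id D (Unit D) \<boxtimes>\<^bsub>D\<^esub> f) = f \<cdot>\<^bsub>D\<^esub> Lunit D F"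
    "Runit D G \<cdot>\<^bsub>D\<^esub> (f \<boxtimes>\<^bsub>D\<^esub> Id D (Unit D)) = f \<cdot>\<^bsub>D\<^esub> Runit D F" if f: "f \<in> hom D F G" for f F G
  proof -
    obtain \<rho> where \<rho>: "f = (F, G, \<rho>)" "module_nat_transf C M M F G \<rho>" using f by (rule arrowE)
    interpret \<rho>: module_nat_transf C M M F G \<rho> by fact
    show "Lunit D G \<cdot>\<^bsub>D\<^esub> (Id D (Unit D) \<boxtimes>\<^bsub>D\<^esub> f) = f \<cdot>\<^bsub>D\<^esub> Lunit D F"
      "Runit D G \<cdot>\<^bsub>D\<^esub> (f \<boxtimes>\<^bsub>D\<^esub> Id D (Unit D)) = f \<cdot>\<^bsub>D\<^esub> Runit D F"
      by (auto simp: \<rho>(1) intro!: extensionalityI[of _ "Obj M"])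
  qed
  show "(Id D K \<boxtimes>\<^bsub>D\<^esub> Assoc D F G H) \<cdot>\<^bsub>D\<^esub> Assoc D K (F \<otimes>\<^bsub>D\<^esub> G) H \<cdot>\<^bsub>D\<^esub> (Assoc D K F G \<boxtimes>\<^bsub>D\<^esub> Id D H)
      = Assoc D K F (G \<otimes>\<^bsub>D\<^esub> H) \<cdot>\<^bsub>D\<^esub> Assoc D (K \<otimes>\<^bsub>D\<^esub> F) G H"
    if KFGH: "K \<in> Obj D" "F \<in> Obj D" "G \<in> Obj D" "H \<in> Obj D" for K F G H
  proof -
    interpret K: module_functor C M M K using KFGH by simp
    interpret F: module_functor C M M F using KFGH by simp
    interpret G: module_functor C M M G using KFGH by simp
    interpret H: module_functor C M M H using KFGH by simp
    show ?thesis by (auto intro!: extensionalityI[of _ "Obj M"])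
  qed
  show "(Id D F \<boxtimes>\<^bsub>D\<^esub> Lunit D G) \<cdot>\<^bsub>D\<^esub> Assoc D F (Unit D) G = Runit D F \<boxtimes>\<^bsub>D\<^esub> Id D G"
    if FG: "F \<in> Obj D" "G \<in> Obj D" for F G
  proof -
    interpret F: module_functor C M M F using FG by simp
    interpret G: module_functor C M M G using FG by simp
    show ?thesis by (auto intro!: extensionalityI[of _ "Obj M"])
  qed
qed

sublocale D: monoidal_category D
  by (rule monoidal_category_dual)

text \<open>
  Up to the structural isomorphisms, which are componentwise identities, the two equations of a dual
  pair are the triangle identities.
\<close>

lemma dual_pair_left_adjoint:
  assumes "left_adjoint C M M F A"
  shows "dual_pair D F (Lfun A) (comp (Lfun A) F, id_mfun M, Lcnt A) (id_mfun M, comp F (Lfun A), Lunt A)"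
proof -
  interpret A: left_adjoint C M M F A by fact
  show ?thesis
    using A.F.module_functor_axioms A.L.module_functor_axioms
      A.unit.module_nat_transf_axioms A.counit.module_nat_transf_axioms
    by (auto simp: dual_pair_def Inv_structure[simplified] intro!: extensionalityI[of _ "Obj M"])
qed

text \<open>The formula for a dual morphism unfolds componentwise to the one for the mate.\<close>

lemma dual_map_mate:
  assumes "mate C M M F G A A' \<rho>"
  shows "dual_map D (Lfun A') (comp (Lfun A') G, id_mfun M, Lcnt A')
      (Lfun A) (id_mfun M, comp F (Lfun A), Lunt A) (F, G, \<rho>)
    = (Lfun A', Lfun A, transf_l M M A A' \<rho>)"
proof -
  interpret mate C M M F G A A' \<rho> by fact
  show ?thesis
    using A.F.module_functor_axioms A.L.module_functor_axioms
      A'.F.module_functor_axioms A'.L.module_functor_axioms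
    by (auto simp: dual_map_def Inv_structure[simplified] transf_l_def
        intro!: extensionalityI[of _ "Obj M"])
qed

lemma mate_ident:
  assumes "left_adjoint C M M F A" and "left_adjoint C M M F A'"
  shows "mate C M M F F A A' (ident F)"
  using assms by (simp add: mate_def left_adjoint_def)

lemma Rdual_arr_mate:
  assumes "module_nat_transf C M M F G \<rho>"
  shows "mate C M M F G (lad F) (lad G) \<rho>"
    "Rdual_arr D (F, G, \<rho>) = (Lfun (lad G), Lfun (lad F), transf_l M M (lad F) (lad G) \<rho>)"
proof -
  interpret module_nat_transf C M M F G \<rho> by fact
  show m: "mate C M M F G (lad F) (lad G) \<rho>"
    using assms lad[OF F.module_functor_axioms] lad[OF G.module_functor_axioms]
    by (simp add: mate_def)
  show "Rdual_arr D (F, G, \<rho>) = (Lfun (lad G), Lfun (lad F), transf_l M M (lad F) (lad G) \<rho>)"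
    using dual_map_mate[OF m] by (simp add: Rdual_arr_def)
qed

text \<open>
  The right dual \<open>F\<^sup>l \<circ> K\<^sup>l\<close> of \<open>K \<circ> F\<close> is the composite adjoint.  So the coherence isomorphisms of the
  double dual compare the composite adjoints with the chosen ones.
\<close>

lemma tens_ev_coev:
  assumes "module_functor C M M K" and "module_functor C M M F"
  defines "A \<equiv> comp_ladj M M K (lad K) F (lad F)"
  shows "tens_ev D K F = (comp (Lfun A) (comp K F), id_mfun M, Lcnt A)"
    "tens_coev D K F = (id_mfun M, comp (comp K F) (Lfun A), Lunt A)"
proof -
  interpret K: left_adjoint C M M K "lad K" by (rule lad) fact
  interpret F: left_adjoint C M M F "lad F" by (rule lad) fact
  show "tens_ev D K F = (comp (Lfun A) (comp K F), id_mfun M, Lcnt A)"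
    "tens_coev D K F = (id_mfun M, comp (comp K F) (Lfun A), Lunt A)"
    using K.F.module_functor_axioms K.L.module_functor_axioms
      F.F.module_functor_axioms F.L.module_functor_axioms
    by (auto simp: tens_ev_def tens_coev_def A_def Inv_structure[simplified]
          Inv_structure(1)[of K F "comp (Lfun (lad F)) (Lfun (lad K))", simplified]
        intro!: extensionalityI[of _ "Obj M"])
qed

end


section \<open>The pivotal structure\<close>

locale traced_dual_category = dual_category C M lad + module_trace C a M \<Theta>
  for C :: "('c, 'k, 'y) fusion_cat_scheme" and a :: "'c \<Rightarrow> 'k"
    and M :: "('c, 'k, 'o, 'a, 'u) module_cat_scheme"
    and \<Theta> :: "'o \<Rightarrow> 'a \<Rightarrow> complex"
    and lad :: "('c, 'o, 'a, 'o, 'a) mfun \<Rightarrow> ('c, 'o, 'a, 'o, 'a) ladj"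
begin

lemma traced_adjointI:
  assumes "left_adjoint C M M F A" and "left_adjoint C M M (Lfun A) B"
  shows "traced_double_adjoint C a M M \<Theta> \<Theta> F A B"
  using assms module_trace_axioms by (simp add: traced_double_adjoint_def)

lemma lad_traced:
  assumes "module_functor C M M F"
  shows "traced_double_adjoint C a M M \<Theta> \<Theta> F (lad F) (lad (Lfun (lad F)))"
  using lad[OF assms] lad[OF left_adjoint.axioms(2)[OF lad[OF assms]]] by (rule traced_adjointI)

abbreviation can where "can \<equiv> canonical_transf M M \<Theta> \<Theta>"

lemma fun_pivotal_eq:
  "fun_pivotal M \<Theta> lad F =
    (F, Lfun (lad (Lfun (lad F))), can F (lad F) (lad (Lfun (lad F))))"
  by (simp add: fun_pivotal_def Let_def)

text \<open>
  The isomorphism \<open>F \<rightarrow> F\<^sup>l\<^sup>l\<close> turns the adjunction between \<open>F\<^sup>l\<^sup>l\<close> and \<open>F\<^sup>l\<close> into one between \<open>F\<close> and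
  \<open>F\<^sup>l\<close>, so that \<open>F\<^sup>l\<close> is a left dual of \<open>F\<close> as well as a right dual.
\<close>

lemma rigid_category_dual: "rigid_category D"
proof unfold_locales
  show "dual_pair D F (Rdual D F) (Ev D F) (Coev D F)" if "F \<in> Obj D" for F
    using dual_pair_left_adjoint[OF lad[of F]] that by simp
  show "\<exists>G e n. dual_pair D G F e n" if "F \<in> Obj D" for F
  proof -
    interpret F: traced_double_adjoint C a M M \<Theta> \<Theta> F "lad F" "lad (Lfun (lad F))"
      using lad_traced that by simp
    note left_adjoint_transport[OF F.B.left_adjoint_axioms F.canonical_module_nat_iso]
    from dual_pair_left_adjoint[OF this] show ?thesis by simp blast
  qed
qed

text \<open>
  Naturality for the identity of \<open>F\<close>, but with different adjoints at its two ends, says how \<open>a\<^sub>F\<close>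
  depends on the adjoints that it is formed with.
\<close>

lemma canonical_transf_change_adjoints:
  assumes "traced_double_adjoint C a M M \<Theta> \<Theta> F A B"
    and "traced_double_adjoint C a M M \<Theta> \<Theta> F A' B'"
  shows "can F A' B' = vcomp M M (transf_ll M M A B A' B' (ident F)) (can F A B)"
proof -
  interpret F: traced_double_adjoint C a M M \<Theta> \<Theta> F A B by fact
  interpret F': traced_double_adjoint C a M M \<Theta> \<Theta> F A' B' by fact
  have "vcomp M M (can F A' B') (ident F) = can F A' B'"
    using F'.canonical_extensional by (auto intro!: extensionalityI[of _ "Obj M"])
  then show ?thesis
    using canonical_transf_natural[OF assms ident_transf] F.A.F.module_functor_axioms by simp
qed

text \<open>
  Two comparisons of right duals compose to the mate of a mate, which is how the coherence
  isomorphisms of the double dual are put together.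
\<close>

lemma double_comparison:
  assumes A: "left_adjoint C M M F A" and B: "left_adjoint C M M (Lfun A) B"
  shows "Rdual_arr D (dual_map D (Rdual D F) (Ev D F) (Lfun A) (id_mfun M, comp F (Lfun A), Lunt A) (Id D F))
      \<cdot>\<^bsub>D\<^esub> dual_map D (Lfun B) (comp (Lfun B) (Lfun A), id_mfun M, Lcnt B)
        (Rdual D (Lfun A)) (Coev D (Lfun A)) (Id D (Lfun A))
    = (Lfun B, Lfun (lad (Lfun (lad F))),
        transf_ll M M A B (lad F) (lad (Lfun (lad F))) (ident F))"
proof -
  interpret A: left_adjoint C M M F A by fact
  interpret B: left_adjoint C M M "Lfun A" B by fact
  note ladF = lad[OF A.F.module_functor_axioms]
  interpret \<tau>: mate C M M F F A "lad F" "ident F"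
    by (rule mate_ident[OF A ladF])
  let ?\<tau> = "transf_l M M A (lad F) (ident F)"
  note \<tau> = dual_map_mate[OF mate_ident[OF A ladF]]
    Rdual_arr_mate[OF \<tau>.transf_l.module_nat_transf_axioms]
  note m = mate_ident[OF lad[OF A.L.module_functor_axioms] B]
  have "vcomp M M (ident (Lfun A)) ?\<tau> = ?\<tau>"
    by (auto intro!: extensionalityI[of _ "Obj M"])
  then show ?thesis
    using \<tau>(1,3) dual_map_mate[OF m] transf_l_vcomp[OF \<tau>(2) m] by (simp add: transf_ll_def)
qed

lemma pivotal_structure_dual: "pivotal_structure D (fun_pivotal M \<Theta> lad)"
proof -
  interpret D: rigid_category D by (rule rigid_category_dual)
  show ?thesis
  proof unfold_locales
    show "fun_pivotal M \<Theta> lad F \<in> hom D F (Rdual D (Rdual D F))" "iso D (fun_pivotal M \<Theta> lad F)"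
      if "F \<in> Obj D" for F
    proof -
      interpret F: traced_double_adjoint C a M M \<Theta> \<Theta> F "lad F" "lad (Lfun (lad F))"
        using lad_traced that by simp
      show "fun_pivotal M \<Theta> lad F \<in> hom D F (Rdual D (Rdual D F))" "iso D (fun_pivotal M \<Theta> lad F)"
        using F.canonical_module_nat_iso nat_iso_iso[OF F.canonical_module_nat_iso]
        by (simp_all add: fun_pivotal_eq module_nat_iso_def)
    qed
    show "Rdual_arr D (Rdual_arr D f) \<cdot>\<^bsub>D\<^esub> fun_pivotal M \<Theta> lad F = fun_pivotal M \<Theta> lad G \<cdot>\<^bsub>D\<^esub> f"
      if f: "f \<in> hom D F G" for f F G
    proof -
      obtain \<rho> where \<rho>: "f = (F, G, \<rho>)" "module_nat_transf C M M F G \<rho>"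
        using f by (rule arrowE)
      interpret \<rho>: module_nat_transf C M M F G \<rho> by fact
      interpret l: mate C M M F G "lad F" "lad G" \<rho>
        by (rule Rdual_arr_mate(1)[OF \<rho>(2)])
      note canonical_transf_natural[OF lad_traced lad_traced \<rho>(2),
          OF \<rho>.F.module_functor_axioms \<rho>.G.module_functor_axioms]
      then show ?thesis
        using Rdual_arr_mate(2)[OF \<rho>(2)] Rdual_arr_mate(2)[OF l.transf_l.module_nat_transf_axioms]
        by (simp add: \<rho>(1) fun_pivotal_eq transf_ll_def)
    qed
    show "fun_pivotal M \<Theta> lad (K \<otimes>\<^bsub>D\<^esub> F) =
        ddual_tens D K F \<cdot>\<^bsub>D\<^esub> (fun_pivotal M \<Theta> lad K \<boxtimes>\<^bsub>D\<^esub> fun_pivotal M \<Theta> lad F)"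
      if "K \<in> Obj D" "F \<in> Obj D" for K F
    proof -
      have [simp]: "module_functor C M M K" "module_functor C M M F" using that by simp_all
      let ?K' = "Lfun (lad K)" and ?F' = "Lfun (lad F)"
      let ?A = "comp_ladj M M K (lad K) F (lad F)" and ?B = "comp_ladj M M ?F' (lad ?F') ?K' (lad ?K')"
      interpret K: traced_double_adjoint C a M M \<Theta> \<Theta> K "lad K" "lad ?K'"
        by (rule lad_traced) simp
      interpret F: traced_double_adjoint C a M M \<Theta> \<Theta> F "lad F" "lad ?F'"
        by (rule lad_traced) simp
      note KF = traced_double_adjoint_comp[OF F.traced_double_adjoint_axioms K.traced_double_adjoint_axioms]
      interpret KF: traced_double_adjoint C a M M \<Theta> \<Theta> "comp K F" ?A ?B
        by (rule KF)
      have "ddual_tens D K F = (Lfun ?B, Lfun (lad (Lfun (lad (comp K F)))),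
          transf_ll M M ?A ?B (lad (comp K F)) (lad (Lfun (lad (comp K F)))) (ident (comp K F)))"
        using double_comparison[OF KF.A.left_adjoint_axioms KF.B.left_adjoint_axioms]
        by (simp add: ddual_tens_def Let_def tens_ev_coev K.A.L.module_functor_axioms F.A.L.module_functor_axioms)
      moreover have "can (comp K F) (lad (comp K F)) (lad (Lfun (lad (comp K F)))) =
          vcomp M M (transf_ll M M ?A ?B (lad (comp K F)) (lad (Lfun (lad (comp K F)))) (ident (comp K F)))
            (hcomp M M K (Lfun (lad ?F')) (can K (lad K) (lad ?K')) (can F (lad F) (lad ?F')))"
        using canonical_transf_change_adjoints[OF KF lad_traced]
          canonical_transf_comp[OF F.traced_double_adjoint_axioms K.traced_double_adjoint_axioms]
        by simp
      ultimately show ?thesis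
        by (simp add: fun_pivotal_eq)
    qed
    show "fun_pivotal M \<Theta> lad (Unit D) = ddual_unit D"
    proof -
      let ?U = "id_mfun M" and ?I = "id_ladj M"
      have I: "left_adjoint C M M ?U ?I"
        by (rule left_adjoint_id) (rule module_category_axioms)
      interpret I: traced_double_adjoint C a M M \<Theta> \<Theta> ?U ?I ?I
        by (rule traced_adjointI) (simp_all add: I)
      have "I.\<alpha> m = Id M m" if [simp]: "m \<in> Obj M" for m
        by (rule I.canonical_eqI) (simp_all add: I.closed_trace_def)
      then have "I.\<alpha> = ident ?U"
        using I.canonical_extensional by (intro extensionalityI[of _ "Obj M"]) auto
      moreover have "ddual_unit D = (?U, Lfun (lad (Lfun (lad ?U))),
          transf_ll M M ?I ?I (lad ?U) (lad (Lfun (lad ?U))) (ident ?U))"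
        using double_comparison[OF I.A.left_adjoint_axioms I.B.left_adjoint_axioms]
        by (simp add: ddual_unit_def Let_def Inv_structure(2)[of ?U, simplified])
      \<comment> \<open>\<open>ident ?U\<close> is at once the canonical transformation of the identity functor formed with the
        identity adjunction and the identity transformation of that functor.\<close>
      moreover have "vcomp M M (transf_ll M M ?I ?I (lad ?U) (lad (Lfun (lad ?U))) (ident ?U)) (ident ?U)
          = transf_ll M M ?I ?I (lad ?U) (lad (Lfun (lad ?U))) (ident ?U)"
      proof -
        interpret l: mate C M M ?U ?U ?I "lad ?U" "ident ?U"
          by (rule mate_ident) (simp_all add: I lad)
        interpret ll: mate C M M "Lfun (lad ?U)" "Lfun ?I" "lad (Lfun (lad ?U))" ?I
            "transf_l M M ?I (lad ?U) (ident ?U)"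
          using I.B.left_adjoint_axioms lad[OF l.A'.L.module_functor_axioms]
            l.transf_l.module_nat_transf_axioms by (simp only: mate_def)
        define t where "t = transf_ll M M ?I ?I (lad ?U) (lad (Lfun (lad ?U))) (ident ?U)"
        have "t m \<in> hom M m (FO (Lfun (lad (Lfun (lad ?U)))) m)" if "m \<in> Obj M" for m
          using ll.transf_l.nat_hom[OF that] unfolding t_def transf_ll_def by simp
        moreover have "t \<in> extensional (Obj M)"
          by (simp add: t_def transf_ll_def)
        ultimately have "vcomp M M t (ident ?U) = t"
          by (auto intro!: extensionalityI[of _ "Obj M"])
        then show ?thesis unfolding t_def .
      qed
      ultimately show ?thesis
        using canonical_transf_change_adjoints[OF I.traced_double_adjoint_axioms lad_traced]
        by (simp add: fun_pivotal_eq)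
    qed
  qed
qed

end

theorem theorem4p5:
  fixes C :: "('c, 'k, 'y) fusion_cat_scheme" and a :: "'c \<Rightarrow> 'k"
    and M :: "('c, 'k, 'o, 'a, 'u) module_cat_scheme"
    and N :: "('c, 'k, 'p, 'b, 'v) module_cat_scheme"
    and E :: "('c, 'k, 'q, 'd, 'w) module_cat_scheme"
    and \<Theta>M :: "'o \<Rightarrow> 'a \<Rightarrow> complex" and \<Theta>N :: "'p \<Rightarrow> 'b \<Rightarrow> complex"
    and \<Theta>E :: "'q \<Rightarrow> 'd \<Rightarrow> complex"
  assumes "fusion_category C" and "pivotal_structure C a"
    and "module_category C M" and "module_trace C a M \<Theta>M"
    and "module_category C N" and "module_trace C a N \<Theta>N"
    and "module_category C E" and "module_trace C a E \<Theta>E"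
  shows
    "(\<forall>F A B. module_functor C M N F \<and>
        left_adjoint C M N F A \<and> left_adjoint C N M (Lfun A) B \<longrightarrow>
        module_nat_iso C M N F (Lfun B) (canonical_transf M N \<Theta>M \<Theta>N F A B)) \<and>
     (\<forall>F A B G A' B' \<rho>. module_functor C M N F \<and>
        left_adjoint C M N F A \<and> left_adjoint C N M (Lfun A) B \<and> module_functor C M N G \<and>
        left_adjoint C M N G A' \<and> left_adjoint C N M (Lfun A') B' \<and>
        module_nat_transf C M N F G \<rho> \<longrightarrow>
        vcomp M N (transf_ll M N A B A' B' \<rho>) (canonical_transf M N \<Theta>M \<Theta>N F A B) =
        vcomp M N (canonical_transf M N \<Theta>M \<Theta>N G A' B') \<rho>) \<and>
     (\<forall>F A B K A' B'. module_functor C M N F \<and>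
        left_adjoint C M N F A \<and> left_adjoint C N M (Lfun A) B \<and> module_functor C N E K \<and>
        left_adjoint C N E K A' \<and> left_adjoint C E N (Lfun A') B' \<longrightarrow>
        (let KF = mfun_comp E K F;
             AA = comp_ladj M E K A' F A;
             BB = comp_ladj E M (Lfun A) B (Lfun A') B'
         in left_adjoint C M E KF AA \<and> left_adjoint C E M (Lfun AA) BB \<and>
            Lfun BB = mfun_comp E (Lfun B') (Lfun B) \<and>
            canonical_transf M E \<Theta>M \<Theta>E KF AA BB =
            hcomp M E K (Lfun B)
              (canonical_transf N E \<Theta>N \<Theta>E K A' B') (canonical_transf M N \<Theta>M \<Theta>N F A B))) \<and>
     (\<forall>lad. (\<forall>F. module_functor C M M F \<longrightarrow> left_adjoint C M M F (lad F)) \<longrightarrow>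
        pivotal_structure (fun_cat C M lad) (fun_pivotal M \<Theta>M lad) \<and>
        (\<forall>z. z \<noteq> 0 \<longrightarrow> module_trace C a M (\<lambda>m f. z * \<Theta>M m f) \<and>
           (\<forall>F. module_functor C M M F \<longrightarrow>
              fun_pivotal M (\<lambda>m f. z * \<Theta>M m f) lad F = fun_pivotal M \<Theta>M lad F)))"
proof (intro conjI allI impI)
  fix F A B
  assume FAB: "module_functor C M N F \<and> left_adjoint C M N F A \<and> left_adjoint C N M (Lfun A) B"
  interpret traced_double_adjoint C a M N \<Theta>M \<Theta>N F A B
    using FAB assms by (simp add: traced_double_adjoint_def)
  show "module_nat_iso C M N F (Lfun B) (canonical_transf M N \<Theta>M \<Theta>N F A B)"
    by (rule canonical_module_nat_iso)
next
  fix F A B G A' B' \<rho>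
  assume "module_functor C M N F \<and>
      left_adjoint C M N F A \<and> left_adjoint C N M (Lfun A) B \<and> module_functor C M N G \<and>
      left_adjoint C M N G A' \<and> left_adjoint C N M (Lfun A') B' \<and> module_nat_transf C M N F G \<rho>"
  then show "vcomp M N (transf_ll M N A B A' B' \<rho>) (canonical_transf M N \<Theta>M \<Theta>N F A B) =
      vcomp M N (canonical_transf M N \<Theta>M \<Theta>N G A' B') \<rho>"
    using assms by (intro canonical_transf_natural[where C = C and a = a]) (simp_all add: traced_double_adjoint_def)
next
  fix F A B K A' B'
  assume FK: "module_functor C M N F \<and>
      left_adjoint C M N F A \<and> left_adjoint C N M (Lfun A) B \<and> module_functor C N E K \<and>
      left_adjoint C N E K A' \<and> left_adjoint C E N (Lfun A') B'"
  have F: "traced_double_adjoint C a M N \<Theta>M \<Theta>N F A B"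
    and K: "traced_double_adjoint C a N E \<Theta>N \<Theta>E K A' B'"
    using FK assms by (simp_all add: traced_double_adjoint_def)
  show "let KF = mfun_comp E K F;
           AA = comp_ladj M E K A' F A;
           BB = comp_ladj E M (Lfun A) B (Lfun A') B'
       in left_adjoint C M E KF AA \<and> left_adjoint C E M (Lfun AA) BB \<and>
          Lfun BB = mfun_comp E (Lfun B') (Lfun B) \<and>
          canonical_transf M E \<Theta>M \<Theta>E KF AA BB =
          hcomp M E K (Lfun B)
            (canonical_transf N E \<Theta>N \<Theta>E K A' B') (canonical_transf M N \<Theta>M \<Theta>N F A B)"
    using traced_double_adjoint_comp[OF F K] canonical_transf_comp[OF F K]
    by (simp add: traced_double_adjoint_def Let_def)
next
  fix lad
  assume lad: "\<forall>F. module_functor C M M F \<longrightarrow> left_adjoint C M M F (lad F)"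
  interpret traced_dual_category C a M \<Theta>M lad
    using lad assms(3,4) by (simp add: traced_dual_category_def dual_category_def dual_category_axioms_def)
  show "pivotal_structure (fun_cat C M lad) (fun_pivotal M \<Theta>M lad)"
    by (rule pivotal_structure_dual)
  fix z :: complex
  assume z: "z \<noteq> 0"
  show "module_trace C a M (\<lambda>m f. z * \<Theta>M m f)"
    using assms(4) z by (rule module_trace_rescale)
  fix F
  assume F: "module_functor C M M F"
  show "fun_pivotal M (\<lambda>m f. z * \<Theta>M m f) lad F = fun_pivotal M \<Theta>M lad F"
    using canonical_transf_rescale[OF lad_traced[OF F] z] by (simp add: fun_pivotal_def Let_def)
qed

end
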